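(* Let $\mathcal{C}=\mathcal{A}\oplus\mathcal{B}$ be a gluing of geometric polytopal $d$-complexes such that $\mathcal{A}\cap\mathcal{B}$ is a union of $m$ disjoint complexes homeomorphic to $(d-1)$-balls. Then $$\chi(\partial\mathcal{C})=\chi(\partial\mathcal{A})+\chi(\partial\mathcal{B})-m\left(1+(-1)^{d-1}\right)$$ and $$\chi_\alpha(\mathcal{C})=\chi_\alpha(\mathcal{A})+\chi_\alpha(\mathcal{B})-m(-1)^{d-1}.$$ In particular, if $d$ is odd, then $\chi(\partial\mathcal{C})-\chi(\partial\mathcal{A})-\chi(\partial\mathcal{B})=2\left(\chi_\alpha(\mathcal{C})-\chi_\alpha(\mathcal{A})-\chi_\alpha(\mathcal{B})\right)$; if $d$ is even (and $m\geq 1$), then $\chi_\alpha(\mathcal{C})>\chi_\alpha(\mathcal{A})+\chi_\alpha(\mathcal{B})$ while $\chi(\partial\mathcal{C})=\chi(\partial\mathcal{A})+\chi(\partial\mathcal{B})$.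
   Context: A polytopal complex is a finite collection of convex polytopes, closed under taking faces, such that the intersection of any two members is a face of both. A geometric polytopal $d$-complex $\mathcal{C}$ is a polytopal complex that is connected, pure of dimension $d$, and embedded in $\mathbb{R}^d$ (its cells are actual convex polytopes in $\mathbb{R}^d$). $|\mathcal{C}|$ is the union of the cells, $\mathrm{int}(\mathcal{C})$ its $d$-dimensional interior, and $\partial\mathcal{C}$ the complex of boundary faces. For a nonempty $F\in\partial\mathcal{C}$, $\alpha(F,\mathcal{C})=\mathrm{vol}(S_\varepsilon(x)\cap\mathrm{int}(\mathcal{C}))/\mathrm{vol}(S_\varepsilon(x))$, with $x$ in the relative interior of $F$ and $S_\varepsilon(x)$ the $(d-1)$-sphere of radius $\varepsilon$ centered at $x$, $\varepsilon>0$ sufficiently small. For $0\le i\le d-1$, $\alpha_i(\mathcal{C})=\sum\alpha(F,\mathcal{C})$ over all $i$-faces $F$ of $\partial\mathcal{C}$; $\chi_\alpha(\mathcal{C})=\sum_{i=0}^{d-1}(-1)^i\alpha_i(\mathcal{C})$, and $\chi(\partial\mathcal{C})=\sum_{i=0}^{d-1}(-1)^if_i(\partial\mathcal{C})$ with $f_i$ the number of $i$-faces. A gluing $\mathcal{C}=\mathcal{A}\oplus\mathcal{B}$ means $\mathcal{C}=\mathcal{A}\cup\mathcal{B}$, where the $d$-complexes $\mathcal{A},\mathcal{B}$ meet exactly along a common subcomplex $\mathcal{A}\cap\mathcal{B}$ contained in both $\partial\mathcal{A}$ and $\partial\mathcal{B}$.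
   Formalization: The formal theorem also assumes that the interior of each glued (d-1)-ball is relatively open in the boundaries of A and of B (no pinching there); without it the claim fails, e.g. two triangles sharing only a vertex glued onto two adjacent squares in the plane. *)

theory Defs
  imports "HOL-Analysis.Analysis"
begin

text \<open>
  Complexes are sets of cells in a Euclidean space \<open>'a\<close>, whose dimension \<open>DIM('a)\<close> is the
  dimension \<open>d\<close> of the complexes. As \<open>face_of\<close> counts the empty set as a face, every nonempty
  complex contains the cell \<open>{}\<close>. It has \<^term>\<open>aff_dim {} = -1\<close>, so that the sums over faces of
  dimension \<open>0, \<dots>, d - 1\<close> below do not see it.
\<close>

definition polytopal_complex :: "'a::euclidean_space set set \<Rightarrow> bool" where
  "polytopal_complex K \<longleftrightarrow>
     finite K \<and>
     (\<forall>P\<in>K. polytope P) \<and>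
     (\<forall>P\<in>K. \<forall>F. F face_of P \<longrightarrow> F \<in> K) \<and>
     (\<forall>P\<in>K. \<forall>Q\<in>K. (P \<inter> Q) face_of P \<and> (P \<inter> Q) face_of Q)"

definition geometric_complex :: "'a::euclidean_space set set \<Rightarrow> bool" where
  "geometric_complex K \<longleftrightarrow>
     polytopal_complex K \<and> K \<noteq> {} \<and> connected (\<Union>K) \<and>
     (\<forall>P\<in>K. \<exists>Q\<in>K. P \<subseteq> Q \<and> aff_dim Q = int DIM('a))"

definition bdry :: "'a::euclidean_space set set \<Rightarrow> 'a set set" where
  "bdry K = {F \<in> K. F \<subseteq> frontier (\<Union>K)}"

definition faces_dim :: "nat \<Rightarrow> 'a::euclidean_space set set \<Rightarrow> 'a set set" where
  "faces_dim i K = {F \<in> K. aff_dim F = int i}"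

text \<open>
  Applied to a boundary complex, which has no cells of dimension \<open>d\<close>, this is the full
  alternating sum of the face numbers.
\<close>

definition euler_char :: "'a::euclidean_space set set \<Rightarrow> int" where
  "euler_char K = (\<Sum>i<DIM('a). (-1) ^ i * int (card (faces_dim i K)))"

text \<open>
  The \<open>(d - 1)\<close>-dimensional volume of a subset \<open>S\<close> of the sphere of radius \<open>r\<close> around \<open>x\<close>: the
  cone over \<open>S\<close> with apex \<open>x\<close> has \<open>d\<close>-dimensional volume \<open>r / d\<close> times the area of \<open>S\<close>.
\<close>

definition sphere_vol :: "'a::euclidean_space \<Rightarrow> real \<Rightarrow> 'a set \<Rightarrow> real" where
  "sphere_vol x r S =
     real DIM('a) / r *
     measure lebesgue {x + t *\<^sub>R (y - x) | t y. 0 \<le> t \<and> t \<le> 1 \<and> y \<in> S}"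

lemma sphere_vol_sphere:
  fixes x :: "'a::euclidean_space"
  assumes "r > 0"
  shows "sphere_vol x r (sphere x r) =
           real DIM('a) * unit_ball_vol (real DIM('a)) * r ^ (DIM('a) - 1)"
proof -
  have "{x + t *\<^sub>R (y - x) | t y. 0 \<le> t \<and> t \<le> 1 \<and> y \<in> sphere x r} = cball x r"
    (is "?L = _")
  proof (intro equalityI subsetI)
    fix z assume "z \<in> ?L"
    then obtain t y where z: "z = x + t *\<^sub>R (y - x)" "0 \<le> t" "t \<le> 1" "dist x y = r"
      by auto
    have "dist x z = t * r"
      using z by (simp add: dist_norm norm_minus_commute)
    also have "\<dots> \<le> r"
      using z assms by (simp add: mult_left_le_one_le)
    finally show "z \<in> cball x r" by simp
  next
    fix z assume z: "z \<in> cball x r"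
    show "z \<in> ?L"
    proof (cases "z = x")
      case True
      obtain y where "y \<in> sphere x r"
        using vector_choose_dist[of r x] assms by auto
      then show ?thesis
        using True by (intro CollectI exI[of _ "0::real"] exI[of _ y]) auto
    next
      case False
      define n where "n = norm (z - x)"
      have n: "n > 0" "n \<le> r"
        using False z by (auto simp: n_def dist_norm norm_minus_commute)
      have "x + (r / n) *\<^sub>R (z - x) \<in> sphere x r"
        using n assms by (simp add: dist_norm n_def)
      moreover have "z = x + (n / r) *\<^sub>R (x + (r / n) *\<^sub>R (z - x) - x)"
        using n assms by simp
      ultimately show ?thesis
        using n assms
        by (intro CollectI exI[of _ "n / r"] exI[of _ "x + (r / n) *\<^sub>R (z - x)"]) auto
    qed
  qed
  moreover have "r ^ DIM('a) = r * r ^ (DIM('a) - 1)"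
    using DIM_positive[where 'a='a] by (metis power_minus_mult mult.commute)
  ultimately show ?thesis
    using assms by (simp add: sphere_vol_def content_cball)
qed

text \<open>
  For a nonempty boundary face the quotient is the same for all points \<open>x\<close> of the relative
  interior and all sufficiently small radii; the solid angle is this common value.
\<close>

definition solid_angle :: "'a::euclidean_space set \<Rightarrow> 'a set set \<Rightarrow> real" where
  "solid_angle F K =
     (THE a. \<forall>x\<in>rel_interior F. \<forall>\<^sub>F r in at_right 0.
        sphere_vol x r (sphere x r \<inter> interior (\<Union>K)) / sphere_vol x r (sphere x r) = a)"

definition angle_sum :: "nat \<Rightarrow> 'a::euclidean_space set set \<Rightarrow> real" where
  "angle_sum i K = (\<Sum>F\<in>faces_dim i (bdry K). solid_angle F K)"

definition angle_char :: "'a::euclidean_space set set \<Rightarrow> real" where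
  "angle_char K = (\<Sum>i<DIM('a). (-1) ^ i * angle_sum i K)"

definition gluing ::
    "'a::euclidean_space set set \<Rightarrow> 'a set set \<Rightarrow> 'a set set \<Rightarrow> bool" where
  "gluing C A B \<longleftrightarrow>
     geometric_complex A \<and> geometric_complex B \<and> C = A \<union> B \<and>
     \<Union>A \<inter> \<Union>B = \<Union>(A \<inter> B) \<and> A \<inter> B \<subseteq> bdry A \<and> A \<inter> B \<subseteq> bdry B"

text \<open>
  \<open>X\<close> is homeomorphic to a \<open>(d - 1)\<close>-ball, with \<open>X\<^sub>0\<close> corresponding to the open ball. The
  model is the unit ball of a coordinate hyperplane, a single point if \<open>d = 1\<close>.
\<close>

definition codim1_ball :: "'a::euclidean_space set \<Rightarrow> 'a set \<Rightarrow> bool" where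
  "codim1_ball X X\<^sub>0 \<longleftrightarrow>
     (\<exists>b\<in>Basis. \<exists>f g.
        homeomorphism (cball 0 1 \<inter> {x::'a. x \<bullet> b = 0}) X f g \<and>
        X\<^sub>0 = f ` (ball 0 1 \<inter> {x. x \<bullet> b = 0}))"

text \<open>
  No other part of the boundary of \<open>K\<close> touches the interior \<open>X\<^sub>0\<close> of a \<open>(d - 1)\<close>-ball in the
  boundary. By invariance of domain this is automatic if the boundary is a \<open>(d - 1)\<close>-manifold.
  Gluing along a ball with a pinch in its interior behaves differently. Let \<open>p, x, q\<close> be
  consecutive points of a line in the plane, let \<open>B\<close> consist of two squares below the segments
  \<open>px\<close> and \<open>xq\<close>, and let \<open>A\<close> consist of two triangles above these segments that have only \<open>x\<close>
  in common. Then \<open>A\<close> and \<open>B\<close> meet in the segment \<open>pq\<close>, but its interior point \<open>x\<close> remains a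
  boundary vertex of \<open>A \<union> B\<close>. The Euler characteristics of the boundaries of \<open>A\<close>, \<open>B\<close> and
  \<open>A \<union> B\<close> are \<open>-1\<close>, \<open>0\<close> and \<open>0\<close>, so they are not additive.
\<close>

definition unpinched_along :: "'a::euclidean_space set set \<Rightarrow> 'a set \<Rightarrow> bool" where
  "unpinched_along K X\<^sub>0 \<longleftrightarrow> openin (top_of_set (\<Union>(bdry K))) X\<^sub>0"

end

(*
  Cutting along a disc changes the boundary only in the faces interior to the disc and those on its
  rim, and solid angles at a common face add up, to 1 if the face becomes interior. So everything
  reduces to the alternating sums over all faces of a disc and over its interior faces, which are 1
  and (-1)^(d-1). These are Euler characteristics of a ball and of a sphere, read off from the ranks
  of singular homology groups by attaching cells in order of dimension.

  Two topological facts identify the faces that become interior. (1) A point of the open disc is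
  interior to the union: near it the frontier of the union contains no (d-1)-faces, since at those
  the two complexes lie on opposite sides, and a set of codimension 2 does not separate a ball, by a
  generic segment. (2) A point of the rim is not: otherwise the disc would separate the two
  complexes near it. But two points close to it are not separated by the disc with a small cap at
  the rim point removed. As the disc retracts to this smaller disc, by Borsuk's criterion the disc
  itself does not separate them either.
*)
theory Submission
  imports Defs "HOL-Homology.Homology"
begin

section \<open>Rank of abelian groups\<close>

text \<open>Nothing is known about the cell structure of a glued disc: it need be neither shellable
  nor collapsible, and its rim is not assumed to be a subcomplex. Its alternating sums therefore
  have to come from a topological invariant. The homology groups have integer coefficients and may a
  priori have torsion, so ranks are developed directly for abelian groups, and each rank must be
  shown to be finite before it is used. That the rim is a union of cells is a consequence of facts
  (1) and (2): together they say that the boundary of the union meets the disc exactly in the rim,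
  and membership of a cell in the boundary is decided at any one point of its relative interior. The
  same homogeneity along a cell makes solid angles well defined. The absence of pinches enters in
  fact (1); fact (2) relies instead on the other discs staying at a positive distance.\<close>

lemma integer_kernel_nontrivial:
  fixes a :: "'j \<Rightarrow> nat \<Rightarrow> int"
  assumes "finite J" "n < card J"
  shows "\<exists>c. (\<exists>j\<in>J. c j \<noteq> 0) \<and> (\<forall>i<n. (\<Sum>j\<in>J. c j * a j i) = 0)"
  using assms
proof (induction n arbitrary: J a)
  case 0
  then obtain j where "j \<in> J" by fastforce
  then show ?case by (intro exI[of _ "\<lambda>_. 1"]) auto
next
  case (Suc n)
  show ?case
  proof (cases "\<forall>j\<in>J. a j n = 0")
    case True
    obtain c where c: "\<exists>j\<in>J. c j \<noteq> 0" "\<forall>i<n. (\<Sum>j\<in>J. c j * a j i) = 0"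
      using Suc.IH[of J a] Suc.prems by auto
    have "(\<Sum>j\<in>J. c j * a j i) = 0" if "i < Suc n" for i
      using that c(2) True by (cases "i = n") auto
    then show ?thesis using c(1) by blast
  next
    case False
    then obtain j0 where j0: "j0 \<in> J" "a j0 n \<noteq> 0" by blast
    define J' where "J' = J - {j0}"
    have J': "finite J'" "n < card J'" "j0 \<notin> J'" "J = insert j0 J'"
      using Suc.prems j0 by (auto simp: J'_def)
    \<comment> \<open>Fraction-free elimination of the unknown \<open>j0\<close>:
      cross-multiplication with the pivot \<open>a j0 n\<close> keeps the entries integral, and
      \<open>b j n\<close> vanishes for every \<open>j\<close>.\<close>
    define b where "b = (\<lambda>j i. a j0 n * a j i - a j n * a j0 i)"
    obtain c where c: "\<exists>j\<in>J'. c j \<noteq> 0" "\<forall>i<n. (\<Sum>j\<in>J'. c j * b j i) = 0"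
      using Suc.IH[of J' b] J' by blast
    have all: "(\<Sum>j\<in>J'. c j * b j i) = 0" if "i < Suc n" for i
      using c(2) that by (cases "i = n") (auto simp: b_def)
    \<comment> \<open>Back substitution. The other unknowns are scaled by the pivot, so that the
      value which equation \<open>n\<close> forces on \<open>j0\<close> is an integer.\<close>
    define e where "e = (\<lambda>j. if j = j0 then - (\<Sum>j\<in>J'. c j * a j n) else a j0 n * c j)"
    have "(\<Sum>j\<in>J. e j * a j i) = 0" if "i < Suc n" for i
    proof -
      have "(\<Sum>j\<in>J. e j * a j i) = - (\<Sum>j\<in>J'. c j * a j n) * a j0 i + (\<Sum>j\<in>J'. e j * a j i)"
        using J' by (simp add: e_def)
      also have "(\<Sum>j\<in>J'. e j * a j i) = (\<Sum>j\<in>J'. a j0 n * c j * a j i)"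
        using J'(3) by (intro sum.cong) (auto simp: e_def)
      also have "- (\<Sum>j\<in>J'. c j * a j n) * a j0 i + (\<Sum>j\<in>J'. a j0 n * c j * a j i)
          = (\<Sum>j\<in>J'. c j * b j i)"
        by (simp add: b_def sum_distrib_left algebra_simps sum_subtractf)
      finally show ?thesis using all[OF that] by simp
    qed
    moreover have "\<exists>j\<in>J. e j \<noteq> 0"
      using c(1) J' j0 by (auto simp: e_def)
    ultimately show ?thesis by blast
  qed
qed

primrec int_comb :: "('g, 'm) monoid_scheme \<Rightarrow> (nat \<Rightarrow> 'g) \<Rightarrow> (nat \<Rightarrow> int) \<Rightarrow> nat \<Rightarrow> 'g" where
  "int_comb G x c 0 = \<one>\<^bsub>G\<^esub>"
| "int_comb G x c (Suc n) = int_comb G x c n \<otimes>\<^bsub>G\<^esub> (x n [^]\<^bsub>G\<^esub> c n)"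

lemma int_comb_cong:
  "\<lbrakk>\<And>i. i < n \<Longrightarrow> x i = y i; \<And>i. i < n \<Longrightarrow> c i = d i\<rbrakk> \<Longrightarrow> int_comb G x c n = int_comb G y d n"
  by (induction n) auto

lemma (in group) int_comb_zero:
  "(\<And>i. i < n \<Longrightarrow> c i = 0) \<Longrightarrow> int_comb G x c n = \<one>"
  by (induction n) auto

lemma (in group) int_comb_closed [simp, intro]:
  "(\<And>i. i < n \<Longrightarrow> x i \<in> carrier G) \<Longrightarrow> int_comb G x c n \<in> carrier G"
  by (induction n) auto

lemma (in comm_group) int_comb_add:
  "(\<And>i. i < n \<Longrightarrow> x i \<in> carrier G) \<Longrightarrow>
     int_comb G x (\<lambda>i. c i + d i) n = int_comb G x c n \<otimes> int_comb G x d n"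
  by (induction n) (auto simp: int_pow_mult m_ac)

lemma (in comm_group) int_comb_mult:
  "(\<And>i. i < n \<Longrightarrow> x i \<in> carrier G) \<Longrightarrow>
     int_comb G x (\<lambda>i. c i * k) n = int_comb G x c n [^] (k::int)"
  by (induction n) (auto simp: int_pow_pow int_pow_distrib)

lemma (in comm_group) int_comb_pow:
  "(\<And>i. i < n \<Longrightarrow> x i \<in> carrier G) \<Longrightarrow>
     int_comb G (\<lambda>i. x i [^] (k i::int)) c n = int_comb G x (\<lambda>i. k i * c i) n"
  by (induction n) (auto simp: int_pow_pow)

lemma int_comb_hom:
  assumes "h \<in> hom G H" "group G" "group H" "\<And>i. i < n \<Longrightarrow> x i \<in> carrier G"
  shows "h (int_comb G x c n) = int_comb H (\<lambda>i. h (x i)) c n"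
proof -
  interpret group_hom G H h
    using assms by (simp add: group_hom_def group_hom_axioms_def)
  show ?thesis
    using assms(4) by (induction n) (auto simp: hom_int_pow)
qed

text \<open>Substituting combinations into a combination multiplies coefficient matrices; this turns
  relations in the group into linear systems over the integers.\<close>

lemma (in comm_group) int_comb_comb:
  assumes "\<And>i. i < n \<Longrightarrow> x i \<in> carrier G"
  shows "int_comb G (\<lambda>j. int_comb G x (a j) n) c m = int_comb G x (\<lambda>i. \<Sum>j<m. c j * a j i) n"
proof (induction m)
  case 0
  then show ?case by (simp add: int_comb_zero)
next
  case (Suc m)
  have "int_comb G x (\<lambda>i. \<Sum>j<Suc m. c j * a j i) n
      = int_comb G x (\<lambda>i. (\<Sum>j<m. c j * a j i) + a m i * c m) n"
    by (rule int_comb_cong) (auto simp: mult.commute)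
  then show ?case
    using Suc assms by (simp add: int_comb_add int_comb_mult)
qed

lemma (in comm_group) int_comb_append:
  assumes "\<And>i. i < m \<Longrightarrow> x i \<in> carrier G" "\<And>i. i < n \<Longrightarrow> y i \<in> carrier G"
  shows "int_comb G (\<lambda>i. if i < m then x i else y (i - m)) c (m + n)
       = int_comb G x c m \<otimes> int_comb G y (\<lambda>i. c (m + i)) n"
  using assms(2)
proof (induction n)
  case 0
  have "int_comb G (\<lambda>i. if i < m then x i else y (i - m)) c m = int_comb G x c m"
    by (rule int_comb_cong) auto
  then show ?case using assms by (simp add: int_comb_closed)
next
  case (Suc n)
  then show ?case using assms by (simp add: int_comb_closed m_assoc)
qed

text \<open>Independence over the integers, which excludes torsion elements. The set
  \<open>K\<close> is kept apart from the ambient group \<open>G\<close>, so that kernels and images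
  need not be made into groups of their own.\<close>

definition indep_family :: "('g, 'm) monoid_scheme \<Rightarrow> 'g set \<Rightarrow> (nat \<Rightarrow> 'g) \<Rightarrow> nat \<Rightarrow> bool" where
  "indep_family G K x n \<longleftrightarrow> (\<forall>i<n. x i \<in> K) \<and> (\<forall>c. int_comb G x c n = \<one>\<^bsub>G\<^esub> \<longrightarrow> (\<forall>i<n. c i = 0))"

lemma indep_familyD:
  "\<lbrakk>indep_family G K x n; int_comb G x c n = \<one>\<^bsub>G\<^esub>; i < n\<rbrakk> \<Longrightarrow> c i = 0"
  by (simp add: indep_family_def)

text \<open>The exponent \<open>k \<noteq> 0\<close> means that torsion is disregarded.\<close>

definition has_rank :: "('g, 'm) monoid_scheme \<Rightarrow> 'g set \<Rightarrow> nat \<Rightarrow> bool" where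
  "has_rank G K n \<longleftrightarrow> (\<exists>x. indep_family G K x n \<and>
     (\<forall>g\<in>K. \<exists>k::int. k \<noteq> 0 \<and> (\<exists>c. g [^]\<^bsub>G\<^esub> k = int_comb G x c n)))"

text \<open>Steinitz exchange in integral form. Nonzero powers of the \<open>y j\<close> are
  combinations of the \<open>x i\<close>; with more \<open>y j\<close> than \<open>x i\<close>, a
  nontrivial solution of the resulting integer system would be a relation between the
  \<open>y j\<close>.\<close>

lemma (in comm_group) indep_family_le_rank:
  assumes K: "subgroup K G" and "has_rank G K n" "indep_family G K y m"
  shows "m \<le> n"
proof (rule ccontr)
  assume "\<not> m \<le> n"
  obtain x where x: "\<forall>i<n. x i \<in> K" and
    sp: "\<forall>g\<in>K. \<exists>k::int. k \<noteq> 0 \<and> (\<exists>c. g [^] k = int_comb G x c n)"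
    using assms(2) by (auto simp: has_rank_def indep_family_def)
  have "\<forall>j. \<exists>k c. j < m \<longrightarrow> (k::int) \<noteq> 0 \<and> y j [^] k = int_comb G x c n"
    using sp assms(3) by (meson indep_family_def)
  then obtain k a where ka: "\<And>j. j < m \<Longrightarrow> (k j::int) \<noteq> 0 \<and> y j [^] k j = int_comb G x (a j) n"
    by metis
  obtain c where c: "\<exists>j\<in>{..<m}. c j \<noteq> 0" "\<forall>i<n. (\<Sum>j<m. c j * a j i) = 0"
    using integer_kernel_nontrivial[of "{..<m}" n a] \<open>\<not> m \<le> n\<close> by auto
  have xG: "\<And>i. i < n \<Longrightarrow> x i \<in> carrier G" and yG: "\<And>i. i < m \<Longrightarrow> y i \<in> carrier G"
    using x assms(3) subgroup.subset[OF K] by (auto simp: indep_family_def)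
  have "int_comb G y (\<lambda>i. k i * c i) m = int_comb G (\<lambda>j. y j [^] k j) c m"
    using int_comb_pow[OF yG] by simp
  also have "\<dots> = int_comb G (\<lambda>j. int_comb G x (a j) n) c m"
    using ka by (intro int_comb_cong) auto
  also have "\<dots> = \<one>"
    using int_comb_comb[OF xG] int_comb_zero c(2) by simp
  finally have "\<forall>i<m. k i * c i = 0"
    using assms(3) unfolding indep_family_def by blast
  then show False using ka c(1) by fastforce
qed

lemma (in comm_group) has_rank_unique:
  "\<lbrakk>subgroup K G; has_rank G K m; has_rank G K n\<rbrakk> \<Longrightarrow> m = n"
  by (meson has_rank_def indep_family_le_rank le_antisym)

text \<open>A maximal independent family generates up to torsion: adding \<open>g\<close> to it
  produces a relation.\<close>

lemma (in comm_group) has_rank_exists: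
  assumes K: "subgroup K G" and bd: "\<And>x m. indep_family G K x m \<Longrightarrow> m \<le> n"
  shows "\<exists>r. has_rank G K r"
proof -
  define M where "M = {m. \<exists>x. indep_family G K x m}"
  have "finite M" using bd by (auto simp: M_def intro: finite_subset[of _ "{..n}"])
  moreover have "0 \<in> M" by (auto simp: M_def indep_family_def)
  ultimately have max: "Max M \<in> M" "\<And>m. m \<in> M \<Longrightarrow> m \<le> Max M"
    by (auto intro: Max_in)
  define r where "r = Max M"
  obtain x where x: "indep_family G K x r" using max(1) by (auto simp: M_def r_def)
  have xG: "\<And>i. i < r \<Longrightarrow> x i \<in> carrier G"
    using x subgroup.subset[OF K] by (auto simp: indep_family_def)
  have "\<exists>k::int. k \<noteq> 0 \<and> (\<exists>c. g [^] k = int_comb G x c r)" if g: "g \<in> K" for g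
  proof -
    have gG: "g \<in> carrier G" using g subgroup.subset[OF K] by auto
    define y where "y = (\<lambda>i. if i < r then x i else g)"
    have yx: "int_comb G y c r = int_comb G x c r" for c
      by (rule int_comb_cong) (auto simp: y_def)
    have "\<not> indep_family G K y (Suc r)"
      using max(2)[of "Suc r"] by (auto simp: M_def r_def)
    then obtain c i where c: "int_comb G y c (Suc r) = \<one>" "i < Suc r" "c i \<noteq> 0"
      using x g by (auto simp: indep_family_def y_def split: if_splits)
    have eq: "int_comb G x c r \<otimes> g [^] c r = \<one>"
      using c(1) yx by (simp add: y_def)
    \<comment> \<open>Otherwise the relation would involve the independent \<open>x i\<close>
      alone.\<close>
    have "c r \<noteq> 0"
    proof
      assume "c r = 0"
      then have "int_comb G x c r = \<one>" using eq xG by simp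
      then show False using x c \<open>c r = 0\<close> less_Suc_eq by (auto simp: indep_family_def)
    qed
    moreover have "g [^] c r = inv (int_comb G x c r)"
      using eq xG gG by (metis inv_comm inv_equality int_comb_closed int_pow_closed)
    then have "g [^] c r = int_comb G x (\<lambda>i. c i * (-1)) r"
      using int_comb_mult[OF xG, where k="-1"] int_comb_closed[OF xG] by (simp add: int_pow_neg)
    ultimately show ?thesis by blast
  qed
  then show ?thesis using x unfolding has_rank_def by blast
qed

lemma (in comm_group) has_rank_subgroup:
  assumes "subgroup K G" "subgroup L G" "K \<subseteq> L" "has_rank G L n"
  shows "\<exists>r. has_rank G K r"
proof (rule has_rank_exists)
  fix x m assume "indep_family G K x m"
  then have "indep_family G L x m" using assms(3) by (auto simp: indep_family_def)
  then show "m \<le> n" using indep_family_le_rank assms by blast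
qed (use assms in auto)

text \<open>Preimages of an independent family are independent, so the rank of the domain bounds the
  families in the image.\<close>

lemma has_rank_image:
  assumes G: "comm_group G" and H: "comm_group H" and h: "h \<in> hom G H" and n: "has_rank G (carrier G) n"
  shows "\<exists>r. has_rank H (h ` carrier G) r"
proof -
  interpret G: comm_group G by fact
  interpret H: comm_group H by fact
  interpret group_hom G H h
    using h by (simp add: group_hom_def group_hom_axioms_def G.is_group H.is_group)
  show ?thesis
  proof (rule H.has_rank_exists)
    show "subgroup (h ` carrier G) H" by (simp add: img_is_subgroup)
    fix x m assume x: "indep_family H (h ` carrier G) x m"
    then have "\<forall>i. \<exists>y. i < m \<longrightarrow> y \<in> carrier G \<and> h y = x i"
      by (auto simp: indep_family_def image_iff) metis
    then obtain y where y: "\<And>i. i < m \<Longrightarrow> y i \<in> carrier G \<and> h (y i) = x i" by metis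
    have "indep_family G (carrier G) y m"
    proof (unfold indep_family_def, intro conjI allI impI)
      fix c i assume "int_comb G y c m = \<one>\<^bsub>G\<^esub>" "i < m"
      then have "int_comb H (\<lambda>i. h (y i)) c m = \<one>\<^bsub>H\<^esub>"
        using int_comb_hom[OF h, of m y c] y by simp
      moreover have "int_comb H (\<lambda>i. h (y i)) c m = int_comb H x c m"
        using y by (intro int_comb_cong) auto
      ultimately show "c i = 0" using x \<open>i < m\<close> by (auto simp: indep_family_def)
    qed (use y in auto)
    then show "m \<le> n"
      using G.indep_family_le_rank n G.subgroup_self by blast
  qed
qed

text \<open>Rank-nullity: a family for the kernel is concatenated with lifts of one for the image.
  This is what turns exactness into equations between ranks.\<close>

lemma has_rank_kernel_image:
  assumes G: "comm_group G" and H: "comm_group H" and h: "h \<in> hom G H"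
    and r: "has_rank G (kernel G H h) r" and s: "has_rank H (h ` carrier G) s"
  shows "has_rank G (carrier G) (r + s)"
proof -
  interpret G: comm_group G by fact
  interpret H: comm_group H by fact
  interpret group_hom G H h
    using h by (simp add: group_hom_def group_hom_axioms_def G.is_group H.is_group)
  have kerG: "kernel G H h \<subseteq> carrier G" by (auto simp: kernel_def)
  obtain u where u: "indep_family G (kernel G H h) u r"
    and usp: "\<forall>g\<in>kernel G H h. \<exists>k::int. k \<noteq> 0 \<and> (\<exists>c. g [^]\<^bsub>G\<^esub> k = int_comb G u c r)"
    using r by (auto simp: has_rank_def)
  obtain w where w: "indep_family H (h ` carrier G) w s"
    and wsp: "\<forall>g\<in>h ` carrier G. \<exists>k::int. k \<noteq> 0 \<and> (\<exists>c. g [^]\<^bsub>H\<^esub> k = int_comb H w c s)"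
    using s by (auto simp: has_rank_def)
  have "\<forall>i. \<exists>y. i < s \<longrightarrow> y \<in> carrier G \<and> h y = w i"
    using w by (auto simp: indep_family_def image_iff) metis
  then obtain v where v: "\<And>i. i < s \<Longrightarrow> v i \<in> carrier G \<and> h (v i) = w i" by metis
  have uG: "u i \<in> carrier G" "h (u i) = \<one>\<^bsub>H\<^esub>" if "i < r" for i
    using u that by (auto simp: indep_family_def kernel_def)
  have hv: "h (int_comb G v c s) = int_comb H w c s" for c
    using int_comb_hom[OF h, of s v c] v int_comb_cong[of s "\<lambda>i. h (v i)" w c c H] by simp
  have hu: "h (int_comb G u c r) = \<one>\<^bsub>H\<^esub>" for c
  proof -
    have "int_comb H (\<lambda>i. h (u i)) c k = \<one>\<^bsub>H\<^esub>" if "k \<le> r" for k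
      using that by (induction k) (auto simp: uG)
    then show ?thesis using int_comb_hom[OF h, of r u c] uG by simp
  qed
  define x where "x = (\<lambda>i. if i < r then u i else v (i - r))"
  have comb: "int_comb G x c (r + s) = int_comb G u c r \<otimes>\<^bsub>G\<^esub> int_comb G v (\<lambda>i. c (r + i)) s" for c
    unfolding x_def using G.int_comb_append[of r u s v c] uG v by blast
  have ucl: "int_comb G u c r \<in> carrier G" and vcl: "int_comb G v c s \<in> carrier G" for c
    using uG v by auto
  have "indep_family G (carrier G) x (r + s)"
  proof (unfold indep_family_def, intro conjI allI impI)
    fix i assume "i < r + s" then show "x i \<in> carrier G" using uG v by (auto simp: x_def)
  next
    fix c i assume eq: "int_comb G x c (r + s) = \<one>\<^bsub>G\<^esub>" and i: "i < r + s"
    have "h (int_comb G x c (r + s)) = h (int_comb G v (\<lambda>i. c (r + i)) s)"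
      unfolding comb hom_mult[OF ucl vcl] hu using hom_closed[OF vcl] by simp
    then have "int_comb H w (\<lambda>i. c (r + i)) s = \<one>\<^bsub>H\<^esub>"
      by (simp add: eq hv)
    then have ws: "c (r + i) = 0" if "i < s" for i
      using indep_familyD[OF w, where c = "\<lambda>i. c (r + i)"] that by blast
    have "int_comb G v (\<lambda>i. c (r + i)) s = \<one>\<^bsub>G\<^esub>"
      by (rule G.int_comb_zero) (rule ws)
    then have "int_comb G u c r = \<one>\<^bsub>G\<^esub>" using comb eq ucl by simp
    then have us: "c i = 0" if "i < r" for i using indep_familyD[OF u] that by blast
    show "c i = 0" using us ws[of "i - r"] i by (cases "i < r") auto
  qed
  moreover have "\<exists>k::int. k \<noteq> 0 \<and> (\<exists>c. g [^]\<^bsub>G\<^esub> k = int_comb G x c (r + s))" if g: "g \<in> carrier G" for g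
  proof -
    obtain k c where k: "k \<noteq> 0" "h g [^]\<^bsub>H\<^esub> (k::int) = int_comb H w c s"
      using wsp g by blast
    \<comment> \<open>A power of \<open>h g\<close> is a combination of the \<open>w i\<close>.
      Dividing the same power of \<open>g\<close> by the lifted combination lands in the kernel,
      where a further power \<open>l\<close> is a combination of the \<open>u i\<close>.\<close>
    define g' where "g' = g [^]\<^bsub>G\<^esub> k \<otimes>\<^bsub>G\<^esub> inv\<^bsub>G\<^esub> (int_comb G v c s)"
    have "g' \<in> carrier G" using g vcl by (simp add: g'_def)
    moreover have "h g' = \<one>\<^bsub>H\<^esub>"
      using k g vcl H.r_inv[OF hom_closed[OF vcl]] by (simp add: g'_def hom_int_pow hv)
    ultimately obtain l e where l: "l \<noteq> 0" "g' [^]\<^bsub>G\<^esub> (l::int) = int_comb G u e r"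
      using usp by (auto simp: kernel_def)
    have "g [^]\<^bsub>G\<^esub> k = g' \<otimes>\<^bsub>G\<^esub> int_comb G v c s"
      using g vcl by (simp add: g'_def G.m_assoc)
    then have "g [^]\<^bsub>G\<^esub> (k * l) = (g' \<otimes>\<^bsub>G\<^esub> int_comb G v c s) [^]\<^bsub>G\<^esub> l"
      using g by (metis G.int_pow_pow)
    also have "\<dots> = int_comb G u e r \<otimes>\<^bsub>G\<^esub> int_comb G v (\<lambda>i. c i * l) s"
      using l \<open>g' \<in> carrier G\<close> vcl v by (simp add: G.int_pow_distrib G.int_comb_mult)
    also have "\<dots> = int_comb G x (\<lambda>i. if i < r then e i else c (i - r) * l) (r + s)"
      unfolding comb by (intro arg_cong2[of _ _ _ _ "monoid.mult G"] int_comb_cong) auto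
    finally show ?thesis using k l by (metis mult_eq_0_iff)
  qed
  ultimately show ?thesis by (auto simp: has_rank_def)
qed

lemma has_rank_trivial:
  assumes "group G"
  shows "has_rank G {\<one>\<^bsub>G\<^esub>} 0"
proof -
  interpret group G by fact
  show ?thesis by (auto simp: has_rank_def indep_family_def intro!: exI[of _ "1::int"])
qed

lemma has_rank_iso:
  assumes G: "comm_group G" and H: "comm_group H" and "G \<cong> H" and "has_rank G (carrier G) n"
  shows "has_rank H (carrier H) n"
proof -
  interpret G: comm_group G by fact
  interpret H: comm_group H by fact
  obtain h where "h \<in> iso H G" using \<open>G \<cong> H\<close> G.iso_sym by (auto simp: is_iso_def)
  then have h: "h \<in> hom H G" "inj_on h (carrier H)" "h ` carrier H = carrier G"
    by (auto simp: iso_def bij_betw_def)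
  interpret group_hom H G h
    using h by (simp add: group_hom_def group_hom_axioms_def G.is_group H.is_group)
  have "kernel H G h = {\<one>\<^bsub>H\<^esub>}"
    using h(2) inj_iff_trivial_ker by blast
  then show ?thesis
    using has_rank_kernel_image[OF H G h(1), of 0 n] has_rank_trivial[OF H.is_group] assms(4) h(3) by simp
qed

lemma has_rank_integer_group: "has_rank integer_group (carrier integer_group) 1"
proof -
  interpret group integer_group by simp
  show ?thesis
    unfolding has_rank_def indep_family_def
    by (rule exI[of _ "\<lambda>_. 1"]) (auto intro!: exI[of _ "1::int"])
qed

section \<open>Euler characteristic of pairs of spaces\<close>

text \<open>A relation and not a function, as the alternating sum makes sense only if all ranks are
  finite and almost all vanish. With \<open>S = {}\<close> it is the Euler characteristic of the
  space \<open>X\<close>, absolute homology being homology relative to the empty set.\<close>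

definition pair_euler :: "'a topology \<Rightarrow> 'a set \<Rightarrow> int \<Rightarrow> bool" where
  "pair_euler X S e \<longleftrightarrow> (\<exists>b N.
     (\<forall>p. has_rank (relative_homology_group (int p) X S) (carrier (relative_homology_group (int p) X S)) (b p)) \<and>
     (\<forall>p>N. b p = 0) \<and> e = (\<Sum>p\<le>N. (-1) ^ p * int (b p)))"

lemma alternating_sum_extend:
  fixes b :: "nat \<Rightarrow> nat"
  assumes "\<forall>p>N. b p = 0" "N \<le> M"
  shows "(\<Sum>p\<le>N. (-1) ^ p * int (b p)) = (\<Sum>p\<le>M. (-1) ^ p * int (b p))"
  using assms by (intro sum.mono_neutral_left) auto

lemma pair_euler_unique:
  assumes "pair_euler X S e" "pair_euler X S e'"
  shows "e = e'"
proof -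
  let ?R = "\<lambda>p. relative_homology_group (int p) X S"
  obtain b N where b: "\<And>p. has_rank (?R p) (carrier (?R p)) (b p)" "\<forall>p>N. b p = 0"
      "e = (\<Sum>p\<le>N. (-1) ^ p * int (b p))"
    using assms(1) by (auto simp: pair_euler_def)
  obtain b' N' where b': "\<And>p. has_rank (?R p) (carrier (?R p)) (b' p)" "\<forall>p>N'. b' p = 0"
      "e' = (\<Sum>p\<le>N'. (-1) ^ p * int (b' p))"
    using assms(2) by (auto simp: pair_euler_def)
  have "b p = b' p" for p
    using comm_group.has_rank_unique[OF abelian_relative_homology_group group.subgroup_self[OF group_relative_homology_group] b(1) b'(1)] .
  then have "b = b'" by blast
  then show ?thesis
    using b b' alternating_sum_extend[of N b "max N N'"] alternating_sum_extend[of N' b "max N N'"] by auto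
qed

lemma pair_euler_iso:
  assumes "pair_euler X S e"
    and iso: "\<And>p. relative_homology_group (int p) X S \<cong> relative_homology_group (int p) Y T"
  shows "pair_euler Y T e"
proof -
  obtain b N where b: "\<And>p. has_rank (relative_homology_group (int p) X S) (carrier (relative_homology_group (int p) X S)) (b p)"
    and N: "\<forall>p>N. b p = 0" "e = (\<Sum>p\<le>N. (-1) ^ p * int (b p))"
    using assms(1) unfolding pair_euler_def by blast
  have "has_rank (relative_homology_group (int p) Y T) (carrier (relative_homology_group (int p) Y T)) (b p)" for p
    using has_rank_iso[OF abelian_relative_homology_group abelian_relative_homology_group iso b] .
  then show ?thesis using N unfolding pair_euler_def by blast
qed

lemma pair_euler_homeomorphic:
  "\<lbrakk>pair_euler X {} e; X homeomorphic_space Y\<rbrakk> \<Longrightarrow> pair_euler Y {} e"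
  using pair_euler_iso homeomorphic_space_imp_isomorphic_homology_groups by blast

lemma has_rank_trivial_group: "trivial_group G \<Longrightarrow> has_rank G (carrier G) 0"
  using has_rank_trivial by (metis trivial_group_def)

lemma pair_euler_single_group:
  assumes "\<And>p. p \<noteq> k \<Longrightarrow> trivial_group (relative_homology_group (int p) X S)"
    and "relative_homology_group (int k) X S \<cong> integer_group"
  shows "pair_euler X S ((-1) ^ k)"
proof -
  let ?R = "\<lambda>p. relative_homology_group (int p) X S"
  have "comm_group integer_group" by (rule abelian_integer_group)
  moreover have "integer_group \<cong> ?R k" using assms(2) group.iso_sym group_relative_homology_group by blast
  ultimately have "has_rank (?R k) (carrier (?R k)) 1"
    using has_rank_iso has_rank_integer_group abelian_relative_homology_group by blast
  then have "has_rank (?R p) (carrier (?R p)) (if p = k then 1 else 0)" for p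
    using has_rank_trivial_group assms(1) by auto
  then show ?thesis
    unfolding pair_euler_def
    by (intro exI[of _ "\<lambda>p. if p = k then 1 else 0"] exI[of _ k] conjI allI)
       (auto simp: if_distrib cong: if_cong)
qed

lemma pair_euler_empty:
  assumes "topspace X = {}" shows "pair_euler X {} 0"
  unfolding pair_euler_def
  by (rule exI[of _ "\<lambda>_. 0"]) (simp add: has_rank_trivial_group trivial_homology_group_empty[OF assms])

text \<open>The numbers \<alpha>, \<beta>, \<gamma> are the ranks of the images of the three maps in
  the long exact sequence: from \<open>S\<close> to \<open>X\<close>, from \<open>X\<close> to the
  pair, and the boundary map. By exactness each image is the next kernel, and rank-nullity gives the
  three sums. Homology in degree -1 is trivial, whence \<open>\<gamma> 0 = 0\<close>.\<close>

lemma long_exact_ranks: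
  fixes X :: "'a topology" and S :: "'a set"
  defines "L \<equiv> \<lambda>q. homology_group q (subtopology X S)" and "K \<equiv> \<lambda>q. homology_group q X"
    and "R \<equiv> \<lambda>q. relative_homology_group q X S"
  assumes fin: "\<And>p. \<exists>n. has_rank (R (int p)) (carrier (R (int p))) n"
    and or: "(\<forall>p. \<exists>n. has_rank (L (int p)) (carrier (L (int p))) n) \<or>
             (\<forall>p. \<exists>n. has_rank (K (int p)) (carrier (K (int p))) n)"
  shows "\<exists>\<alpha> \<beta> \<gamma>. \<gamma> 0 = 0 \<and> (\<forall>p::nat.
            has_rank (K (int p)) (carrier (K (int p))) (\<alpha> p + \<beta> p) \<and>
            has_rank (L (int p)) (carrier (L (int p))) (\<gamma> (Suc p) + \<alpha> p) \<and>
            has_rank (R (int p)) (carrier (R (int p))) (\<beta> p + \<gamma> p))"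
proof -
  define f where "f = (\<lambda>q. hom_induced q (subtopology X S) {} X {} id)"
  define g where "g = (\<lambda>q. hom_induced q X {} X S id)"
  define d where "d = (\<lambda>q. hom_boundary q X S)"
  have ab: "comm_group (L q)" "comm_group (K q)" "comm_group (R q)" for q
    by (auto simp: L_def K_def R_def)
  have gr: "group (L q)" "group (K q)" "group (R q)" for q
    using ab comm_group.axioms(2) by blast+
  have f: "f q \<in> hom (L q) (K q)" and g: "g q \<in> hom (K q) (R q)" and d: "d q \<in> hom (R q) (L (q - 1))" for q
    by (auto simp: f_def g_def d_def L_def K_def R_def hom_induced_hom hom_boundary_hom)
  have kg: "kernel (K q) (R q) (g q) = f q ` carrier (L q)" for q
    using homology_exactness_axiom_3[of q X S] by (simp add: f_def g_def L_def K_def R_def)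
  have kd: "kernel (R q) (L (q - 1)) (d q) = g q ` carrier (K q)" for q
    using homology_exactness_axiom_1[of q X S] by (simp add: d_def g_def L_def K_def R_def)
  have kf: "kernel (L q) (K q) (f q) = d (q + 1) ` carrier (R (q + 1))" for q
    using homology_exactness_axiom_2[of "q + 1" X S] by (simp add: d_def f_def L_def K_def R_def)
  \<comment> \<open>The image of \<open>f\<close> is a quotient of \<open>L\<close> and a subgroup
    of \<open>K\<close>, so finite rank of either suffices. This is the reason for the disjunction
    in the assumptions.\<close>
  have "\<exists>a. has_rank (K (int p)) (f (int p) ` carrier (L (int p))) a" for p
    using or
  proof
    assume "\<forall>p. \<exists>n. has_rank (L (int p)) (carrier (L (int p))) n"
    then show ?thesis using has_rank_image[OF ab(1) ab(2) f] by blast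
  next
    assume "\<forall>p. \<exists>n. has_rank (K (int p)) (carrier (K (int p))) n"
    then obtain n where "has_rank (K (int p)) (carrier (K (int p))) n" by blast
    moreover have "group_hom (L (int p)) (K (int p)) (f (int p))"
      using f gr by (simp add: group_hom_def group_hom_axioms_def)
    then have "subgroup (f (int p) ` carrier (L (int p))) (K (int p))"
      by (rule group_hom.img_is_subgroup)
    ultimately show ?thesis
      using comm_group.has_rank_subgroup[OF ab(2)] group.subgroup_self[OF gr(2)] subgroup.subset by metis
  qed
  then obtain \<alpha> where a: "\<And>p. has_rank (K (int p)) (f (int p) ` carrier (L (int p))) (\<alpha> p)" by metis
  have "\<exists>a. has_rank (R (int p)) (kernel (R (int p)) (L (int p - 1)) (d (int p))) a" for p
  proof -
    obtain n where "has_rank (R (int p)) (carrier (R (int p))) n" using fin by blast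
    moreover have "group_hom (R (int p)) (L (int p - 1)) (d (int p))"
      using d gr by (simp add: group_hom_def group_hom_axioms_def)
    then have "subgroup (kernel (R (int p)) (L (int p - 1)) (d (int p))) (R (int p))"
      by (rule group_hom.subgroup_kernel)
    ultimately show ?thesis
      using comm_group.has_rank_subgroup[OF ab(3)] group.subgroup_self[OF gr(3)] subgroup.subset by metis
  qed
  then obtain \<beta> where b: "\<And>p. has_rank (R (int p)) (kernel (R (int p)) (L (int p - 1)) (d (int p))) (\<beta> p)" by metis
  have "\<exists>a. has_rank (L (int p - 1)) (d (int p) ` carrier (R (int p))) a" for p
    using has_rank_image[OF ab(3) ab(1) d] fin by blast
  then obtain \<gamma> where c: "\<And>p. has_rank (L (int p - 1)) (d (int p) ` carrier (R (int p))) (\<gamma> p)" by metis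
  have "\<gamma> 0 = 0"
  proof -
    have "trivial_group (L (int 0 - 1))" by (simp add: L_def)
    moreover have "d (int 0) ` carrier (R (int 0)) \<subseteq> carrier (L (int 0 - 1))"
      using d[of "int 0"] hom_carrier by blast
    moreover have "\<one>\<^bsub>L (int 0 - 1)\<^esub> \<in> d (int 0) ` carrier (R (int 0))"
      using hom_one[OF d gr(3) gr(1)] gr(3)
      by (metis group.is_monoid image_eqI monoid.one_closed)
    ultimately have "d (int 0) ` carrier (R (int 0)) = {\<one>\<^bsub>L (int 0 - 1)\<^esub>}"
      unfolding trivial_group_def by blast
    then have "has_rank (L (int 0 - 1)) {\<one>\<^bsub>L (int 0 - 1)\<^esub>} (\<gamma> 0)" using c[of 0] by simp
    then show ?thesis
      using comm_group.has_rank_unique[OF ab(1) group.triv_subgroup[OF gr(1)] _ has_rank_trivial[OF gr(1)]] by blast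
  qed
  moreover have "has_rank (K (int p)) (carrier (K (int p))) (\<alpha> p + \<beta> p)" for p
    using has_rank_kernel_image[OF ab(2) ab(3) g, of "int p" "\<alpha> p" "\<beta> p"] a[of p] b[of p] by (simp add: kg kd)
  moreover have "has_rank (L (int p)) (carrier (L (int p))) (\<gamma> (Suc p) + \<alpha> p)" for p
    using has_rank_kernel_image[OF ab(1) ab(2) f, of "int p" "\<gamma> (Suc p)" "\<alpha> p"] a[of p] c[of "Suc p"]
    by (simp add: kf add.commute)
  moreover have "has_rank (R (int p)) (carrier (R (int p))) (\<beta> p + \<gamma> p)" for p
    using has_rank_kernel_image[OF ab(3) ab(1) d, of "int p" "\<beta> p" "\<gamma> p"] b[of p] c[of p] by simp
  ultimately show ?thesis by blast
qed

lemma alternating_sum_telescope: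
  fixes \<gamma> :: "nat \<Rightarrow> nat"
  assumes "\<gamma> 0 = 0"
  shows "(\<Sum>p\<le>M. (-1) ^ p * (int (\<gamma> (Suc p)) + int (\<gamma> p))) = (-1) ^ M * int (\<gamma> (Suc M))"
  by (induction M) (simp_all add: assms algebra_simps)

text \<open>In \<open>L + R - K\<close> the ranks \<alpha> and \<beta> cancel and those of the
  boundary maps telescope. The disjunction lets the equation be solved for either space: attaching a
  cell leads from \<open>S\<close> to \<open>X\<close>, while a sphere is obtained from its ball,
  from \<open>X\<close> to \<open>S\<close>.\<close>

lemma long_exact_euler:
  fixes X :: "'a topology"
  assumes R: "pair_euler X S r" and or: "pair_euler (subtopology X S) {} e \<or> pair_euler X {} (e + r)"
  shows "pair_euler (subtopology X S) {} e \<and> pair_euler X {} (e + r)"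
proof -
  let ?L = "\<lambda>p. homology_group (int p) (subtopology X S)" and ?K = "\<lambda>p. homology_group (int p) X"
    and ?R = "\<lambda>p. relative_homology_group (int p) X S"
  have R': "\<And>p. \<exists>n. has_rank (?R p) (carrier (?R p)) n"
    using R unfolding pair_euler_def by blast
  have or': "(\<forall>p. \<exists>n. has_rank (?L p) (carrier (?L p)) n) \<or> (\<forall>p. \<exists>n. has_rank (?K p) (carrier (?K p)) n)"
    using or unfolding pair_euler_def by blast
  obtain \<alpha> \<beta> \<gamma> where abc: "\<gamma> 0 = 0 \<and> (\<forall>p::nat.
     has_rank (?K p) (carrier (?K p)) (\<alpha> p + \<beta> p) \<and>
     has_rank (?L p) (carrier (?L p)) (\<gamma> (Suc p) + \<alpha> p) \<and>
     has_rank (?R p) (carrier (?R p)) (\<beta> p + \<gamma> p))"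
    using long_exact_ranks[OF R' or'] by (elim exE) (rule that)
  note g0 = conjunct1[OF abc]
  have ranks: "has_rank (?K p) (carrier (?K p)) (\<alpha> p + \<beta> p)"
     "has_rank (?L p) (carrier (?L p)) (\<gamma> (Suc p) + \<alpha> p)"
     "has_rank (?R p) (carrier (?R p)) (\<beta> p + \<gamma> p)" for p
    using abc by simp_all
  have uniq: "m = n" if "has_rank (relative_homology_group q Y T) (carrier (relative_homology_group q Y T)) m"
      "has_rank (relative_homology_group q Y T) (carrier (relative_homology_group q Y T)) n" for q Y T m n
    using comm_group.has_rank_unique[OF abelian_relative_homology_group group.subgroup_self[OF group_relative_homology_group] that] .
  obtain br Nr where r: "\<And>p. has_rank (?R p) (carrier (?R p)) (br p)" "\<forall>p>Nr. br p = 0"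
      "r = (\<Sum>p\<le>Nr. (-1) ^ p * int (br p))"
    using R unfolding pair_euler_def by blast
  have br: "br p = \<beta> p + \<gamma> p" for p
    using uniq[OF r(1) ranks(3)] .
  have bound: "\<exists>N. (\<forall>p>N. \<alpha> p + \<beta> p = 0) \<or> (\<forall>p>N. \<gamma> (Suc p) + \<alpha> p = 0)"
  proof -
    have "\<exists>b N. (\<forall>p. has_rank (?L p) (carrier (?L p)) (b p)) \<and> (\<forall>p>N. b p = 0)" if "pair_euler (subtopology X S) {} e"
      using that unfolding pair_euler_def by blast
    moreover have "\<exists>b N. (\<forall>p. has_rank (?K p) (carrier (?K p)) (b p)) \<and> (\<forall>p>N. b p = 0)" if "pair_euler X {} (e + r)"
      using that unfolding pair_euler_def by blast
    ultimately show ?thesis using or uniq[OF ranks(1)] uniq[OF ranks(2)] by metis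
  qed
  then obtain N where N: "(\<forall>p>N. \<alpha> p + \<beta> p = 0) \<or> (\<forall>p>N. \<gamma> (Suc p) + \<alpha> p = 0)" by blast
  define M where "M = max N Nr"
  \<comment> \<open>\<open>\<gamma> (Suc p)\<close> is also controlled by the relative group in
    degree \<open>p + 1\<close>, which covers the case that only the ranks for \<open>X\<close> are
    known to vanish.\<close>
  have van: "\<alpha> p = 0 \<and> \<beta> p = 0 \<and> \<gamma> p = 0 \<and> \<gamma> (Suc p) = 0" if "p > M" for p
    using that N r(2) br[of p] br[of "Suc p"] by (auto simp: M_def)
  have gM: "\<gamma> (Suc M) = 0" using van[of "Suc M"] by simp
  define eL where "eL = (\<Sum>p\<le>M. (-1) ^ p * int (\<gamma> (Suc p) + \<alpha> p))"
  define eK where "eK = (\<Sum>p\<le>M. (-1) ^ p * int (\<alpha> p + \<beta> p))"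
  have L: "pair_euler (subtopology X S) {} eL"
    unfolding pair_euler_def eL_def
    by (rule exI[of _ "\<lambda>p. \<gamma> (Suc p) + \<alpha> p"], rule exI[of _ M]) (use ranks van in auto)
  have K: "pair_euler X {} eK"
    unfolding pair_euler_def eK_def
    by (rule exI[of _ "\<lambda>p. \<alpha> p + \<beta> p"], rule exI[of _ M]) (use ranks van in auto)
  have "r = (\<Sum>p\<le>M. (-1) ^ p * int (\<beta> p + \<gamma> p))"
    using alternating_sum_extend[of Nr br M] r br by (auto simp: M_def)
  then have "eL + r - eK = (\<Sum>p\<le>M. (-1) ^ p * (int (\<gamma> (Suc p)) + int (\<gamma> p)))"
    by (simp add: eL_def eK_def sum.distrib sum_subtractf algebra_simps)
  also have "\<dots> = 0"
    using alternating_sum_telescope[of \<gamma> M, OF g0] gM by simp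
  finally have "eK = eL + r" by simp
  moreover have "eL = e \<or> eK = e + r"
    using or L K pair_euler_unique by blast
  ultimately show ?thesis using L K by auto
qed

section \<open>Homology of an attached cell\<close>

text \<open>The last conclusion makes the straight-line homotopy from the identity to
  \<open>r\<close> avoid the puncture \<open>c\<close>.\<close>

lemma radial_retraction_rel_frontier:
  fixes P :: "'a::euclidean_space set"
  assumes "convex P" "compact P" "c \<in> rel_interior P"
  obtains r where "continuous_on (P - {c}) r" "r ` (P - {c}) \<subseteq> rel_frontier P"
    "\<And>x. x \<in> rel_frontier P \<Longrightarrow> r x = x" "\<And>x. x \<in> P - {c} \<Longrightarrow> c \<notin> closed_segment x (r x)"
proof -
  define V where "V = (\<lambda>z. z - c) ` (affine hull P)"
  define S where "S = (\<lambda>z. z - c) ` rel_frontier P"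
  have cP: "c \<in> affine hull P"
    using rel_interior_subset[of P] hull_subset[of P affine] assms(3) by auto
  have V: "subspace V"
    unfolding V_def by (rule affine_diffs_subspace_subtract[OF affine_affine_hull cP])
  have PV: "x - c \<in> V - {0}" if "x \<in> P - {c}" for x
    using that hull_inc[of x P affine] by (auto simp: V_def)
  have SP: "y \<in> S \<longleftrightarrow> c + y \<in> rel_frontier P" for y
    by (force simp: S_def image_iff)
  have ex: "\<exists>k>0. k *\<^sub>R y \<in> S" if y: "y \<in> V - {0}" for y
  proof -
    have "c + y \<in> affine hull P" using y by (auto simp: V_def)
    then show ?thesis
      using ray_to_rel_frontier[of P c y] assms y compact_imp_bounded by (metis DiffD2 SP insertI1)
  qed
  \<comment> \<open>Points of a ray from \<open>c\<close> that precede a frontier point are in the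
    relative interior. So each ray meets the relative frontier only once, and the factor
    \<open>d\<close> is determined.\<close>
  have no: False if "k *\<^sub>R y \<in> S" "l *\<^sub>R y \<in> S" "0 < k" "k < l" "y \<noteq> 0" for y k l
  proof -
    have "c + l *\<^sub>R y \<in> closure P" using that SP by (auto simp: rel_frontier_def)
    then have "open_segment c (c + l *\<^sub>R y) \<subseteq> rel_interior P"
      using rel_interior_closure_convex_segment assms by blast
    moreover have "c + k *\<^sub>R y \<in> open_segment c (c + l *\<^sub>R y)"
      unfolding in_segment using that by (intro conjI exI[of _ "k / l"]) (auto simp: algebra_simps)
    ultimately show False using that SP by (auto simp: rel_frontier_def)
  qed
  have uniq: "k = l" if "k *\<^sub>R y \<in> S" "l *\<^sub>R y \<in> S" "0 < k" "0 < l" "y \<noteq> 0" for y k l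
    using no that by (meson linorder_neqE_linordered_idom)
  define d where "d y = (SOME k. k > 0 \<and> k *\<^sub>R y \<in> S)" for y
  have d: "d y > 0 \<and> d y *\<^sub>R y \<in> S" if "y \<in> V - {0}" for y
    unfolding d_def by (rule someI_ex) (use ex[OF that] in blast)
  have S0: "S \<subseteq> V - {0}"
  proof -
    have "rel_frontier P \<subseteq> P" "c \<notin> rel_frontier P"
      using assms closure_closed[OF compact_imp_closed[OF assms(2)]] by (auto simp: rel_frontier_def)
    then have "x - c \<in> V - {0}" if "x \<in> rel_frontier P" for x
      using that by (intro PV) auto
    then show ?thesis unfolding S_def by (rule image_subsetI)
  qed
  have "continuous_on (V - {0}) (\<lambda>x. d x *\<^sub>R x)"
  proof (rule continuous_on_compact_surface_projection[OF _ S0])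
    show "compact S"
      unfolding S_def using assms compact_rel_frontier_bounded compact_imp_bounded
      by (intro compact_continuous_image continuous_intros) blast
    show "Convex.cone V" using V by (rule subspace_imp_cone)
    show "\<And>x k. x \<in> V - {0} \<Longrightarrow> (0 < k \<and> k *\<^sub>R x \<in> S) = (d x = k)"
      using d uniq by blast
  qed
  then have cont: "continuous_on (P - {c}) ((\<lambda>x. d x *\<^sub>R x) \<circ> (\<lambda>x. x - c))"
    using PV by (intro continuous_on_compose continuous_on_diff continuous_on_id continuous_on_const)
      (auto elim!: continuous_on_subset)
  define r where "r x = c + d (x - c) *\<^sub>R (x - c)" for x
  show thesis
  proof
    show "continuous_on (P - {c}) r"
      using cont by (auto simp: r_def o_def intro!: continuous_intros)
    show "r ` (P - {c}) \<subseteq> rel_frontier P"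
      using d[OF PV] SP by (auto simp: r_def)
    show "r x = x" if "x \<in> rel_frontier P" for x
    proof -
      have "x - c \<in> S" using that by (auto simp: S_def)
      then have "x - c \<in> V - {0}" using S0 by blast
      then have "d (x - c) = 1"
        using uniq[of "d (x - c)" "x - c" 1] d \<open>x - c \<in> S\<close> by auto
      then show ?thesis by (simp add: r_def)
    qed
    show "c \<notin> closed_segment x (r x)" if "x \<in> P - {c}" for x
    proof
      assume "c \<in> closed_segment x (r x)"
      then obtain u where u: "0 \<le> u" "u \<le> 1" "c = (1 - u) *\<^sub>R x + u *\<^sub>R r x"
        by (auto simp: in_segment)
      then have "(1 - u + u * d (x - c)) *\<^sub>R (x - c) = 0"
        by (simp add: r_def algebra_simps)
      \<comment> \<open>\<open>x\<close> and \<open>r x\<close> lie on the same ray from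
        \<open>c\<close>, so no convex combination of them is \<open>c\<close>.\<close>
      moreover have "1 - u + u * d (x - c) > 0"
        using u d[OF PV[OF that]] by (cases "u = 1") (auto intro: add_pos_nonneg)
      ultimately show False using that by auto
    qed
  qed
qed

text \<open>The punctured cell is pushed radially onto its relative frontier while \<open>L\<close>
  stays fixed, so \<open>L\<close> is a deformation retract.\<close>

lemma trivial_relative_homology_punctured_cell:
  fixes P L :: "'a::euclidean_space set"
  assumes "convex P" "compact P" "c \<in> rel_interior P" "closed L" "L \<inter> P = rel_frontier P"
  shows "trivial_group (relative_homology_group p (top_of_set (L \<union> P - {c})) L)"
proof -
  obtain r where r: "continuous_on (P - {c}) r" "r ` (P - {c}) \<subseteq> rel_frontier P"
    "\<And>x. x \<in> rel_frontier P \<Longrightarrow> r x = x" "\<And>x. x \<in> P - {c} \<Longrightarrow> c \<notin> closed_segment x (r x)"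
    using radial_retraction_rel_frontier assms by blast
  have cL: "c \<notin> L"
    using assms rel_interior_subset by (auto simp: rel_frontier_def)
  define X where "X = L \<union> P - {c}"
  have XL: "L \<subseteq> X" using cL by (auto simp: X_def)
  define f where "f x = (if x \<in> P then r x else x)" for x
  have fL: "f x = x" if "x \<in> L" for x using that r(3) assms(5) by (auto simp: f_def)
  have fX: "f ` X \<subseteq> L" using r(2) assms(5) by (auto simp: f_def X_def)
  have "continuous_on (L \<union> (P - {c})) f"
  proof -
    have "closedin (top_of_set (L \<union> (P - {c}))) L"
      using assms(4) closed_subset by blast
    moreover have "closedin (top_of_set (L \<union> (P - {c}))) (P - {c})"
    proof -
      have "P - {c} = (L \<union> (P - {c})) \<inter> P" using cL assms by (auto simp: rel_frontier_def)
      then show ?thesis using assms(2) compact_imp_closed closedin_closed_Int by metis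
    qed
    moreover have "continuous_on L f" using fL continuous_on_eq continuous_on_id by metis
    moreover have "continuous_on (P - {c}) f"
      using r(1) continuous_on_eq by (metis DiffD1 f_def)
    ultimately show ?thesis by (rule continuous_on_Un_local)
  qed
  moreover have "L \<union> (P - {c}) = X" using cL by (auto simp: X_def)
  ultimately have cont: "continuous_on X f" by simp
  have "trivial_group (relative_homology_group p (top_of_set X) L)"
  proof (rule trivial_relative_homology_group_gen)
    have sub: "subtopology (top_of_set X) L = top_of_set L"
      using XL by (simp add: subtopology_subtopology Int_absorb1)
    show "continuous_map (top_of_set X) (subtopology (top_of_set X) L) f"
      unfolding sub using cont fX by auto
    show "homotopic_with (\<lambda>h. True) (subtopology (top_of_set X) L) (subtopology (top_of_set X) L) f id"
      unfolding sub by (rule homotopic_with_equal) (use fL continuous_on_subset[OF cont XL] in auto)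
    have "homotopic_with_canon (\<lambda>h. True) X X f id"
    proof (rule homotopic_with_linear)
      fix x assume x: "x \<in> X"
      have "closed_segment x (f x) \<subseteq> X"
      proof (cases "x \<in> P")
        case True
        then have "x \<in> P - {c}" using x by (auto simp: X_def)
        moreover have "r x \<in> P" using r(2) calculation assms(5) by blast
        then have "closed_segment x (r x) \<subseteq> P"
          using True assms(1) closed_segment_subset by blast
        ultimately show ?thesis using r(4) True by (auto simp: f_def X_def)
      next
        case False
        then show ?thesis using x by (auto simp: f_def)
      qed
      then show "closed_segment (f x) (id x) \<subseteq> X" by (simp add: closed_segment_commute)
    qed (use cont in auto)
    then show "homotopic_with (\<lambda>k. True) (top_of_set X) (top_of_set X) f id" .
  qed
  then show ?thesis by (simp add: X_def)
qed

text \<open>In the exact sequence of the triple \<open>L\<close>, \<open>L \<union> P - {c}\<close>,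
  \<open>L \<union> P\<close> the groups of the pair formed by the first two vanish.\<close>

lemma relative_homology_punctured_iso:
  fixes P L :: "'a::euclidean_space set"
  assumes "convex P" "compact P" "c \<in> rel_interior P" "closed L" "L \<inter> P = rel_frontier P"
  shows "relative_homology_group p (top_of_set (L \<union> P)) L \<cong>
         relative_homology_group p (top_of_set (L \<union> P)) (L \<union> P - {c})"
proof -
  let ?X = "top_of_set (L \<union> P)" and ?S = "L \<union> P - {c}"
  have cL: "c \<notin> L"
    using assms rel_interior_subset by (auto simp: rel_frontier_def)
  then have LS: "L \<subseteq> ?S" by auto
  have sub: "subtopology ?X ?S = top_of_set ?S"
    by (simp add: subtopology_subtopology Int_absorb1)
  have "hom_induced p ?X L ?X ?S id \<in> iso (relative_homology_group p ?X L) (relative_homology_group p ?X ?S)"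
  proof (rule very_short_exact_sequence)
    show "exact_seq
         ([relative_homology_group(p - 1) (subtopology ?X ?S) L, relative_homology_group p ?X ?S, relative_homology_group p ?X L, relative_homology_group p (subtopology ?X ?S) L],
          [hom_relboundary p ?X ?S L, hom_induced p ?X L ?X ?S id, hom_induced p (subtopology ?X ?S) L ?X L id])"
      using homology_exactness_triple_1 [OF LS] homology_exactness_triple_3 [OF LS] by fastforce
    show "trivial_group (relative_homology_group p (subtopology ?X ?S) L)"
      "trivial_group (relative_homology_group(p - 1) (subtopology ?X ?S) L)"
      using trivial_relative_homology_punctured_cell[OF assms] by (simp_all only: sub)
  qed
  then show ?thesis by (auto simp: is_iso_def)
qed

text \<open>Excision of \<open>L - P\<close>. Its closure lies in \<open>L\<close>, which need not
  be open; the enlarged subspace \<open>L \<union> P - {c}\<close> is open, and this is the purpose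
  of the puncture.\<close>

lemma relative_homology_excise_cell:
  fixes P L :: "'a::euclidean_space set"
  assumes "convex P" "compact P" "c \<in> rel_interior P" "closed L" "L \<inter> P = rel_frontier P"
  shows "relative_homology_group p (top_of_set P) (P - {c}) \<cong>
         relative_homology_group p (top_of_set (L \<union> P)) (L \<union> P - {c})"
proof -
  let ?X = "top_of_set (L \<union> P)"
  have cL: "c \<notin> L" and cP: "c \<in> P"
    using assms rel_interior_subset by (auto simp: rel_frontier_def)
  have "?X closure_of (L - P) \<subseteq> ?X closure_of L" by (rule closure_of_mono) auto
  also have "?X closure_of L = L"
    by (rule closure_of_closedin) (use assms(4) closed_subset in blast)
  finally have 1: "?X closure_of (L - P) \<subseteq> L" .
  have "openin ?X (L \<union> P - {c})"
    by (metis open_delete open_UNIV openin_open_Int Diff_eq Compl_eq_Diff_UNIV inf_commute)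
  then have 2: "?X interior_of (L \<union> P - {c}) = L \<union> P - {c}"
    by (rule interior_of_openin)
  have "hom_induced p (subtopology ?X (L \<union> P - (L - P))) (L \<union> P - {c} - (L - P)) (subtopology ?X (L \<union> P)) (L \<union> P - {c}) id
    \<in> iso (relative_homology_group p (subtopology ?X (L \<union> P - (L - P))) (L \<union> P - {c} - (L - P)))
          (relative_homology_group p (subtopology ?X (L \<union> P)) (L \<union> P - {c}))"
    by (rule homology_excision_axiom) (use 1 2 cL in auto)
  moreover have "L \<union> P - (L - P) = P" "L \<union> P - {c} - (L - P) = P - {c}"
    by auto
  moreover have "subtopology ?X P = top_of_set P" "subtopology ?X (L \<union> P) = ?X"
    by (simp_all add: subtopology_subtopology Int_absorb1)
  ultimately show ?thesis by (auto simp: is_iso_def)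
qed

lemma homeomorphic_imp_homeomorphic_space:
  assumes "S homeomorphic T" shows "top_of_set S homeomorphic_space top_of_set T"
proof -
  obtain f g where "homeomorphism S T f g" using assms by (auto simp: homeomorphic_def)
  then have "homeomorphic_maps (top_of_set S) (top_of_set T) f g"
    by (auto simp: homeomorphism_def homeomorphic_maps_def)
  then show ?thesis by (rule homeomorphic_maps_imp_homeomorphic_space)
qed

text \<open>\<open>nsphere n\<close> consists of real sequences. It is first identified with the
  unit sphere of a coordinate subspace of dimension \<open>n + 1\<close>, whose ball is a bounded
  convex set of the same dimension as \<open>P\<close>.\<close>

lemma rel_frontier_homeomorphic_nsphere:
  fixes P :: "'a::euclidean_space set"
  assumes "convex P" "bounded P" "aff_dim P = int (Suc n)"
  shows "top_of_set (rel_frontier P) homeomorphic_space nsphere n"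
proof -
  have "Suc n \<le> DIM('a)" using assms(3) aff_dim_le_DIM[of P] by simp
  then obtain B :: "'a set" where B: "B \<subseteq> Basis" "card B = Suc n"
    by (metis obtain_subset_with_card_n)
  have "independent B" using B independent_Basis independent_mono by blast
  moreover have "pairwise orthogonal B"
    using B orthogonal_Basis by (auto simp: pairwise_def)
  ultimately obtain f g where fg: "homeomorphic_maps (nsphere (Suc n - 1)) (top_of_set (sphere 0 1 \<inter> span B)) f g"
    using homeomorphic_maps_nsphere_euclidean_sphere[of B "Suc n"] B by (metis Zero_not_Suc norm_Basis subsetD)
  have "rel_frontier (ball (0::'a) 1 \<inter> span B) = frontier (ball 0 1) \<inter> span B"
  proof (rule convex_affine_rel_frontier_Int)
    show "interior (ball 0 1) \<inter> span B \<noteq> {}" using span_zero by force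
  qed (auto simp: subspace_imp_affine)
  then have rf: "rel_frontier (ball (0::'a) 1 \<inter> span B) = sphere 0 1 \<inter> span B" by simp
  have "aff_dim (span B \<inter> ball 0 1) = aff_dim (span B)"
    by (rule aff_dim_convex_Int_open) (use span_zero in \<open>auto simp: subspace_imp_convex\<close>, force)
  also have "\<dots> = int (Suc n)"
    using \<open>independent B\<close> B by (simp add: aff_dim_subspace dim_eq_card_independent)
  finally have "aff_dim (ball 0 1 \<inter> span B) = int (Suc n)" by (simp add: Int_commute)
  then have "rel_frontier P homeomorphic (sphere 0 1 \<inter> span B)"
    unfolding rf[symmetric]
    by (intro homeomorphic_rel_frontiers_convex_bounded_sets assms)
       (auto simp: assms convex_Int subspace_imp_convex bounded_Int)
  moreover have "top_of_set (sphere 0 1 \<inter> span B) homeomorphic_space nsphere n"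
    using homeomorphic_maps_imp_homeomorphic_space[OF fg] by (subst homeomorphic_space_sym) simp
  ultimately show ?thesis
    using homeomorphic_imp_homeomorphic_space homeomorphic_space_trans by blast
qed

text \<open>\<open>P\<close> is contractible, so the homology of the pair is the reduced homology,
  one degree lower, of the punctured cell, that is, of a sphere of dimension \<open>k - 1\<close>.
  For \<open>k = 0\<close> the punctured cell is empty and the homology of a point is used
  instead.\<close>

lemma pair_euler_punctured_cell:
  fixes P :: "'a::euclidean_space set"
  assumes "convex P" "compact P" "c \<in> rel_interior P" "aff_dim P = int k"
  shows "pair_euler (top_of_set P) (P - {c}) ((-1) ^ k)"
proof (rule pair_euler_single_group)
  have cP: "c \<in> P" using assms rel_interior_subset by blast
  have cont: "contractible_space (top_of_set P)" using assms(1) convex_imp_contractible by simp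
  have "relative_homology_group (int k) (top_of_set P) (P - {c}) \<cong> integer_group \<and>
     (\<forall>p. p \<noteq> k \<longrightarrow> trivial_group (relative_homology_group (int p) (top_of_set P) (P - {c})))"
  proof (cases k)
    case 0
    then have "P = {c}" using assms(4) cP aff_dim_eq_0 by (metis of_nat_0 singletonD)
    then show ?thesis
      using 0 homology_coefficients[of "top_of_set {c}" c] homology_dimension_axiom[of "top_of_set {c}" c] by simp
  next
    case (Suc n)
    have ne: "topspace (top_of_set P) \<inter> (P - {c}) \<noteq> {}"
    proof -
      have "P \<noteq> {c}" using assms(4) Suc by auto
      then show ?thesis using cP by auto
    qed
    have "relative_homology_group p (top_of_set P) (P - {c}) \<cong>
          reduced_homology_group (p - 1) (nsphere n)" for p
    proof -
      have sub: "subtopology (top_of_set P) (P - {c}) = top_of_set (P - {c})"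
        by (simp add: subtopology_subtopology Int_absorb1)
      have "rel_frontier P homotopy_eqv (P - {c})"
        by (rule homotopy_eqv_rel_frontier_punctured_convex)
           (use assms compact_imp_bounded closure_closed[OF compact_imp_closed[OF assms(2)]] hull_subset[of P affine] in \<open>auto simp: rel_frontier_def\<close>)
      then have "top_of_set (P - {c}) homotopy_equivalent_space nsphere n"
        using rel_frontier_homeomorphic_nsphere[of P n] assms compact_imp_bounded Suc
        by (metis homeomorphic_imp_homotopy_equivalent_space homotopy_equivalent_space_sym homotopy_eqv_trans)
      then have "reduced_homology_group (p - 1) (top_of_set (P - {c})) \<cong> reduced_homology_group (p - 1) (nsphere n)"
        by (rule homotopy_equivalent_space_imp_isomorphic_reduced_homology_groups)
      then show ?thesis
        using isomorphic_group_relative_homology_of_contractible[OF cont ne, of p] sub by (metis iso_trans)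
    qed
    then have iso: "relative_homology_group (int p) (top_of_set P) (P - {c}) \<cong>
          reduced_homology_group (int p - 1) (nsphere n)" for p by blast
    have "relative_homology_group (int k) (top_of_set P) (P - {c}) \<cong> integer_group"
      using iso[of k] reduced_homology_group_nsphere(1)[of n] Suc iso_trans by fastforce
    moreover have "trivial_group (relative_homology_group (int p) (top_of_set P) (P - {c}))" if "p \<noteq> k" for p
      using iso[of p] reduced_homology_group_nsphere(2)[of "int p - 1" n] that Suc
        isomorphic_group_triviality[OF iso group_relative_homology_group group_reduced_homology_group] by auto
    ultimately show ?thesis by blast
  qed
  then show "relative_homology_group (int k) (top_of_set P) (P - {c}) \<cong> integer_group"
    "\<And>p. p \<noteq> k \<Longrightarrow> trivial_group (relative_homology_group (int p) (top_of_set P) (P - {c}))" by auto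
qed

lemma pair_euler_attach_cell:
  fixes P L :: "'a::euclidean_space set"
  assumes "convex P" "compact P" "aff_dim P = int k" "closed L" "L \<inter> P = rel_frontier P"
  shows "pair_euler (top_of_set (L \<union> P)) L ((-1) ^ k)"
proof -
  have "P \<noteq> {}" using assms(3) by auto
  then obtain c where c: "c \<in> rel_interior P"
    using assms(1) rel_interior_eq_empty by blast
  have "relative_homology_group p (top_of_set P) (P - {c}) \<cong> relative_homology_group p (top_of_set (L \<union> P)) L" for p
    using relative_homology_excise_cell[OF assms(1,2) c assms(4,5), of p]
      relative_homology_punctured_iso[OF assms(1,2) c assms(4,5), of p]
      group.iso_sym[OF group_relative_homology_group] iso_trans by blast
  then show ?thesis
    using pair_euler_iso[OF pair_euler_punctured_cell[OF assms(1,2) c assms(3)]] by blast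
qed

section \<open>Euler characteristic of polytopal complexes\<close>

text \<open>The empty cell has dimension -1, which \<open>nat\<close> truncates to 0. Left in the
  sum, it would count as a vertex.\<close>

definition cell_euler :: "'a::euclidean_space set set \<Rightarrow> int" where
  "cell_euler K = (\<Sum>F\<in>K - {{}}. (-1) ^ nat (aff_dim F))"

lemma polytopal_complexD:
  assumes "polytopal_complex K"
  shows "finite K" "\<And>P. P \<in> K \<Longrightarrow> polytope P" "\<And>P F. P \<in> K \<Longrightarrow> F face_of P \<Longrightarrow> F \<in> K"
    "\<And>P Q. P \<in> K \<Longrightarrow> Q \<in> K \<Longrightarrow> (P \<inter> Q) face_of P" "\<And>P Q. P \<in> K \<Longrightarrow> Q \<in> K \<Longrightarrow> (P \<inter> Q) face_of Q"
    "\<And>P. P \<in> K \<Longrightarrow> convex P" "\<And>P. P \<in> K \<Longrightarrow> compact P" "\<And>P. P \<in> K \<Longrightarrow> closed P"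
    "compact (\<Union>K)" "closed (\<Union>K)"
proof -
  show fin: "finite K" and poly: "\<And>P. P \<in> K \<Longrightarrow> polytope P"
   and "\<And>P F. P \<in> K \<Longrightarrow> F face_of P \<Longrightarrow> F \<in> K"
    "\<And>P Q. P \<in> K \<Longrightarrow> Q \<in> K \<Longrightarrow> (P \<inter> Q) face_of P" "\<And>P Q. P \<in> K \<Longrightarrow> Q \<in> K \<Longrightarrow> (P \<inter> Q) face_of Q"
    using assms unfolding polytopal_complex_def by blast+
  show "\<And>P. P \<in> K \<Longrightarrow> convex P" "\<And>P. P \<in> K \<Longrightarrow> compact P" "\<And>P. P \<in> K \<Longrightarrow> closed P"
    using poly polytope_imp_convex polytope_imp_compact compact_imp_closed by blast+
  show "compact (\<Union>K)" using fin poly polytope_imp_compact by (intro compact_Union) auto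
  then show "closed (\<Union>K)" by (rule compact_imp_closed)
qed

text \<open>A cell of largest dimension is a proper face of no other cell. Hence the others stay
  closed under faces, and they meet it in proper faces only.\<close>

lemma polytopal_complex_remove_top:
  assumes K: "polytopal_complex K" and P: "P \<in> K" and max: "\<And>Q. Q \<in> K \<Longrightarrow> aff_dim Q \<le> aff_dim P"
  shows "polytopal_complex (K - {P})" "P \<noteq> {} \<Longrightarrow> \<Union>(K - {P}) \<inter> P = rel_frontier P"
proof -
  note K' = polytopal_complexD[OF K]
  have noface: "Q = P" if "P face_of Q" "Q \<in> K" for Q
    using face_of_aff_dim_lt[OF K'(6)[OF that(2)] that(1)] max[OF that(2)] by force
  show "polytopal_complex (K - {P})"
    unfolding polytopal_complex_def
  proof (intro conjI ballI allI impI)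
    fix Q F assume Q: "Q \<in> K - {P}" "F face_of Q"
    then have "F \<in> K" using K'(3) by blast
    moreover have "F \<noteq> P" using noface Q by blast
    ultimately show "F \<in> K - {P}" by blast
  qed (use K' in auto)
  assume "P \<noteq> {}"
  have "Q \<inter> P \<subseteq> rel_frontier P" if "Q \<in> K - {P}" for Q
  proof -
    have "Q \<inter> P \<noteq> P" using noface[of Q] that K'(4)[of Q P] P by (metis DiffD1 DiffD2 singletonI)
    then show ?thesis using face_of_subset_rel_frontier[OF K'(5)[of Q P]] that P by auto
  qed
  moreover have "rel_frontier P \<subseteq> \<Union>(K - {P}) \<inter> P"
  proof
    fix x assume "x \<in> rel_frontier P"
    then obtain F where F: "F facet_of P" "x \<in> F"
      using rel_frontier_of_polyhedron[OF polytope_imp_polyhedron[OF K'(2)[OF P]]] by auto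
    then have "F face_of P" "F \<noteq> P" by (auto simp: facet_of_def)
    then show "x \<in> \<Union>(K - {P}) \<inter> P" using F K'(3)[OF P] face_of_imp_subset by blast
  qed
  ultimately show "\<Union>(K - {P}) \<inter> P = rel_frontier P" by blast
qed

theorem pair_euler_polytopal_complex:
  assumes "polytopal_complex K"
  shows "pair_euler (top_of_set (\<Union>K)) {} (cell_euler K)"
  using assms
proof (induction "card K" arbitrary: K)
  case 0
  then have "K = {}" using polytopal_complexD(1) by fastforce
  then show ?case by (simp add: cell_euler_def pair_euler_empty)
next
  case (Suc n)
  note K' = polytopal_complexD[OF Suc.prems]
  show ?case
  proof (cases "K \<subseteq> {{}}")
    case True
    then have "\<Union>K = {}" "K - {{}} = {}" by auto
    then show ?thesis unfolding cell_euler_def by (simp only: sum.empty) (simp add: pair_euler_empty)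
  next
    case False
    then obtain Q where Q: "Q \<in> K" "Q \<noteq> {}" by auto
    define d where "d = Max (aff_dim ` K)"
    have "d \<in> aff_dim ` K" unfolding d_def using K'(1) Q by (intro Max_in) auto
    then obtain P where P: "P \<in> K" "aff_dim P = d" by auto
    have max: "aff_dim F \<le> aff_dim P" if "F \<in> K" for F
      unfolding P d_def using that K'(1) by (intro Max_ge) auto
    have "aff_dim Q \<ge> 0" using Q(2) by (metis aff_dim_negative_iff linorder_not_le)
    then have "aff_dim P \<ge> 0" using max[OF Q(1)] by simp
    then obtain k where k: "aff_dim P = int k" by (metis nonneg_int_cases)
    then have Pne: "P \<noteq> {}" by auto
    let ?L = "K - {P}"
    have L: "polytopal_complex ?L" "\<Union>?L \<inter> P = rel_frontier P"
      using polytopal_complex_remove_top[OF Suc.prems P(1) max] Pne by blast+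
    have U: "\<Union>?L \<union> P = \<Union>K" using P(1) by blast
    have "n = card ?L" using Suc.hyps(2) P(1) K'(1) by simp
    then have IH: "pair_euler (top_of_set (\<Union>?L)) {} (cell_euler ?L)" using Suc.hyps(1) L(1) by blast
    have att: "pair_euler (top_of_set (\<Union>K)) (\<Union>?L) ((-1) ^ k)"
      using pair_euler_attach_cell[OF K'(6)[OF P(1)] K'(7)[OF P(1)] k polytopal_complexD(10)[OF L(1)] L(2)] U by simp
    have sub: "subtopology (top_of_set (\<Union>K)) (\<Union>?L) = top_of_set (\<Union>?L)"
      using U by (metis Int_absorb1 Un_upper1 subtopology_subtopology)
    have "pair_euler (top_of_set (\<Union>K)) {} (cell_euler ?L + (-1) ^ k)"
      using long_exact_euler[OF att] IH unfolding sub by blast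
    moreover have "cell_euler K = cell_euler ?L + (-1) ^ k"
    proof -
      have "K - {{}} = insert P (?L - {{}})" using P(1) Pne by auto
      then show ?thesis using K'(1) k by (simp add: cell_euler_def)
    qed
    ultimately show ?thesis by simp
  qed
qed

lemma cell_euler_homeomorphic:
  assumes "polytopal_complex K" "\<Union>K homeomorphic S" "pair_euler (top_of_set S) {} e"
  shows "cell_euler K = e"
proof -
  have "pair_euler (top_of_set S) {} (cell_euler K)"
    using pair_euler_homeomorphic[OF pair_euler_polytopal_complex[OF assms(1)] homeomorphic_imp_homeomorphic_space[OF assms(2)]] .
  then show ?thesis using pair_euler_unique assms(3) by blast
qed

lemma pair_euler_convex:
  fixes S :: "'a::euclidean_space set"
  assumes "convex S" "S \<noteq> {}"
  shows "pair_euler (top_of_set S) {} 1"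
proof -
  obtain a where a: "a \<in> S" using assms by blast
  have "S homotopy_eqv {a}"
    using homotopy_eqv_contractible_sets[of S "{a}"] assms convex_imp_contractible by auto
  then have "homology_group p (top_of_set {a}) \<cong> homology_group p (top_of_set S)" for p
    using homotopy_equivalent_space_imp_isomorphic_homology_groups homotopy_equivalent_space_sym by blast
  moreover have "pair_euler (top_of_set {a}) {} ((-1) ^ 0)"
    by (rule pair_euler_single_group) (simp_all add: homology_dimension_axiom[of _ a] homology_coefficients[of _ a])
  ultimately show ?thesis using pair_euler_iso by fastforce
qed

text \<open>\<open>P\<close> arises from its relative frontier by attaching \<open>P\<close> itself.
  The Euler characteristic 1 of \<open>P\<close> is known, so the exact sequence is solved for the
  sphere. For \<open>k = 0\<close> this gives 0, the sphere being empty.\<close>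

lemma pair_euler_rel_frontier:
  fixes P :: "'a::euclidean_space set"
  assumes "convex P" "compact P" "aff_dim P = int k"
  shows "pair_euler (top_of_set (rel_frontier P)) {} (1 - (-1) ^ k)"
proof -
  have sub: "rel_frontier P \<subseteq> P" using closure_closed[OF compact_imp_closed[OF assms(2)]] by (auto simp: rel_frontier_def)
  then have U: "rel_frontier P \<union> P = P" "rel_frontier P \<inter> P = rel_frontier P" by auto
  have "pair_euler (top_of_set P) (rel_frontier P) ((-1) ^ k)"
    using pair_euler_attach_cell[OF assms, of "rel_frontier P"] compact_rel_frontier_bounded[of P]
      compact_imp_bounded compact_imp_closed assms(2) U by auto
  moreover have "pair_euler (top_of_set P) {} (1 - (-1) ^ k + (-1) ^ k)"
    using pair_euler_convex[OF assms(1)] assms(3) by fastforce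
  moreover have "subtopology (top_of_set P) (rel_frontier P) = top_of_set (rel_frontier P)"
    using sub by (simp add: subtopology_subtopology Int_absorb1)
  ultimately show ?thesis using long_exact_euler by metis
qed

section \<open>Local structure of complexes\<close>

text \<open>Up to distance \<epsilon> from \<open>x\<close> the set \<open>S\<close> is a cone with
  apex \<open>x\<close>. As \<open>t\<close> is positive, nothing is said about the apex
  itself.\<close>

definition conic_at :: "'a::real_normed_vector \<Rightarrow> 'a set \<Rightarrow> real \<Rightarrow> bool" where
  "conic_at x S \<epsilon> \<longleftrightarrow> (\<forall>v t. norm v < \<epsilon> \<and> 0 < t \<and> t \<le> 1 \<longrightarrow> (x + t *\<^sub>R v \<in> S \<longleftrightarrow> x + v \<in> S))"

lemma eventually_at_right_0_small:
  assumes "(e::real) > 0" "\<And>r. 0 < r \<Longrightarrow> r < e \<Longrightarrow> Q r"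
  shows "\<forall>\<^sub>F r in at_right 0. Q r"
  using assms eventually_at_right[of 0 1 Q] by (auto intro: exI[of _ e])

lemma eventually_conic_halfspace:
  fixes x a :: "'a::euclidean_space"
  shows "\<forall>\<^sub>F \<epsilon> in at_right 0. conic_at x {y. a \<bullet> y \<le> b} \<epsilon>"
proof -
  \<comment> \<open>A lower bound for the distance of \<open>x\<close> from the bounding hyperplane;
    the summand 1 makes the quotient meaningful for \<open>a = 0\<close>.\<close>
  define \<delta> where "\<delta> = \<bar>b - a \<bullet> x\<bar> / (norm a + 1)"
  have pos: "norm a + 1 > 0" by (meson add_nonneg_pos norm_ge_zero zero_less_one)
  show ?thesis
  proof (cases "a \<bullet> x = b")
    case True
    have "conic_at x {y. a \<bullet> y \<le> b} \<epsilon>" for \<epsilon>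
      using True by (auto simp: conic_at_def inner_add_right mult_le_0_iff)
    then show ?thesis by simp
  next
    case False
    have "\<delta> > 0" using False pos by (simp add: \<delta>_def)
    moreover have "conic_at x {y. a \<bullet> y \<le> b} \<epsilon>" if "0 < \<epsilon>" "\<epsilon> < \<delta>" for \<epsilon>
      unfolding conic_at_def
    proof (intro allI impI)
      have small: "\<bar>a \<bullet> w\<bar> < \<bar>b - a \<bullet> x\<bar>" if "norm w < \<epsilon>" for w
      proof -
        have "\<bar>a \<bullet> w\<bar> \<le> norm a * norm w" by (rule Cauchy_Schwarz_ineq2)
        also have "\<dots> \<le> (norm a + 1) * norm w" by (intro mult_right_mono) auto
        also have "\<dots> < (norm a + 1) * \<delta>"
          using that \<open>\<epsilon> < \<delta>\<close> pos by (intro mult_strict_left_mono) auto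
        also have "\<dots> = \<bar>b - a \<bullet> x\<bar>" using pos by (simp add: \<delta>_def)
        finally show ?thesis .
      qed
      fix v :: 'a and t :: real assume vt: "norm v < \<epsilon> \<and> 0 < t \<and> t \<le> 1"
      have "norm (t *\<^sub>R v) \<le> norm v" using vt by (simp add: mult_left_le_one_le)
      then have "\<bar>a \<bullet> v\<bar> < \<bar>b - a \<bullet> x\<bar>" "\<bar>a \<bullet> (t *\<^sub>R v)\<bar> < \<bar>b - a \<bullet> x\<bar>"
        using vt by (auto intro!: small simp del: norm_scaleR inner_scaleR_right)
      then show "(x + t *\<^sub>R v \<in> {y. a \<bullet> y \<le> b}) = (x + v \<in> {y. a \<bullet> y \<le> b})"
        by (auto simp: inner_add_right simp del: inner_scaleR_right)
    qed
    ultimately show ?thesis by (rule eventually_at_right_0_small)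
  qed
qed

lemma eventually_conic_polyhedron:
  fixes P :: "'a::euclidean_space set"
  assumes "polyhedron P"
  shows "\<forall>\<^sub>F \<epsilon> in at_right 0. conic_at x P \<epsilon>"
proof -
  obtain F where F: "finite F" "P = \<Inter>F" "\<forall>h\<in>F. \<exists>a b. a \<noteq> 0 \<and> h = {x. a \<bullet> x \<le> b}"
    using assms unfolding polyhedron_def by blast
  have "\<forall>h\<in>F. \<forall>\<^sub>F \<epsilon> in at_right 0. conic_at x h \<epsilon>"
    using F(3) eventually_conic_halfspace by metis
  then have "\<forall>\<^sub>F \<epsilon> in at_right 0. \<forall>h\<in>F. conic_at x h \<epsilon>"
    using F(1) by (simp add: eventually_ball_finite)
  then show ?thesis
    by (rule eventually_mono) (auto simp: F(2) conic_at_def)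
qed

lemma eventually_conic_complex:
  assumes "polytopal_complex K"
  shows "\<forall>\<^sub>F \<epsilon> in at_right 0. conic_at x (\<Union>K) \<epsilon>"
proof -
  note K = polytopal_complexD[OF assms]
  have "\<forall>\<^sub>F \<epsilon> in at_right 0. \<forall>P\<in>K. conic_at x P \<epsilon>"
    using K(1,2) by (intro eventually_ball_finite ballI eventually_conic_polyhedron polytope_imp_polyhedron)
  then show ?thesis by (rule eventually_mono) (auto simp: conic_at_def)
qed

text \<open>The segment from \<open>x\<close> to \<open>y\<close> is prolonged inside
  \<open>F\<close> to a point \<open>z\<close> beyond \<open>y\<close>. Then
  \<open>y + t *\<^sub>R v\<close> is a convex combination of \<open>z\<close> and
  \<open>x + v\<close>, and conicity of \<open>P\<close> at \<open>y\<close> allows the factor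
  \<open>t\<close> to be dropped.\<close>

lemma eventually_homogeneous_polyhedron:
  fixes P F :: "'a::euclidean_space set"
  assumes P: "polyhedron P" and F: "F \<subseteq> P" and x: "x \<in> rel_interior F" and y: "y \<in> rel_interior F"
  shows "\<forall>\<^sub>F \<epsilon> in at_right 0. \<forall>v. norm v < \<epsilon> \<and> x + v \<in> P \<longrightarrow> y + v \<in> P"
proof -
  have xF: "x \<in> F" "x \<in> affine hull F" "y \<in> affine hull F"
    using x y rel_interior_subset hull_subset[of F affine] by blast+
  obtain e where e: "e > 0" "ball y e \<inter> affine hull F \<subseteq> F"
    using y by (auto simp: mem_rel_interior_ball)
  define n where "n = norm (y - x) + 1"
  \<comment> \<open>With this choice \<open>z\<close> is at distance at most \<open>e / 2\<close>
    from \<open>y\<close>.\<close>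
  define s where "s = e / (2 * n)"
  have n1: "n > 0" unfolding n_def by (meson add_nonneg_pos norm_ge_zero zero_less_one)
  then have s: "s > 0" using e by (simp add: s_def)
  define z where "z = (1 + s) *\<^sub>R y + (- s) *\<^sub>R x"
  have "z \<in> affine hull F"
    unfolding z_def by (rule mem_affine) (use xF in auto)
  moreover have "dist y z < e"
  proof -
    have "y - z = (- s) *\<^sub>R (y - x)" by (simp add: z_def algebra_simps)
    then have "dist y z = s * norm (y - x)" using s by (simp add: dist_norm)
    also have "\<dots> \<le> s * n" using s by (intro mult_left_mono) (auto simp: n_def)
    also have "\<dots> = e / 2" using n1 by (simp add: s_def)
    finally show ?thesis using e by simp
  qed
  ultimately have zP: "z \<in> P" using e F by auto
  define t where "t = s / (1 + s)"
  have t: "0 < t" "t \<le> 1" using s by (auto simp: t_def)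
  have "y + v \<in> P" if c: "conic_at y P \<epsilon>" and v: "norm v < \<epsilon>" "x + v \<in> P" for \<epsilon> v
  proof -
    have "(1 / (1 + s)) *\<^sub>R z + t *\<^sub>R (x + v) \<in> P"
      using polyhedron_imp_convex[OF P] zP v(2) s t by (intro convexD) (auto simp: t_def field_simps)
    also have "(1 / (1 + s)) *\<^sub>R z + t *\<^sub>R (x + v) = y + t *\<^sub>R v"
    proof -
      have "(1 / (1 + s)) *\<^sub>R z = y - t *\<^sub>R x"
        using s by (simp add: z_def t_def scaleR_diff_right)
      then show ?thesis by (simp add: algebra_simps)
    qed
    finally show ?thesis using c v t by (auto simp: conic_at_def)
  qed
  then show ?thesis
    using eventually_mono[OF eventually_conic_polyhedron[OF P, of y]] by (smt (verit, best))
qed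

lemma complex_cell_subset:
  assumes "polytopal_complex K" "F \<in> K" "P \<in> K" "x \<in> rel_interior F" "x \<in> P"
  shows "F \<subseteq> P"
proof -
  note K = polytopal_complexD[OF assms(1)]
  have "F \<subseteq> F \<inter> P"
    by (rule subset_of_face_of[OF K(4)[OF assms(2,3)] order_refl])
       (use assms rel_interior_subset[of F] in auto)
  then show ?thesis by blast
qed

lemma eventually_homogeneous:
  assumes K: "polytopal_complex K" and F: "F \<in> K" and x: "x \<in> rel_interior F" and y: "y \<in> rel_interior F"
  shows "\<forall>\<^sub>F \<epsilon> in at_right 0. \<forall>v. norm v < \<epsilon> \<longrightarrow> (x + v \<in> \<Union>K \<longleftrightarrow> y + v \<in> \<Union>K)"
proof -
  note K' = polytopal_complexD[OF K]
  have one: "\<forall>\<^sub>F \<epsilon> in at_right 0. \<forall>P\<in>K. \<forall>v. norm v < \<epsilon> \<and> x + v \<in> P \<longrightarrow> y + v \<in> P"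
    if x: "x \<in> rel_interior F" and y: "y \<in> rel_interior F" for x y
  proof (rule eventually_ball_finite[OF K'(1)], rule ballI)
    fix P assume P: "P \<in> K"
    show "\<forall>\<^sub>F \<epsilon> in at_right 0. \<forall>v. norm v < \<epsilon> \<and> x + v \<in> P \<longrightarrow> y + v \<in> P"
    proof (cases "x \<in> P")
      case True
      then show ?thesis
        using eventually_homogeneous_polyhedron[OF polytope_imp_polyhedron[OF K'(2)[OF P]] _ x y]
          complex_cell_subset[OF K F P x] by blast
    next
      case False
      then obtain e where e: "e > 0" "ball x e \<subseteq> - P"
        using K'(8)[OF P] open_contains_ball[of "- P"] by (auto simp: open_Compl)
      show ?thesis
      proof (rule eventually_at_right_0_small[OF e(1)], intro allI impI)
        fix r v assume "0 < r" "r < e" "norm v < r \<and> x + v \<in> P"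
        then have "x + v \<in> ball x e" "x + v \<in> P" by (auto simp: dist_norm)
        then show "y + v \<in> P" using e by blast
      qed
    qed
  qed
  show ?thesis
    using one[OF x y] one[OF y x] by eventually_elim blast
qed

section \<open>Cells in the boundary of a complex\<close>

lemma interior_homogeneous:
  assumes "polytopal_complex K" "F \<in> K" "x \<in> rel_interior F" "y \<in> rel_interior F" "x \<in> interior (\<Union>K)"
  shows "y \<in> interior (\<Union>K)"
proof -
  obtain e where e: "e > 0" "\<forall>v. norm v < e \<longrightarrow> (x + v \<in> \<Union>K \<longleftrightarrow> y + v \<in> \<Union>K)"
    using eventually_homogeneous[OF assms(1-4)] unfolding eventually_at_right[OF zero_less_one]
    by (metis dense)
  obtain e' where e': "e' > 0" "ball x e' \<subseteq> \<Union>K" using assms(5) mem_interior by blast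
  have "z \<in> \<Union>K" if "z \<in> ball y (min e e')" for z
  proof -
    have n: "norm (z - y) < e" "norm (z - y) < e'" using that by (auto simp: dist_norm norm_minus_commute)
    then have "x + (z - y) \<in> ball x e'" by (simp add: dist_norm norm_minus_commute)
    then show ?thesis using e(2) n e'(2) by fastforce
  qed
  then have "ball y (min e e') \<subseteq> \<Union>K" by blast
  then show ?thesis using e e' mem_interior by (metis min_less_iff_conj)
qed

text \<open>By homogeneity, the relative interior of a cell lies in the interior of the complex
  entirely or not at all; in the latter case closedness of the frontier extends this to the whole
  cell.\<close>

lemma bdry_iff:
  assumes K: "polytopal_complex K" and F: "F \<in> K" and x: "x \<in> rel_interior F"
  shows "F \<in> bdry K \<longleftrightarrow> x \<notin> interior (\<Union>K)"
proof
  note K' = polytopal_complexD[OF K]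
  have fr: "frontier (\<Union>K) = \<Union>K - interior (\<Union>K)" using K'(10) by (simp add: frontier_def)
  have "x \<in> F" using x rel_interior_subset by blast
  then show "F \<in> bdry K \<Longrightarrow> x \<notin> interior (\<Union>K)" unfolding bdry_def fr by blast
  assume nx: "x \<notin> interior (\<Union>K)"
  have "rel_interior F \<subseteq> frontier (\<Union>K)"
  proof
    fix y assume y: "y \<in> rel_interior F"
    then have "y \<in> \<Union>K" using F rel_interior_subset by blast
    moreover have "y \<notin> interior (\<Union>K)" using interior_homogeneous[OF K F y x] nx by blast
    ultimately show "y \<in> frontier (\<Union>K)" by (simp add: fr)
  qed
  then have "closure (rel_interior F) \<subseteq> frontier (\<Union>K)" by (simp add: closure_minimal)
  moreover have "closure (rel_interior F) = F"
    using convex_closure_rel_interior[OF K'(6)[OF F]] K'(8)[OF F] by simp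
  ultimately show "F \<in> bdry K" using F by (simp add: bdry_def)
qed

text \<open>A cell of smallest dimension through \<open>x\<close> works: if \<open>x\<close> were on
  its relative frontier, a facet would contain \<open>x\<close>.\<close>

lemma complex_rel_interior_cover:
  assumes K: "polytopal_complex K" and "x \<in> \<Union>K"
  obtains F where "F \<in> K" "x \<in> rel_interior F"
proof -
  note K' = polytopal_complexD[OF K]
  define M where "M = {F \<in> K. x \<in> F}"
  have "finite M" "M \<noteq> {}" using K'(1) assms(2) by (auto simp: M_def)
  then obtain F where F: "F \<in> M" "\<And>G. G \<in> M \<Longrightarrow> aff_dim F \<le> aff_dim G"
    by (metis arg_min_if_finite(1) arg_min_least)
  then have FK: "F \<in> K" "x \<in> F" by (auto simp: M_def)
  have "x \<notin> rel_frontier F"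
  proof
    assume "x \<in> rel_frontier F"
    then obtain G where G: "G facet_of F" "x \<in> G"
      using rel_frontier_of_polyhedron[OF polytope_imp_polyhedron[OF K'(2)[OF FK(1)]]] by auto
    then have "G \<in> M" using K'(3)[OF FK(1)] by (auto simp: M_def facet_of_def)
    then show False using F(2)[of G] G by (auto simp: facet_of_def)
  qed
  then have "x \<in> rel_interior F"
    using FK K'(8)[OF FK(1)] by (simp add: rel_frontier_def)
  then show thesis using that FK by blast
qed

lemma Union_bdry:
  assumes K: "polytopal_complex K"
  shows "\<Union>(bdry K) = frontier (\<Union>K)"
proof
  show "\<Union>(bdry K) \<subseteq> frontier (\<Union>K)" by (auto simp: bdry_def)
  show "frontier (\<Union>K) \<subseteq> \<Union>(bdry K)"
  proof
    fix x assume x: "x \<in> frontier (\<Union>K)"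
    then have "x \<in> \<Union>K" "x \<notin> interior (\<Union>K)"
      using polytopal_complexD(10)[OF K] frontier_subset_closed by (auto simp: frontier_def)
    then obtain F where "F \<in> K" "x \<in> rel_interior F" using complex_rel_interior_cover[OF K] by blast
    then have "F \<in> bdry K" "x \<in> F" using bdry_iff[OF K] \<open>x \<notin> interior (\<Union>K)\<close> rel_interior_subset by blast+
    then show "x \<in> \<Union>(bdry K)" by blast
  qed
qed

lemma bdry_aff_dim:
  fixes K :: "'a::euclidean_space set set"
  assumes K: "polytopal_complex K" and F: "F \<in> bdry K"
  shows "aff_dim F < int DIM('a)"
proof (rule ccontr)
  assume "\<not> ?thesis"
  then have d: "aff_dim F = int DIM('a)" using aff_dim_le_DIM[of F] by simp
  have FK: "F \<in> K" "F \<subseteq> frontier (\<Union>K)" using F by (auto simp: bdry_def)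
  have "rel_interior F \<noteq> {}"
    using polytopal_complexD(6)[OF K FK(1)] d rel_interior_eq_empty[of F] by fastforce
  moreover have "rel_interior F = interior F"
    using d rel_interior_interior[of F] aff_dim_eq_full[of F] by simp
  moreover have "interior F \<subseteq> interior (\<Union>K)" using FK by (intro interior_mono) auto
  moreover have "interior F \<subseteq> frontier (\<Union>K)" using FK interior_subset by blast
  ultimately show False by (auto simp: frontier_def)
qed

section \<open>Solid angles as ball densities\<close>

text \<open>The share of a ball is visibly additive over sets with negligible overlap, whereas
  \<open>sphere_vol\<close> refers to cones over parts of a sphere. For complexes and small radii
  both give the same ratio.\<close>

definition ball_density :: "'a::euclidean_space \<Rightarrow> 'a set \<Rightarrow> real \<Rightarrow> real" where
  "ball_density x X r = measure lebesgue (cball x r \<inter> X) / measure lebesgue (cball x r)"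

lemma conic_at_interior:
  fixes x :: "'a::euclidean_space"
  assumes "conic_at x X \<epsilon>"
  shows "conic_at x (interior X) \<epsilon>"
  unfolding conic_at_def
proof (intro allI impI iffI)
  fix v :: 'a and t :: real assume vt: "norm v < \<epsilon> \<and> 0 < t \<and> t \<le> 1"
  {
    assume "x + t *\<^sub>R v \<in> interior X"
    then obtain d where d: "d > 0" "ball (x + t *\<^sub>R v) d \<subseteq> X" using mem_interior by blast
    have "ball (x + v) (min d (\<epsilon> - norm v)) \<subseteq> X"
    proof
      fix z assume z: "z \<in> ball (x + v) (min d (\<epsilon> - norm v))"
      define w where "w = z - x - v"
      have nw: "norm w < d" "norm w < \<epsilon> - norm v" and zw: "z = x + (v + w)"
        using z by (auto simp: w_def dist_norm norm_minus_commute algebra_simps)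
      have "norm (t *\<^sub>R w) < d" using nw vt by (simp add: le_less_trans[OF mult_left_le_one_le])
      then have "x + t *\<^sub>R (v + w) \<in> X"
        using d(2) by (auto simp: subset_iff dist_norm algebra_simps)
      moreover have "norm (v + w) < \<epsilon>" using nw norm_triangle_ineq[of v w] by simp
      ultimately show "z \<in> X" using assms vt zw by (auto simp: conic_at_def)
    qed
    then show "x + v \<in> interior X" using d(1) vt mem_interior by (metis diff_gt_0_iff_gt min_less_iff_conj)
  }
  {
    assume "x + v \<in> interior X"
    then obtain d where d: "d > 0" "ball (x + v) d \<subseteq> X" using mem_interior by blast
    define e where "e = min d (\<epsilon> - norm v)"
    have e: "e > 0" using d vt by (simp add: e_def)
    have "ball (x + t *\<^sub>R v) (t * e) \<subseteq> X"
    proof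
      fix z assume z: "z \<in> ball (x + t *\<^sub>R v) (t * e)"
      define w where "w = (1 / t) *\<^sub>R (z - x) - v"
      have zw: "z = x + t *\<^sub>R (v + w)" using vt by (simp add: w_def)
      have "t * norm w < t * e"
        using z vt unfolding zw by (simp add: dist_norm algebra_simps)
      then have nw: "norm w < e" using vt by simp
      then have "x + (v + w) \<in> X" using d(2) by (auto simp: subset_iff dist_norm e_def algebra_simps)
      moreover have "norm (v + w) < \<epsilon>" using nw norm_triangle_ineq[of v w] by (simp add: e_def)
      ultimately show "z \<in> X" using assms vt zw by (auto simp: conic_at_def)
    qed
    moreover have "t * e > 0" using e vt by simp
    ultimately show "x + t *\<^sub>R v \<in> interior X" using mem_interior by blast
  }
qed

text \<open>The cone from \<open>x\<close> over the part of the sphere is the part of the ball,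
  except possibly for the apex, which is negligible.\<close>

lemma sphere_vol_eq_cball:
  fixes x :: "'a::euclidean_space"
  assumes c: "conic_at x (interior X) \<epsilon>" and r: "0 < r" "r < \<epsilon>"
  shows "sphere_vol x r (sphere x r \<inter> interior X) =
         real DIM('a) / r * measure lebesgue (cball x r \<inter> interior X)"
proof -
  let ?S = "{x + t *\<^sub>R (y - x) | t y. 0 \<le> t \<and> t \<le> 1 \<and> y \<in> sphere x r \<inter> interior X}"
  let ?T = "cball x r \<inter> interior X"
  have "?S - {x} \<subseteq> ?T"
  proof
    fix z assume "z \<in> ?S - {x}"
    then obtain t y where z: "z = x + t *\<^sub>R (y - x)" "0 \<le> t" "t \<le> 1" "dist x y = r" "y \<in> interior X" "z \<noteq> x"
      by auto
    then have t: "t > 0" by (cases "t = 0") auto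
    have n: "norm (y - x) = r" using z by (simp add: dist_norm norm_minus_commute)
    have "z \<in> interior X" using c r t z n unfolding conic_at_def by (auto dest!: spec[of _ "y - x"])
    moreover have "dist x z \<le> r" using z n r by (simp add: dist_norm mult_left_le_one_le)
    ultimately show "z \<in> ?T" by simp
  qed
  moreover have "?T - {x} \<subseteq> ?S"
  proof
    fix z assume z: "z \<in> ?T - {x}"
    define n where "n = norm (z - x)"
    have n: "n > 0" "n \<le> r" using z by (auto simp: n_def dist_norm norm_minus_commute)
    define y where "y = x + (r / n) *\<^sub>R (z - x)"
    have yx: "z = x + (n / r) *\<^sub>R (y - x)" "norm (y - x) = r"
      using n r by (auto simp: y_def n_def)
    moreover have "y \<in> interior X"
      using c[unfolded conic_at_def, rule_format, of "y - x" "n / r"] n r z yx by (auto simp: field_simps)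
    ultimately show "z \<in> ?S"
      using n r by (intro CollectI exI[of _ "n / r"] exI[of _ y]) (auto simp: dist_norm norm_minus_commute)
  qed
  ultimately have "negligible (?T - ?S \<union> (?S - ?T))"
    by (intro negligible_subset[OF negligible_sing[of x]]) blast
  moreover have "?T \<in> lmeasurable"
    by (intro fmeasurable_Int_fmeasurable) auto
  ultimately have "measure lebesgue ?S = measure lebesgue ?T"
    by (rule measure_negligible_symdiff[rotated])
  then show ?thesis by (simp add: sphere_vol_def)
qed

text \<open>Passing from the interior to the closed set changes volumes only by the negligible
  frontier.\<close>

lemma solid_angle_ratio_density:
  fixes x :: "'a::euclidean_space"
  assumes c: "conic_at x X \<epsilon>" and r: "0 < r" "r < \<epsilon>" and X: "closed X" "negligible (frontier X)"
  shows "sphere_vol x r (sphere x r \<inter> interior X) / sphere_vol x r (sphere x r) = ball_density x X r"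
proof -
  have u: "sphere_vol x r (sphere x r) = real DIM('a) / r * measure lebesgue (cball x r)"
    using sphere_vol_eq_cball[of x UNIV \<epsilon> r] r by (simp add: conic_at_def)
  have "cball x r \<inter> X \<in> lmeasurable"
    using X(1) by (intro lmeasurable_compact compact_Int_closed) auto
  moreover have "negligible (cball x r \<inter> X - cball x r \<inter> interior X \<union> (cball x r \<inter> interior X - cball x r \<inter> X))"
    by (rule negligible_subset[OF X(2)]) (use X(1) interior_subset in \<open>auto simp: frontier_def\<close>)
  ultimately have "measure lebesgue (cball x r \<inter> interior X) = measure lebesgue (cball x r \<inter> X)"
    by (rule measure_negligible_symdiff)
  then show ?thesis
    using sphere_vol_eq_cball[OF conic_at_interior[OF c] r] u r by (simp add: ball_density_def)
qed

text \<open>The homothety with centre \<open>x\<close> and ratio \<open>r / s\<close> maps the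
  larger ball and the part of \<open>X\<close> in it onto the smaller ones, and multiplies both
  volumes by the same factor.\<close>

lemma ball_density_scale:
  fixes x :: "'a::euclidean_space"
  assumes c: "conic_at x X \<epsilon>" and r: "0 < r" "r \<le> s" "s < \<epsilon>"
  shows "ball_density x X r = ball_density x X s"
proof -
  define m where "m = r / s"
  have m: "0 < m" "m \<le> 1" using r by (auto simp: m_def)
  have sc: "cball x r \<inter> Y = (\<lambda>z. (x - m *\<^sub>R x) + m *\<^sub>R z) ` (cball x s \<inter> Y)" if cY: "conic_at x Y \<epsilon>" for Y
  proof (intro equalityI subsetI)
    fix z assume z: "z \<in> cball x r \<inter> Y"
    define v where "v = (1 / m) *\<^sub>R (z - x)"
    have v: "z = x + m *\<^sub>R v" using m by (simp add: v_def)
    have "m * norm v \<le> r" using z m unfolding v by (simp add: dist_norm)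
    then have nv: "norm v \<le> s" using r m by (simp add: m_def field_simps)
    then have "x + v \<in> Y" using cY z m r v by (auto simp: conic_at_def)
    then show "z \<in> (\<lambda>z. (x - m *\<^sub>R x) + m *\<^sub>R z) ` (cball x s \<inter> Y)"
      using nv v by (intro image_eqI[of _ _ "x + v"]) (auto simp: algebra_simps dist_norm)
  next
    fix z assume "z \<in> (\<lambda>z. (x - m *\<^sub>R x) + m *\<^sub>R z) ` (cball x s \<inter> Y)"
    then obtain y where y: "z = (x - m *\<^sub>R x) + m *\<^sub>R y" and "y \<in> cball x s \<inter> Y"
      by (rule imageE)
    then have yY: "norm (y - x) \<le> s" "y \<in> Y"
      by (auto simp: dist_norm norm_minus_commute)
    have z: "z = x + m *\<^sub>R (y - x)" by (simp add: y algebra_simps)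
    have "m * norm (y - x) \<le> m * s" using yY m by (intro mult_left_mono) auto
    then have "dist x z \<le> r" using m r by (simp add: z dist_norm m_def)
    moreover have "z \<in> Y"
      using cY[unfolded conic_at_def, rule_format, of "y - x" m] yY m r z by auto
    ultimately show "z \<in> cball x r \<inter> Y" by simp
  qed
  have ms: "measure lebesgue (cball x r \<inter> Y) = m ^ DIM('a) * measure lebesgue (cball x s \<inter> Y)" if "conic_at x Y \<epsilon>" for Y
    unfolding sc[OF that] using measure_lebesgue_affine[of m "x - m *\<^sub>R x" "cball x s \<inter> Y"] m by (simp add: add.commute)
  have "conic_at x UNIV \<epsilon>" by (simp add: conic_at_def)
  then show ?thesis
    using ms[OF c] ms[of UNIV] m by (simp add: ball_density_def)
qed

lemma ball_density_translate:
  fixes x y :: "'a::euclidean_space"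
  assumes "\<forall>v. norm v < \<epsilon> \<longrightarrow> (x + v \<in> X \<longleftrightarrow> y + v \<in> X)" "r < \<epsilon>"
  shows "ball_density x X r = ball_density y X r"
proof -
  have "cball y r \<inter> Y = (\<lambda>z. (y - x) + 1 *\<^sub>R z) ` (cball x r \<inter> Y)"
    if Y: "\<forall>v. norm v < \<epsilon> \<longrightarrow> (x + v \<in> Y \<longleftrightarrow> y + v \<in> Y)" for Y
  proof (intro equalityI subsetI)
    fix z assume z: "z \<in> cball y r \<inter> Y"
    then have "norm (z - y) \<le> r" by (simp add: dist_norm norm_minus_commute)
    moreover have "x + (z - y) \<in> Y" using Y[rule_format, of "z - y"] z calculation assms(2) by auto
    ultimately show "z \<in> (\<lambda>z. (y - x) + 1 *\<^sub>R z) ` (cball x r \<inter> Y)"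
      by (intro image_eqI[of _ _ "x + (z - y)"]) (auto simp: dist_norm norm_minus_commute)
  next
    fix z assume "z \<in> (\<lambda>z. (y - x) + 1 *\<^sub>R z) ` (cball x r \<inter> Y)"
    then obtain w where w: "z = y + (w - x)" "norm (w - x) \<le> r" "w \<in> Y"
      by (auto simp: dist_norm norm_minus_commute)
    then show "z \<in> cball y r \<inter> Y"
      using Y[rule_format, of "w - x"] assms(2) by (auto simp: dist_norm norm_minus_commute)
  qed
  then have "measure lebesgue (cball y r \<inter> Y) = measure lebesgue (cball x r \<inter> Y)"
    if "\<forall>v. norm v < \<epsilon> \<longrightarrow> (x + v \<in> Y \<longleftrightarrow> y + v \<in> Y)" for Y
    using that measure_lebesgue_affine[of 1 "y - x" "cball x r \<inter> Y"] by (simp add: add.commute)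
  from this[of X] this[of UNIV] show ?thesis
    using assms(1) by (simp add: ball_density_def)
qed

text \<open>A frontier point of the union is a frontier point of some cell, and convex sets have
  negligible frontier.\<close>

lemma negligible_frontier_complex:
  assumes "polytopal_complex K"
  shows "negligible (frontier (\<Union>K))"
proof -
  note K = polytopal_complexD[OF assms]
  have "frontier (\<Union>K) \<subseteq> \<Union>(frontier ` K)"
  proof
    fix x assume x: "x \<in> frontier (\<Union>K)"
    then obtain P where P: "P \<in> K" "x \<in> P" using K(10) frontier_subset_closed by blast
    moreover have "interior P \<subseteq> interior (\<Union>K)" using P by (intro interior_mono) auto
    ultimately have "x \<in> frontier P" using x closure_subset by (auto simp: frontier_def)
    then show "x \<in> \<Union>(frontier ` K)" using P by blast
  qed
  moreover have "negligible (\<Union>(frontier ` K))"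
    using K by (intro negligible_Union) (auto intro: negligible_convex_frontier)
  ultimately show ?thesis by (rule negligible_subset[rotated])
qed

text \<open>Scaling makes the quotient independent of the radius and translation along
  \<open>F\<close> makes it independent of the point, so the definite description in
  \<open>solid_angle\<close> denotes. From here on a solid angle is a density at one relative
  interior point.\<close>

lemma solid_angle_density:
  fixes K :: "'a::euclidean_space set set"
  assumes K: "polytopal_complex K" and F: "F \<in> K" and x: "x \<in> rel_interior F"
  shows "\<forall>\<^sub>F r in at_right 0. ball_density x (\<Union>K) r = solid_angle F K"
proof -
  note K' = polytopal_complexD[OF K]
  let ?q = "\<lambda>y r. sphere_vol y r (sphere y r \<inter> interior (\<Union>K)) / sphere_vol y r (sphere y r)"
  obtain e where e: "e > 0" "conic_at x (\<Union>K) e"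
    using eventually_conic_complex[OF K, of x] unfolding eventually_at_right[OF zero_less_one] by (metis dense)
  define a where "a = ball_density x (\<Union>K) (e/2)"
  have a: "ball_density x (\<Union>K) r = a" if "0 < r" "r < e" for r
    unfolding a_def using ball_density_scale[OF e(2), of r "e/2"] ball_density_scale[OF e(2), of "e/2" r] that
    by (cases "r \<le> e/2") auto
  have xa: "\<forall>\<^sub>F r in at_right 0. ball_density x (\<Union>K) r = a"
    using eventually_at_right_0_small[OF e(1) a] .
  have q: "\<forall>\<^sub>F r in at_right 0. ?q y r = a" if y: "y \<in> rel_interior F" for y
  proof -
    obtain e1 where e1: "e1 > 0" "conic_at y (\<Union>K) e1"
      using eventually_conic_complex[OF K, of y] unfolding eventually_at_right[OF zero_less_one] by (metis dense)
    obtain e2 where e2: "e2 > 0" "\<forall>v. norm v < e2 \<longrightarrow> (x + v \<in> \<Union>K \<longleftrightarrow> y + v \<in> \<Union>K)"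
      using eventually_homogeneous[OF K F x y] unfolding eventually_at_right[OF zero_less_one] by (metis dense)
    have "?q y r = a" if r: "0 < r" "r < min e (min e1 e2)" for r
      using solid_angle_ratio_density[OF e1(2), of r] K'(10) negligible_frontier_complex[OF K] r
        ball_density_translate[OF e2(2), of r] a[of r] by simp
    then show ?thesis
      using e e1 e2 by (intro eventually_at_right_0_small[of "min e (min e1 e2)"]) auto
  qed
  have "solid_angle F K = a"
    unfolding solid_angle_def
  proof (rule the_equality)
    show "\<forall>x\<in>rel_interior F. \<forall>\<^sub>F r in at_right 0. ?q x r = a" using q by blast
    fix b assume "\<forall>x\<in>rel_interior F. \<forall>\<^sub>F r in at_right 0. ?q x r = b"
    then have "\<forall>\<^sub>F r in at_right 0. ?q x r = b" using x by blast
    then have "\<forall>\<^sub>F r in at_right (0::real). a = b" using q[OF x] by eventually_elim simp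
    then show "b = a" by (simp add: trivial_limit_at_right_real)
  qed
  then show ?thesis using xa by simp
qed

section \<open>Interior points of the glued discs\<close>

text \<open>Split \<open>v\<close> into \<open>h + l *\<^sub>R (w - z)\<close> with \<open>h\<close>
  parallel to the hyperplane. For small \<open>t\<close> the point \<open>z + t *\<^sub>R v\<close>
  is a convex combination of \<open>w\<close> and a point \<open>g\<close> of \<open>G\<close>;
  conicity at \<open>z\<close> then removes \<open>t\<close>.\<close>

lemma half_ball_in_polyhedron_aux:
  fixes a :: "'a::euclidean_space"
  assumes G: "affine hull G = {y. a \<bullet> y = b}" "z \<in> rel_interior G" "G \<subseteq> P" and P: "polyhedron P"
    and w: "w \<in> P" "a \<bullet> w < b"
  shows "\<exists>\<epsilon>>0. \<forall>v. norm v < \<epsilon> \<and> a \<bullet> v \<le> 0 \<longrightarrow> z + v \<in> P"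
proof -
  obtain \<epsilon> where \<epsilon>: "\<epsilon> > 0" "conic_at z P \<epsilon>"
    using eventually_conic_polyhedron[OF P, of z] unfolding eventually_at_right[OF zero_less_one] by (metis dense)
  obtain e where e: "e > 0" "ball z e \<inter> affine hull G \<subseteq> G"
    using G(2) by (auto simp: mem_rel_interior_ball)
  have az: "a \<bullet> z = b"
    using G(1,2) rel_interior_subset[of G] hull_subset[of G affine] by auto
  have "z + v \<in> P" if v: "norm v < \<epsilon>" "a \<bullet> v \<le> 0" for v
  proof -
    have neg: "a \<bullet> (w - z) < 0" using w az by (simp add: inner_diff_right)
    define l where "l = (a \<bullet> v) / (a \<bullet> (w - z))"
    have l: "l \<ge> 0" using neg v by (simp add: l_def divide_nonpos_neg)
    define h where "h = v - l *\<^sub>R (w - z)"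
    have ah: "a \<bullet> h = 0" using neg by (simp add: h_def l_def inner_diff_right)
    \<comment> \<open>The second bound keeps the weight \<open>t * l\<close> of \<open>w\<close>
      below or at 1/2. The displacement of \<open>g\<close> from \<open>z\<close> is then at most
      \<open>2 * t * norm h\<close>, which the third bound makes smaller than
      \<open>e\<close>.\<close>
    define t where "t = min 1 (min (1 / (2 * (l + 1))) (e / (4 * (norm h + 1))))"
    have h1: "norm h + 1 > 0" by (meson add_nonneg_pos norm_ge_zero zero_less_one)
    have t: "0 < t" "t \<le> 1" using l e h1 by (auto simp: t_def)
    have "t * l \<le> 1 / (2 * (l + 1)) * l" using l by (intro mult_right_mono) (auto simp: t_def)
    also have "\<dots> \<le> 1 / 2" using l by (simp add: field_simps)
    finally have tl: "t * l \<le> 1 / 2" .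
    have "2 * t * norm h \<le> 2 * (e / (4 * (norm h + 1))) * norm h"
      by (intro mult_right_mono mult_left_mono) (auto simp: t_def)
    also have "\<dots> < e" using e h1 by (simp add: field_simps add_pos_nonneg)
    finally have th: "2 * t * norm h < e" .
    define g where "g = z + (t / (1 - t * l)) *\<^sub>R h"
    have "t / (1 - t * l) \<le> 2 * t" using tl t by (simp add: field_simps)
    then have "t / (1 - t * l) * norm h < e"
      using th by (meson le_less_trans mult_right_mono norm_ge_zero)
    then have "dist z g < e" using tl t by (simp add: g_def dist_norm)
    moreover have "g \<in> affine hull G" using G(1) az ah by (simp add: g_def inner_add_right)
    ultimately have "g \<in> P" using e G(3) by auto
    then have "(1 - t * l) *\<^sub>R g + (t * l) *\<^sub>R w \<in> P"
      using polyhedron_imp_convex[OF P] w(1) tl t l by (intro convexD) auto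
    also have "(1 - t * l) *\<^sub>R g + (t * l) *\<^sub>R w = z + t *\<^sub>R v"
    proof -
      have "(1 - t * l) *\<^sub>R g = (1 - t * l) *\<^sub>R z + t *\<^sub>R h"
        using tl by (simp add: g_def scaleR_add_right)
      then show ?thesis by (simp add: h_def algebra_simps)
    qed
    finally show ?thesis using \<epsilon>(2) v t by (auto simp: conic_at_def)
  qed
  then show ?thesis using \<epsilon>(1) by blast
qed

lemma half_ball_in_polyhedron:
  fixes a :: "'a::euclidean_space"
  assumes G: "affine hull G = {y. a \<bullet> y = b}" "z \<in> rel_interior G" "G \<subseteq> P" and P: "polyhedron P"
    and a: "a \<noteq> 0" and d: "aff_dim P = int DIM('a)"
  shows "\<exists>\<epsilon>>0. (\<forall>v. norm v < \<epsilon> \<and> a \<bullet> v \<le> 0 \<longrightarrow> z + v \<in> P) \<or> (\<forall>v. norm v < \<epsilon> \<and> a \<bullet> v \<ge> 0 \<longrightarrow> z + v \<in> P)"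
proof -
  have "\<not> P \<subseteq> {y. a \<bullet> y = b}"
    using aff_dim_subset[of P "{y. a \<bullet> y = b}"] d a by (auto simp: aff_dim_hyperplane)
  then obtain w where "w \<in> P" "a \<bullet> w \<noteq> b" by blast
  then consider "a \<bullet> w < b" | "(- a) \<bullet> w < - b" by fastforce
  then show ?thesis
  proof cases
    case 1
    then show ?thesis using half_ball_in_polyhedron_aux[OF G P \<open>w \<in> P\<close>] by blast
  next
    case 2
    have "affine hull G = {y. (- a) \<bullet> y = - b}" using G(1) by simp
    then show ?thesis using half_ball_in_polyhedron_aux[OF _ G(2,3) P \<open>w \<in> P\<close> 2] by force
  qed
qed

lemma open_subset_frontier_empty:
  assumes "open U" "U \<subseteq> frontier X" "closed X"
  shows "U = {}"
proof -
  have "U \<subseteq> X" using assms frontier_subset_closed by blast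
  then have "U \<subseteq> interior X" using assms(1) interior_maximal by blast
  then show ?thesis using assms(2) by (auto simp: frontier_def)
qed

lemma geometric_complexD:
  fixes K :: "'a::euclidean_space set set"
  assumes "geometric_complex K"
  shows "polytopal_complex K" "\<And>P. P \<in> K \<Longrightarrow> \<exists>Q\<in>K. P \<subseteq> Q \<and> aff_dim Q = int DIM('a)"
  using assms by (auto simp: geometric_complex_def)

text \<open>The full-dimensional cells above \<open>G\<close> in \<open>A\<close> and in
  \<open>B\<close> each fill a half ball at \<open>z\<close>. They cannot fill the same one, since
  the overlap of the complexes lies in a frontier and contains no nonempty open set; so together
  they fill the ball.\<close>

lemma codim1_face_interior:
  fixes A B :: "'a::euclidean_space set set"
  assumes A: "geometric_complex A" and B: "geometric_complex B"
    and AB: "\<Union>A \<inter> \<Union>B \<subseteq> frontier (\<Union>A)"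
    and G: "G \<in> A" "G \<in> B" "aff_dim G = int DIM('a) - 1" and z: "z \<in> rel_interior G"
  shows "z \<in> interior (\<Union>A \<union> \<Union>B)"
proof -
  obtain a b where ab: "a \<noteq> 0" "affine hull G = {y. a \<bullet> y = b}"
    using G(3) aff_dim_eq_hyperplane[of G] by auto
  have half: "\<exists>\<epsilon>>0. (\<forall>v. norm v < \<epsilon> \<and> a \<bullet> v \<le> 0 \<longrightarrow> z + v \<in> \<Union>K) \<or> (\<forall>v. norm v < \<epsilon> \<and> a \<bullet> v \<ge> 0 \<longrightarrow> z + v \<in> \<Union>K)"
    if K: "geometric_complex K" "G \<in> K" for K
  proof -
    obtain P where P: "P \<in> K" "G \<subseteq> P" "aff_dim P = int DIM('a)" using geometric_complexD(2)[OF K] by blast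
    then have "polyhedron P" using polytopal_complexD(2)[OF geometric_complexD(1)[OF K(1)]] polytope_imp_polyhedron by blast
    then show ?thesis using half_ball_in_polyhedron[OF ab(2) z P(2) _ ab(1) P(3)] P(1) by blast
  qed
  obtain \<epsilon>1 where e1: "\<epsilon>1 > 0" "(\<forall>v. norm v < \<epsilon>1 \<and> a \<bullet> v \<le> 0 \<longrightarrow> z + v \<in> \<Union>A) \<or> (\<forall>v. norm v < \<epsilon>1 \<and> a \<bullet> v \<ge> 0 \<longrightarrow> z + v \<in> \<Union>A)"
    using half[OF A G(1)] by blast
  obtain \<epsilon>2 where e2: "\<epsilon>2 > 0" "(\<forall>v. norm v < \<epsilon>2 \<and> a \<bullet> v \<le> 0 \<longrightarrow> z + v \<in> \<Union>B) \<or> (\<forall>v. norm v < \<epsilon>2 \<and> a \<bullet> v \<ge> 0 \<longrightarrow> z + v \<in> \<Union>B)"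
    using half[OF B G(2)] by blast
  define \<epsilon> where "\<epsilon> = min \<epsilon>1 \<epsilon>2"
  have \<epsilon>: "\<epsilon> > 0" using e1 e2 by (simp add: \<epsilon>_def)
  have clA: "closed (\<Union>A)" using polytopal_complexD(10)[OF geometric_complexD(1)[OF A]] .
  have no: False if c: "c \<noteq> 0" "\<And>v. norm v < \<epsilon> \<Longrightarrow> c \<bullet> v \<le> 0 \<Longrightarrow> z + v \<in> \<Union>A \<inter> \<Union>B" for c
  proof -
    define U where "U = ball z \<epsilon> \<inter> {y. c \<bullet> y < c \<bullet> z}"
    have "open U" unfolding U_def by (intro open_Int open_ball open_halfspace_lt)
    moreover have "U \<subseteq> \<Union>A \<inter> \<Union>B"
    proof
      fix y assume "y \<in> U"
      then have "norm (y - z) < \<epsilon>" "c \<bullet> (y - z) \<le> 0"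
        by (auto simp: U_def dist_norm norm_minus_commute inner_diff_right)
      then show "y \<in> \<Union>A \<inter> \<Union>B" using c(2)[of "y - z"] by simp
    qed
    ultimately have "U = {}"
      by (rule open_subset_frontier_empty[OF _ subset_trans[OF _ AB] clA])
    moreover have "z - (\<epsilon> / (2 * norm c)) *\<^sub>R c \<in> U"
      using c(1) \<epsilon> by (simp add: U_def dist_norm inner_diff_right)
    ultimately show False by blast
  qed
  have "ball z \<epsilon> \<subseteq> \<Union>A \<union> \<Union>B"
  proof
    fix y assume "y \<in> ball z \<epsilon>"
    then have n: "norm (y - z) < \<epsilon>1" "norm (y - z) < \<epsilon>2" by (auto simp: \<epsilon>_def dist_norm norm_minus_commute)
    have "(\<forall>v. norm v < \<epsilon>1 \<and> a \<bullet> v \<le> 0 \<longrightarrow> z + v \<in> \<Union>A) \<and> (\<forall>v. norm v < \<epsilon>2 \<and> a \<bullet> v \<ge> 0 \<longrightarrow> z + v \<in> \<Union>B) \<or>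
      (\<forall>v. norm v < \<epsilon>1 \<and> a \<bullet> v \<ge> 0 \<longrightarrow> z + v \<in> \<Union>A) \<and> (\<forall>v. norm v < \<epsilon>2 \<and> a \<bullet> v \<le> 0 \<longrightarrow> z + v \<in> \<Union>B)"
      using e1(2) e2(2) no[of a] no[of "- a"] ab(1) by (auto simp: \<epsilon>_def)
    moreover have "z + (y - z) = y" by simp
    ultimately show "y \<in> \<Union>A \<union> \<Union>B"
      using n by (metis Un_iff linorder_le_cases)
  qed
  then show ?thesis using \<epsilon> mem_interior by blast
qed

text \<open>Let \<open>p\<close> be a point near \<open>x\<close> outside \<open>X\<close>. Together
  with \<open>p\<close>, each member of \<G> spans at most a hyperplane, so some interior point
  \<open>q\<close> of \<open>X\<close> near \<open>x\<close> avoids all these spans. The segment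
  from \<open>p\<close> to \<open>q\<close> would then enter \<open>X\<close> without meeting its
  frontier.\<close>

lemma frontier_subset_low_dim_interior:
  fixes X :: "'a::euclidean_space set"
  assumes X: "closed X" and e: "e > 0" and x: "x \<in> closure (interior X)"
    and \<G>: "finite \<G>" "\<And>G. G \<in> \<G> \<Longrightarrow> aff_dim G \<le> int DIM('a) - 2"
    and fr: "frontier X \<inter> ball x e \<subseteq> \<Union>\<G>"
  shows "x \<in> interior X"
proof (rule ccontr)
  assume nx: "x \<notin> interior X"
  obtain p where p: "p \<in> ball x e" "p \<notin> X"
    using nx e mem_interior[of x X] by blast
  define W where "W = interior X \<inter> ball x e"
  have "W \<noteq> {}" using x e unfolding W_def
    by (metis centre_in_ball closure_iff_nhds_not_empty open_ball order_refl inf_commute)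
  have "negligible (\<Union>G\<in>\<G>. affine hull (insert p G))"
  proof (rule negligible_Union)
    show "finite ((\<lambda>G. affine hull (insert p G)) ` \<G>)" using \<G>(1) by simp
    fix T assume "T \<in> (\<lambda>G. affine hull (insert p G)) ` \<G>"
    then obtain G where G: "G \<in> \<G>" "T = affine hull (insert p G)" by blast
    have "aff_dim (insert p G) \<le> aff_dim G + 1" by (simp add: aff_dim_insert)
    then have "aff_dim T < int DIM('a)" using \<G>(2)[OF G(1)] G(2) by (simp add: aff_dim_affine_hull)
    moreover have "convex T" by (simp add: G(2) convex_affine_hull)
    ultimately have "interior T = {}" using aff_dim_nonempty_interior by fastforce
    then show "negligible T" using \<open>convex T\<close> by (simp add: negligible_convex_interior)
  qed
  moreover have "open W" by (simp add: W_def open_Int)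
  ultimately have "\<not> W \<subseteq> (\<Union>G\<in>\<G>. affine hull (insert p G))"
    using \<open>W \<noteq> {}\<close> open_not_negligible negligible_subset by blast
  then obtain q where "q \<in> W" and q': "q \<notin> (\<Union>G\<in>\<G>. affine hull (insert p G))" by blast
  then have q: "q \<in> interior X" "q \<in> ball x e" by (auto simp: W_def)
  have q3: "q \<notin> affine hull (insert p G)" if "G \<in> \<G>" for G using q' that by blast
  have "closed_segment p q \<inter> frontier X \<noteq> {}"
    by (rule connected_Int_frontier) (use p q interior_subset in auto)
  then obtain g where g: "g \<in> closed_segment p q" "g \<in> frontier X" by blast
  have "closed_segment p q \<subseteq> ball x e" using p q by (intro closed_segment_subset) auto
  then obtain G where G: "G \<in> \<G>" "g \<in> G" using g fr by blast
  have "g \<noteq> p" using g p(2) X frontier_subset_closed by blast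
  obtain u where u: "g = (1 - u) *\<^sub>R p + u *\<^sub>R q" using g by (auto simp: in_segment)
  then have "u \<noteq> 0" using \<open>g \<noteq> p\<close> by auto
  \<comment> \<open>\<open>q\<close> is on the line through \<open>p\<close> and the frontier point
    \<open>g\<close>, hence in a span that it was chosen to avoid.\<close>
  then have "q = (1 - 1 / u) *\<^sub>R p + (1 / u) *\<^sub>R g" by (simp add: u algebra_simps)
  moreover have "p \<in> affine hull (insert p G)" "g \<in> affine hull (insert p G)"
    using G by (auto intro: hull_inc)
  ultimately have "q \<in> affine hull (insert p G)"
    using mem_affine[of "affine hull (insert p G)" p g "1 - 1 / u" "1 / u"] by simp
  then show False using q3[OF G(1)] by blast
qed

text \<open>Purity: every point is in a full-dimensional cell, which is the closure of its
  interior.\<close>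

lemma geometric_complex_closure_interior:
  fixes K :: "'a::euclidean_space set set"
  assumes K: "geometric_complex K"
  shows "\<Union>K \<subseteq> closure (interior (\<Union>K))"
proof
  fix x assume "x \<in> \<Union>K"
  then obtain P where P: "P \<in> K" "x \<in> P" "aff_dim P = int DIM('a)"
    using geometric_complexD(2)[OF K] by blast
  note K' = polytopal_complexD[OF geometric_complexD(1)[OF K]]
  have "closure (rel_interior P) = P"
    using convex_closure_rel_interior[OF K'(6)[OF P(1)]] K'(8)[OF P(1)] by simp
  moreover have "rel_interior P = interior P"
    using P(3) rel_interior_interior[of P] aff_dim_eq_full[of P] by simp
  moreover have "closure (interior P) \<subseteq> closure (interior (\<Union>K))"
    using P by (intro closure_mono interior_mono) auto
  ultimately show "x \<in> closure (interior (\<Union>K))" using P(2) by (metis subsetD)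
qed

text \<open>Near \<open>x\<close> the frontier of the union lies in common cells. A frontier point
  cannot be in the relative interior of a common cell of codimension 1, which leaves cells of
  codimension at least 2.\<close>

lemma glued_interior_point:
  fixes A B :: "'a::euclidean_space set set"
  assumes gl: "gluing C A B" and e: "e > 0" and x: "x \<in> \<Union>A"
    and fr: "frontier (\<Union>A) \<inter> ball x e \<subseteq> \<Union>(A \<inter> B)" "frontier (\<Union>B) \<inter> ball x e \<subseteq> \<Union>(A \<inter> B)"
  shows "x \<in> interior (\<Union>A \<union> \<Union>B)"
proof -
  have A: "geometric_complex A" and B: "geometric_complex B" and XY: "\<Union>A \<inter> \<Union>B = \<Union>(A \<inter> B)"
    and bd: "A \<inter> B \<subseteq> bdry A"
    using gl by (auto simp: gluing_def)
  note A' = polytopal_complexD[OF geometric_complexD(1)[OF A]] and B' = polytopal_complexD[OF geometric_complexD(1)[OF B]]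
  have XYf: "\<Union>A \<inter> \<Union>B \<subseteq> frontier (\<Union>A)" using XY bd by (auto simp: bdry_def)
  define \<G> where "\<G> = {G \<in> A \<inter> B. aff_dim G \<le> int DIM('a) - 2}"
  have AB: "polytopal_complex (A \<inter> B)"
    using geometric_complexD(1)[OF A] geometric_complexD(1)[OF B] by (auto simp: polytopal_complex_def)
  show ?thesis
  proof (rule frontier_subset_low_dim_interior[where \<G> = \<G>])
    show "closed (\<Union>A \<union> \<Union>B)" using A'(10) B'(10) by (rule closed_Un)
    show "x \<in> closure (interior (\<Union>A \<union> \<Union>B))"
      using geometric_complex_closure_interior[OF A] x closure_mono[OF interior_mono[of "\<Union>A" "\<Union>A \<union> \<Union>B"]] by blast
    show "finite \<G>" using A'(1) by (simp add: \<G>_def)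
    show "aff_dim G \<le> int DIM('a) - 2" if "G \<in> \<G>" for G using that by (simp add: \<G>_def)
    show "frontier (\<Union>A \<union> \<Union>B) \<inter> ball x e \<subseteq> \<Union>\<G>"
    proof
      fix z assume z: "z \<in> frontier (\<Union>A \<union> \<Union>B) \<inter> ball x e"
      then have "z \<in> frontier (\<Union>A) \<union> frontier (\<Union>B)" using frontier_Un_subset by blast
      then have "z \<in> \<Union>(A \<inter> B)" using fr z by blast
      then obtain G where G: "G \<in> A \<inter> B" "z \<in> rel_interior G" using complex_rel_interior_cover[OF AB] by blast
      have "aff_dim G < int DIM('a)" using bdry_aff_dim[OF geometric_complexD(1)[OF A]] G bd by blast
      moreover have "aff_dim G \<noteq> int DIM('a) - 1"
        using codim1_face_interior[OF A B XYf _ _ _ G(2)] G(1) z by (auto simp: frontier_def)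
      ultimately have "G \<in> \<G>" using G by (simp add: \<G>_def)
      then show "z \<in> \<Union>\<G>" using G(2) rel_interior_subset by blast
    qed
  qed (rule e)
qed

section \<open>Rim points of the glued discs\<close>

text \<open>Adding the sphere of radius \<open>e\<close> around the rim point to the disc localizes
  Borsuk's global criterion: a connected set that starts inside the sphere and avoids it stays
  inside. The cap is taken so small that its image misses the sphere, so the deformation can leave
  the sphere fixed.\<close>

lemma disc_boundary_not_separating:
  fixes D :: "'a::euclidean_space set"
  assumes fg: "homeomorphism (cball 0 1 \<inter> {x::'a. x \<bullet> b = 0}) D f g"
    and b: "b \<in> Basis" and u: "u \<in> sphere 0 1" "u \<bullet> b = 0" and e: "e > 0"
  obtains \<delta> where "\<delta> > 0"
    "\<And>p q. p \<in> ball (f u) \<delta> - D \<Longrightarrow> q \<in> ball (f u) \<delta> - D \<Longrightarrow> connected_component (ball (f u) e - D) p q"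
proof -
  define Q where "Q = cball 0 1 \<inter> {x::'a. x \<bullet> b = 0}"
  note fg = fg[folded Q_def]
  have contf: "continuous_on Q f" and contg: "continuous_on D g" and fQ: "f ` Q = D" and gD: "g ` D = Q"
    and gf: "\<And>y. y \<in> Q \<Longrightarrow> g (f y) = y" and fg': "\<And>z. z \<in> D \<Longrightarrow> f (g z) = z"
    using fg by (auto simp: homeomorphism_def)
  have nu: "norm u = 1" "u \<bullet> u = 1" using u by (auto simp: norm_eq_1)
  have uQ: "u \<in> Q" using u by (simp add: Q_def)
  \<comment> \<open>Borsuk's criterion is about dimension at least 2. In dimension 1 the disc is a
    point without rim: no unit vector \<open>u\<close> is orthogonal to \<open>b\<close>.\<close>
  have DIM2: "2 \<le> DIM('a)"
  proof (rule ccontr)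
    assume "\<not> ?thesis"
    then have "card (Basis::'a set) = 1" using DIM_positive[where 'a='a] by linarith
    then have "Basis = {b}" using b by (metis card_1_singletonE singletonD)
    then have "u = 0" using u(2) by (metis euclidean_all_zero_iff singletonD)
    then show False using nu by simp
  qed
  have "compact Q" unfolding Q_def
    by (intro compact_Int_closed compact_cball) (auto simp: closed_hyperplane inner_commute[of _ b])
  then have cD: "compact D" using contf fQ compact_continuous_image by blast
  obtain \<eta> where \<eta>: "\<eta> > 0" "\<And>y. y \<in> Q \<Longrightarrow> dist y u < \<eta> \<Longrightarrow> dist (f y) (f u) < e"
    using contf uQ e unfolding continuous_on_iff by metis
  \<comment> \<open>For \<open>y\<close> in the unit ball the squared distance to \<open>u\<close>
    is at most \<open>2 - 2 * (y \<bullet> u)\<close>, which is less than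
    \<open>\<eta>\<^sup>2 / 2\<close> above height \<open>1 - \<eta>\<^sup>2 / 4\<close>. That
    \<open>c\<close> is nonnegative is used to show that lowering a vector to height
    \<open>c\<close> does not lengthen it.\<close>
  define c where "c = max 0 (1 - \<eta>\<^sup>2 / 4)"
  have c: "0 \<le> c" "c < 1" using \<eta>(1) by (auto simp: c_def)
  have cap: "dist (f y) (f u) < e" if y: "y \<in> Q" "c < y \<bullet> u" for y
  proof -
    have "norm y \<le> 1" using y(1) by (simp add: Q_def)
    then have "(norm y)\<^sup>2 \<le> 1" by (simp add: power_le_one)
    then have "(norm (y - u))\<^sup>2 \<le> 2 - 2 * (y \<bullet> u)"
      using nu by (simp add: power2_norm_eq_inner inner_diff inner_commute algebra_simps)
    also have "\<dots> < \<eta>\<^sup>2"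
    proof -
      have "1 - \<eta>\<^sup>2 / 4 < y \<bullet> u" using y(2) by (simp add: c_def)
      moreover have "\<eta>\<^sup>2 > 0" using \<eta>(1) by simp
      ultimately show ?thesis by argo
    qed
    finally have "norm (y - u) < \<eta>" using \<eta>(1) by (simp add: power2_less_imp_less)
    then show ?thesis using \<eta>(2)[OF y(1)] by (simp add: dist_norm)
  qed
  define Q' where "Q' = Q \<inter> {y. y \<bullet> u \<le> c}"
  define D' where "D' = f ` Q'"
  have "compact Q'" unfolding Q'_def using \<open>compact Q\<close>
    by (intro compact_Int_closed) (auto simp: closed_halfspace_le inner_commute[of _ u])
  then have cD': "compact D'" unfolding D'_def
    by (intro compact_continuous_image continuous_on_subset[OF contf]) (auto simp: Q'_def)
  have D'D: "D' \<subseteq> D" using fQ by (auto simp: D'_def Q'_def)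
  have "f u \<notin> D'"
  proof
    assume "f u \<in> D'"
    then obtain y where "y \<in> Q'" "f u = f y" by (auto simp: D'_def)
    then have "u = y" using gf uQ by (metis IntD1 Q'_def)
    then show False using \<open>y \<in> Q'\<close> nu c by (simp add: Q'_def)
  qed
  then obtain \<delta>0 where d0: "\<delta>0 > 0" "ball (f u) \<delta>0 \<subseteq> - D'"
    using compact_imp_closed[OF cD'] open_contains_ball[of "- D'"] by (auto simp: open_Compl)
  \<comment> \<open>Within this radius only the removed cap of \<open>D\<close> is present, and the
    sphere of radius \<open>e\<close> is not reached.\<close>
  define \<delta> where "\<delta> = min \<delta>0 e"
  have \<delta>: "\<delta> > 0" "ball (f u) \<delta> \<inter> D' = {}" "ball (f u) \<delta> \<subseteq> ball (f u) e"
    using d0 e by (auto simp: \<delta>_def)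
  define S where "S = D \<union> sphere (f u) e"
  define S' where "S' = D' \<union> sphere (f u) e"
  \<comment> \<open>At \<open>t = 1\<close> the component of \<open>y\<close> in direction
    \<open>u\<close> is cut off at \<open>c\<close>; vectors at or below that height are
    fixed.\<close>
  define \<rho> where "\<rho> t y = y - (t * max 0 (y \<bullet> u - c)) *\<^sub>R u" for t :: real and y
  \<comment> \<open>\<open>H\<close> pushes the cap of \<open>D\<close> at \<open>f u\<close> into \<open>D'\<close>. It does not move the points of the sphere,
    which the cap does not reach.\<close>
  define H where "H = (\<lambda>(t, z). if z \<in> D then f (\<rho> t (g z)) else z)"
  have \<rho>Q: "\<rho> t y \<in> Q" if "y \<in> Q" "t \<in> {0..1}" for t y
  proof -
    define s where "s = t * max 0 (y \<bullet> u - c)"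
    have "(\<rho> t y) \<bullet> b = 0" using that(1) u by (simp add: \<rho>_def Q_def inner_diff_left)
    moreover have "norm (\<rho> t y) \<le> 1"
    proof (cases "y \<bullet> u \<le> c")
      case True
      then show ?thesis using that(1) by (simp add: \<rho>_def Q_def)
    next
      case False
      then have "s = t * (y \<bullet> u - c)" "0 \<le> y \<bullet> u - c" by (auto simp: s_def)
      moreover have "t * (y \<bullet> u - c) \<le> y \<bullet> u - c"
        by (rule mult_left_le_one_le) (use False that(2) in auto)
      ultimately have s: "0 \<le> s" "s \<le> y \<bullet> u"
        using that(2) c(1) by auto
      have "(norm (\<rho> t y))\<^sup>2 = y \<bullet> y - 2 * s * (y \<bullet> u) + s * s"
        unfolding power2_norm_eq_inner \<rho>_def s_def[symmetric]
        using nu by (simp add: inner_diff inner_commute algebra_simps)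
      also have "\<dots> \<le> y \<bullet> y - s * (y \<bullet> u)"
        using mult_left_mono[OF s(2) s(1)] by (simp add: algebra_simps)
      also have "\<dots> \<le> y \<bullet> y" using s by simp
      also have "\<dots> \<le> 1" using that(1) by (simp add: Q_def norm_le_square)
      finally show ?thesis by (simp add: power_le_one_iff abs_square_le_1)
    qed
    ultimately show ?thesis by (simp add: Q_def)
  qed
  have \<rho>1: "\<rho> 1 y \<in> Q'" if "y \<in> Q" for y
    using \<rho>Q[OF that, of 1] nu by (auto simp: Q'_def \<rho>_def inner_diff_left)
  have \<rho>id: "\<rho> t y = y" if "y \<bullet> u \<le> c" for t y using that by (simp add: \<rho>_def)
  have fix_sphere: "f (\<rho> t (g z)) = z" if "z \<in> D" "z \<in> sphere (f u) e" for t z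
  proof -
    have "g z \<in> Q" using that gD by blast
    then have "g z \<bullet> u \<le> c" using cap[of "g z"] fg'[OF that(1)] that(2) by (auto simp: dist_commute not_le[symmetric])
    then show ?thesis using \<rho>id fg'[OF that(1)] by simp
  qed
  have Hs: "H (t, z) = z" if "z \<in> sphere (f u) e" for t z
    using fix_sphere that by (auto simp: H_def)
  have contH: "continuous_on ({0..1} \<times> S) H"
  proof -
    have "continuous_on ({0..1} \<times> D) (\<lambda>x. \<rho> (fst x) (g (snd x)))"
      unfolding \<rho>_def
      by (intro continuous_intros continuous_on_compose2[OF contg]) auto
    then have "continuous_on ({0..1} \<times> D) (\<lambda>x. f (\<rho> (fst x) (g (snd x))))"
      by (rule continuous_on_compose2[OF contf]) (use \<rho>Q gD in auto)
    then have 1: "continuous_on ({0..1} \<times> D) H"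
      by (rule continuous_on_eq) (auto simp: H_def)
    have 2: "continuous_on ({0..1} \<times> sphere (f u) e) H"
      by (rule continuous_on_eq[where f = snd]) (use Hs in \<open>auto intro!: continuous_intros\<close>)
    have "continuous_on ({0..1} \<times> D \<union> {0..1} \<times> sphere (f u) e) H"
      using 1 2 by (intro continuous_on_closed_Un closed_Times compact_imp_closed[OF cD]) auto
    then show ?thesis by (simp add: S_def Times_Un_distrib1 Sigma_Un_distrib2)
  qed
  have HS: "H (t, z) \<in> S" if "t \<in> {0..1}" "z \<in> S" for t z
    using that \<rho>Q gD fQ by (auto simp: H_def S_def)
  have H0: "H (0, z) = z" if "z \<in> S" for z
    using fg' by (auto simp: H_def \<rho>_def)
  have H1: "H (1, z) \<in> S'" if "z \<in> S" for z
    using that \<rho>1 gD Hs by (auto simp: H_def S_def S'_def D'_def)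
  define r where "r z = H (1, z)" for z
  have hom: "homotopic_with_canon (\<lambda>_. True) S S id r"
  proof (subst homotopic_with, simp, intro exI[of _ H] conjI ballI)
    have "continuous_map (top_of_set ({0..1} \<times> S)) (top_of_set S) H"
      using contH HS by auto
    then show "continuous_map (prod_topology (top_of_set {0..1}) (top_of_set S)) (top_of_set S) H"
      by (simp add: subtopology_Times euclidean_product_topology)
  qed (use H0 in \<open>auto simp: r_def\<close>)
  show thesis
  proof (rule that[OF \<delta>(1)])
    fix p q assume p: "p \<in> ball (f u) \<delta> - D" and q: "q \<in> ball (f u) \<delta> - D"
    let ?\<beta> = "\<lambda>p z. (z - p) /\<^sub>R norm (z - p)"
    have out: "p \<notin> S" "q \<notin> S" using p q \<delta>(3) by (auto simp: S_def)
    have seg: "closed_segment p q \<subseteq> ball (f u) \<delta>" using p q by (intro closed_segment_subset) auto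
    \<comment> \<open>\<open>p\<close> and \<open>q\<close> are joined off the smaller set
      \<open>S'\<close>, which makes their Borsuk maps homotopic on \<open>S'\<close>. Composition
      with \<open>r\<close> transfers the homotopy to \<open>S\<close>.\<close>
    then have "closed_segment p q \<subseteq> - S'" using \<delta> by (auto simp: S'_def subset_iff disjoint_iff)
    then have "path_component (- S') p q"
      by (meson ends_in_segment path_component_of_subset convex_closed_segment convex_imp_path_connected path_connected_component)
    then have h': "homotopic_with_canon (\<lambda>_. True) S' (sphere 0 1) (?\<beta> p) (?\<beta> q)"
      by (rule Borsuk_maps_homotopic_in_path_component)
    have contr: "continuous_map (top_of_set S) (top_of_set S') r"
    proof -
      have "continuous_on S (H \<circ> Pair 1)"
        by (intro continuous_on_compose continuous_intros continuous_on_subset[OF contH]) auto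
      then show ?thesis using H1 by (auto simp: r_def o_def)
    qed
    have contb: "continuous_map (top_of_set S) (top_of_set (sphere 0 1)) (?\<beta> a)" if "a \<notin> S" for a
      using continuous_on_Borsuk_map[OF that] that by (auto intro!: left_inverse)
    \<comment> \<open>The deformation takes place inside \<open>S\<close>, so it never meets
      \<open>a\<close> and may be followed by the Borsuk map of \<open>a\<close>.\<close>
    have key: "homotopic_with_canon (\<lambda>_. True) S (sphere 0 1) (?\<beta> a) (?\<beta> a \<circ> r)" if "a \<notin> S" for a
      using homotopic_with_compose_continuous_map_left[OF hom contb[OF that]] by (simp add: o_def)
    have "homotopic_with_canon (\<lambda>_. True) S (sphere 0 1) (?\<beta> p \<circ> r) (?\<beta> q \<circ> r)"
      using homotopic_with_compose_continuous_map_right[OF h' contr] by simp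
    then have "homotopic_with_canon (\<lambda>_. True) S (sphere 0 1) (?\<beta> p) (?\<beta> q)"
      using key[OF out(1)] key[OF out(2)] homotopic_with_trans homotopic_with_symD by blast
    moreover have "compact S" using cD by (simp add: S_def compact_Un)
    ultimately have "connected_component (- S) p q"
      using Borsuk_maps_homotopic_in_connected_component_eq[OF _ out DIM2] by blast
    then obtain T where T: "connected T" "T \<subseteq> - S" "p \<in> T" "q \<in> T"
      unfolding connected_component_def by blast
    have "T \<subseteq> ball (f u) e"
    proof (rule ccontr)
      assume "\<not> ?thesis"
      then have "T \<inter> frontier (ball (f u) e) \<noteq> {}"
        using T p \<delta>(3) by (intro connected_Int_frontier) auto
      then show False using T(2) e by (auto simp: S_def)
    qed
    then have "T \<subseteq> ball (f u) e - D" using T(2) by (auto simp: S_def)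
    then show "connected_component (ball (f u) e - D) p q"
      using T unfolding connected_component_def by blast
  qed
qed

section \<open>Gluings\<close>

lemma gluingD:
  fixes A B C :: "'a::euclidean_space set set"
  assumes "gluing C A B"
  shows "geometric_complex A" "geometric_complex B" "polytopal_complex A" "polytopal_complex B"
    "C = A \<union> B" "\<Union>A \<inter> \<Union>B = \<Union>(A \<inter> B)" "A \<inter> B \<subseteq> bdry A" "A \<inter> B \<subseteq> bdry B"
    "\<Union>C = \<Union>A \<union> \<Union>B" "\<Union>A \<inter> \<Union>B \<subseteq> frontier (\<Union>A)" "\<Union>A \<inter> \<Union>B \<subseteq> frontier (\<Union>B)"
proof -
  show g: "geometric_complex A" "geometric_complex B" "C = A \<union> B" "\<Union>A \<inter> \<Union>B = \<Union>(A \<inter> B)"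
    "A \<inter> B \<subseteq> bdry A" "A \<inter> B \<subseteq> bdry B"
    using assms by (auto simp: gluing_def)
  show "polytopal_complex A" "polytopal_complex B"
    using g(1,2) by (simp_all add: geometric_complex_def)
  show "\<Union>C = \<Union>A \<union> \<Union>B" using g by auto
  show "\<Union>A \<inter> \<Union>B \<subseteq> frontier (\<Union>A)" "\<Union>A \<inter> \<Union>B \<subseteq> frontier (\<Union>B)"
    using g(4-6) by (auto simp: bdry_def)
qed

lemma gluing_sym: "gluing C A B \<Longrightarrow> gluing C B A"
  by (auto simp: gluing_def Int_commute)

text \<open>The definition of a gluing says how the point sets meet, not how two cells do. Take a
  common cell \<open>G\<close> through a relative interior point of \<open>P \<inter> Q\<close>. The
  faces \<open>P \<inter> G\<close> of \<open>P\<close> and \<open>Q \<inter> G\<close> of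
  \<open>Q\<close> then contain \<open>P \<inter> Q\<close>, which is thus the intersection of two
  faces of \<open>G\<close>.\<close>

lemma gluing_cell_Int:
  fixes A B C :: "'a::euclidean_space set set"
  assumes gl: "gluing C A B" and P: "P \<in> A" and Q: "Q \<in> B"
  shows "P \<inter> Q \<in> A \<inter> B"
proof (cases "P \<inter> Q = {}")
  case True
  then show ?thesis
    using polytopal_complexD(3)[OF gluingD(3)[OF gl] P, of "{}"] polytopal_complexD(3)[OF gluingD(4)[OF gl] Q, of "{}"] by simp
next
  case False
  note A = polytopal_complexD[OF gluingD(3)[OF gl]] and B = polytopal_complexD[OF gluingD(4)[OF gl]]
  have "convex (P \<inter> Q)" using A(6)[OF P] B(6)[OF Q] by (rule convex_Int)
  then obtain x where x: "x \<in> rel_interior (P \<inter> Q)" using False rel_interior_eq_empty by blast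
  then have "x \<in> P \<inter> Q" using rel_interior_subset by blast
  then obtain G where G: "G \<in> A" "G \<in> B" "x \<in> G" using gluingD(6)[OF gl] P Q by blast
  have 1: "P \<inter> Q \<subseteq> P \<inter> G"
    by (rule subset_of_face_of[OF A(4)[OF P G(1)]]) (use x G \<open>x \<in> P \<inter> Q\<close> in auto)
  have 2: "P \<inter> Q \<subseteq> Q \<inter> G"
    by (rule subset_of_face_of[OF B(4)[OF Q G(2)]]) (use x G \<open>x \<in> P \<inter> Q\<close> in auto)
  have "P \<inter> Q = (P \<inter> G) \<inter> (Q \<inter> G)" using 1 2 by blast
  moreover have "(P \<inter> G) \<inter> (Q \<inter> G) face_of G"
    using A(5)[OF P G(1)] B(5)[OF Q G(2)] by (rule face_of_Int)
  ultimately have "P \<inter> Q face_of G" by simp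
  then show ?thesis using A(3)[OF G(1)] B(3)[OF G(2)] by blast
qed

lemma polytopal_complex_gluing:
  fixes A B C :: "'a::euclidean_space set set"
  assumes gl: "gluing C A B"
  shows "polytopal_complex C"
proof -
  note A = polytopal_complexD[OF gluingD(3)[OF gl]] and B = polytopal_complexD[OF gluingD(4)[OF gl]]
  have mixed: "(P \<inter> Q) face_of P \<and> (P \<inter> Q) face_of Q" if P: "P \<in> A" and Q: "Q \<in> B" for P Q
  proof -
    have G: "P \<inter> Q \<in> A" "P \<inter> Q \<in> B" using gluing_cell_Int[OF gl P Q] by auto
    have "P \<inter> (P \<inter> Q) face_of P" "(P \<inter> Q) \<inter> Q face_of Q" using A(4)[OF P G(1)] B(5)[OF G(2) Q] by auto
    then show ?thesis by (simp add: Int_assoc Int_absorb1)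
  qed
  show ?thesis
    unfolding polytopal_complex_def gluingD(5)[OF gl]
  proof (intro conjI ballI allI impI)
    show "finite (A \<union> B)" using A(1) B(1) by simp
    show "polytope P" if "P \<in> A \<union> B" for P using that A(2) B(2) by blast
    show "F \<in> A \<union> B" if "P \<in> A \<union> B" "F face_of P" for P F using that A(3) B(3) by blast
    fix P Q assume PQ: "P \<in> A \<union> B" "Q \<in> A \<union> B"
    show "P \<inter> Q face_of P" using PQ A(4) B(4) mixed[of P Q] mixed[of Q P] by (auto simp: Int_commute)
    show "P \<inter> Q face_of Q" using PQ A(5) B(5) mixed[of P Q] mixed[of Q P] by (auto simp: Int_commute)
  qed
qed

text \<open>If a relative interior point of \<open>F\<close> were in \<open>\<Union>B\<close>, it
  would lie in a common cell having \<open>F\<close> as a face. So \<open>C\<close> and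
  \<open>A\<close> coincide near this point.\<close>

lemma gluing_private_face:
  fixes A B C :: "'a::euclidean_space set set"
  assumes gl: "gluing C A B" and F: "F \<in> A" "F \<notin> B"
  shows "F \<in> bdry C \<longleftrightarrow> F \<in> bdry A" "solid_angle F C = solid_angle F A"
proof -
  note A = polytopal_complexD[OF gluingD(3)[OF gl]] and B = polytopal_complexD[OF gluingD(4)[OF gl]]
  have FC: "F \<in> C" using F gluingD(5)[OF gl] by blast
  have main: "(F \<in> bdry C \<longleftrightarrow> F \<in> bdry A) \<and> solid_angle F C = solid_angle F A" if ne: "F \<noteq> {}"
  proof -
    obtain x where x: "x \<in> rel_interior F" using ne rel_interior_eq_empty[OF A(6)[OF F(1)]] by auto
    then have xF: "x \<in> F" using rel_interior_subset by blast
    have "x \<notin> \<Union>B"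
    proof
      assume "x \<in> \<Union>B"
      then obtain G where G: "G \<in> A" "G \<in> B" "x \<in> G" using gluingD(6)[OF gl] F(1) xF by blast
      have "F \<subseteq> G" using complex_cell_subset[OF gluingD(3)[OF gl] F(1) G(1) x G(3)] .
      then have "F face_of G" using A(5)[OF F(1) G(1)] by (simp add: Int_absorb2)
      then show False using B(3)[OF G(2)] F(2) by blast
    qed
    then have "x \<in> - \<Union>B" by blast
    then obtain e where e: "e > 0" "ball x e \<subseteq> - \<Union>B"
      using openE[OF open_Compl[OF B(10)]] by blast
    have same: "ball x e \<inter> \<Union>C = ball x e \<inter> \<Union>A" using e gluingD(9)[OF gl] by blast
    have "x \<in> interior (\<Union>C) \<longleftrightarrow> x \<in> interior (\<Union>A)"
    proof
      assume "x \<in> interior (\<Union>C)"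
      then have "x \<in> interior (ball x e \<inter> \<Union>C)" using e by (simp add: interior_Int)
      then show "x \<in> interior (\<Union>A)" unfolding same by (simp add: interior_Int)
    next
      assume "x \<in> interior (\<Union>A)"
      then show "x \<in> interior (\<Union>C)" using interior_mono[of "\<Union>A" "\<Union>C"] gluingD(9)[OF gl] by blast
    qed
    then have 1: "F \<in> bdry C \<longleftrightarrow> F \<in> bdry A"
      using bdry_iff[OF polytopal_complex_gluing[OF gl] FC x] bdry_iff[OF gluingD(3)[OF gl] F(1) x] by simp
    have "\<forall>\<^sub>F r in at_right 0. ball_density x (\<Union>C) r = ball_density x (\<Union>A) r"
    proof (rule eventually_at_right_0_small[OF e(1)])
      fix r assume "0 < r" "r < e"
      then have "cball x r \<inter> \<Union>C = cball x r \<inter> \<Union>A" using same by (auto simp: set_eq_iff)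
      then show "ball_density x (\<Union>C) r = ball_density x (\<Union>A) r" by (simp add: ball_density_def)
    qed
    then have "\<forall>\<^sub>F r in at_right (0::real). solid_angle F C = solid_angle F A"
      using solid_angle_density[OF polytopal_complex_gluing[OF gl] FC x] solid_angle_density[OF gluingD(3)[OF gl] F(1) x]
      by eventually_elim simp
    then show ?thesis using 1 by (simp add: trivial_limit_at_right_real)
  qed
  \<comment> \<open>For the empty cell the condition in \<open>solid_angle\<close> is vacuous, so
    both sides are the same unspecified number.\<close>
  have empty: "(F \<in> bdry C \<longleftrightarrow> F \<in> bdry A) \<and> solid_angle F C = solid_angle F A" if "F = {}"
    using that F FC by (simp add: bdry_def solid_angle_def)
  show "F \<in> bdry C \<longleftrightarrow> F \<in> bdry A" "solid_angle F C = solid_angle F A" using main empty by blast+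
qed

text \<open>The overlap of the two complexes lies in a frontier and is negligible, so densities add.
  Around a relative interior point of a cell outside the boundary, \<open>C\<close> fills a whole
  ball.\<close>

lemma gluing_common_face:
  fixes A B C :: "'a::euclidean_space set set"
  assumes gl: "gluing C A B" and F: "F \<in> A" "F \<in> B" "F \<noteq> {}"
  shows "solid_angle F C = solid_angle F A + solid_angle F B" "F \<notin> bdry C \<Longrightarrow> solid_angle F C = 1"
proof -
  note A = polytopal_complexD[OF gluingD(3)[OF gl]] and B = polytopal_complexD[OF gluingD(4)[OF gl]]
  note C = polytopal_complex_gluing[OF gl]
  have FC: "F \<in> C" using F gluingD(5)[OF gl] by blast
  obtain x where x: "x \<in> rel_interior F" using F(3) rel_interior_eq_empty A(6)[OF F(1)] by blast
  have add: "ball_density x (\<Union>C) r = ball_density x (\<Union>A) r + ball_density x (\<Union>B) r" for r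
  proof -
    have "measure lebesgue (cball x r \<inter> \<Union>C) = measure lebesgue (cball x r \<inter> \<Union>A) + measure lebesgue (cball x r \<inter> \<Union>B) + measure lebesgue ({}::'a set)"
    proof (rule measure_Un3_negligible)
      show "cball x r \<inter> \<Union>A \<in> lmeasurable" "cball x r \<inter> \<Union>B \<in> lmeasurable"
        using A(10) B(10) by (auto intro!: lmeasurable_compact compact_Int_closed)
      show "negligible (cball x r \<inter> \<Union>A \<inter> (cball x r \<inter> \<Union>B))"
        by (rule negligible_subset[OF negligible_frontier_complex[OF gluingD(3)[OF gl]]])
           (use gluingD(10)[OF gl] in blast)
      show "cball x r \<inter> \<Union>A \<union> cball x r \<inter> \<Union>B \<union> {} = cball x r \<inter> \<Union>C"
        using gluingD(9)[OF gl] by blast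
    qed auto
    then show ?thesis by (simp add: ball_density_def add_divide_distrib)
  qed
  have "\<forall>\<^sub>F r in at_right (0::real). solid_angle F C = solid_angle F A + solid_angle F B"
    using solid_angle_density[OF C FC x] solid_angle_density[OF gluingD(3)[OF gl] F(1) x]
      solid_angle_density[OF gluingD(4)[OF gl] F(2) x]
    by eventually_elim (simp add: add)
  then show "solid_angle F C = solid_angle F A + solid_angle F B" by (simp add: trivial_limit_at_right_real)
  assume "F \<notin> bdry C"
  then have "x \<in> interior (\<Union>C)" using bdry_iff[OF C FC x] by blast
  then obtain e where e: "e > 0" "ball x e \<subseteq> \<Union>C" using mem_interior by blast
  have "\<forall>\<^sub>F r in at_right 0. ball_density x (\<Union>C) r = 1"
  proof (rule eventually_at_right_0_small[OF e(1)])
    fix r assume r: "0 < r" "r < e"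
    then have "cball x r \<subseteq> ball x e" by auto
    then have "cball x r \<inter> \<Union>C = cball x r" using e(2) by blast
    then show "ball_density x (\<Union>C) r = 1" using r less_imp_neq[OF unit_ball_vol_pos[of "real DIM('a)"]] by (simp add: ball_density_def content_cball)
  qed
  then have "\<forall>\<^sub>F r in at_right (0::real). solid_angle F C = 1"
    using solid_angle_density[OF C FC x] by eventually_elim simp
  then show "solid_angle F C = 1" by (simp add: trivial_limit_at_right_real)
qed

section \<open>Alternating sums over boundary faces\<close>

lemma sum_faces_dim:
  fixes K :: "'a::euclidean_space set set" and w :: "'a set \<Rightarrow> 'b::comm_ring_1"
  assumes "finite K" "\<And>F. F \<in> K \<Longrightarrow> aff_dim F < int d"
  shows "(\<Sum>i<d. (-1) ^ i * (\<Sum>F\<in>faces_dim i K. w F)) = (\<Sum>F\<in>K - {{}}. (-1) ^ nat (aff_dim F) * w F)"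
proof -
  have nonneg: "aff_dim F \<ge> 0" if "F \<noteq> {}" for F :: "'a set"
    using that by (metis aff_dim_negative_iff linorder_not_le)
  have eq: "faces_dim i K = {F \<in> K - {{}}. nat (aff_dim F) = i}" for i
  proof -
    have "aff_dim F = int i \<longleftrightarrow> F \<noteq> {} \<and> nat (aff_dim F) = i" for F :: "'a set"
      using nonneg[of F] by (cases "F = {}") auto
    then show ?thesis by (auto simp: faces_dim_def)
  qed
  have "(\<Sum>i<d. (-1) ^ i * (\<Sum>F\<in>faces_dim i K. w F))
      = (\<Sum>i<d. \<Sum>F\<in>{F \<in> K - {{}}. nat (aff_dim F) = i}. (-1) ^ nat (aff_dim F) * w F)"
    unfolding eq by (simp add: sum_distrib_left)
  also have "\<dots> = (\<Sum>F\<in>K - {{}}. (-1) ^ nat (aff_dim F) * w F)"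
  proof (rule sum.group)
    show "(\<lambda>F. nat (aff_dim F)) ` (K - {{}}) \<subseteq> {..<d}"
    proof (rule image_subsetI)
      fix F assume "F \<in> K - {{}}"
      then show "nat (aff_dim F) \<in> {..<d}" using assms(2)[of F] nonneg[of F] by (simp add: nat_less_iff)
    qed
  qed (use assms in auto)
  finally show ?thesis .
qed

lemma euler_char_bdry:
  fixes K :: "'a::euclidean_space set set"
  assumes K: "polytopal_complex K"
  shows "euler_char (bdry K) = cell_euler (bdry K)"
  using sum_faces_dim[of "bdry K" "DIM('a)" "\<lambda>_. 1::int"] polytopal_complexD(1)[OF K] bdry_aff_dim[OF K]
  by (simp add: euler_char_def cell_euler_def bdry_def)

lemma angle_char_sum:
  fixes K :: "'a::euclidean_space set set"
  assumes K: "polytopal_complex K"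
  shows "angle_char K = (\<Sum>F\<in>bdry K - {{}}. (-1) ^ nat (aff_dim F) * solid_angle F K)"
  using sum_faces_dim[of "bdry K" "DIM('a)" "\<lambda>F. solid_angle F K"] polytopal_complexD(1)[OF K] bdry_aff_dim[OF K]
  by (simp add: angle_char_def angle_sum_def bdry_def)

text \<open>Cells of \<open>N\<close> are counted in both boundaries, but in that of
  \<open>C\<close> only once, or not at all if they are in \<open>E\<close>; this gives one
  correction over \<open>N\<close> and one over \<open>E\<close>. Solid angles add up on
  \<open>N\<close> by themselves, and only the angles 1 of the cells in \<open>E\<close> are missing
  from \<open>angle_char C\<close>.\<close>

lemma gluing_characters:
  fixes A B C :: "'a::euclidean_space set set"
  assumes gl: "gluing C A B"
  defines "N \<equiv> A \<inter> B - {{}}"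
  defines "E \<equiv> {F \<in> N. F \<notin> bdry C}"
  shows "euler_char (bdry C) = euler_char (bdry A) + euler_char (bdry B)
      - (\<Sum>F\<in>N. (-1) ^ nat (aff_dim F)) - (\<Sum>F\<in>E. (-1) ^ nat (aff_dim F))"
    and "angle_char C = angle_char A + angle_char B - (\<Sum>F\<in>E. (-1) ^ nat (aff_dim F))"
proof -
  note C = polytopal_complex_gluing[OF gl]
  let ?s = "\<lambda>F::'a set. (-1) ^ nat (aff_dim F)"
  define a where "a = bdry A - {{}} - N"
  define b where "b = bdry B - {{}} - N"
  have fin: "finite A" "finite B" using polytopal_complexD(1) gluingD[OF gl] by auto
  then have f: "finite a" "finite b" "finite N" "finite E" by (auto simp: a_def b_def N_def E_def bdry_def)
  have aB: "F \<in> A \<and> F \<notin> B" if "F \<in> a" for F using that by (auto simp: a_def N_def bdry_def)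
  have bA: "F \<in> B \<and> F \<notin> A" if "F \<in> b" for F using that by (auto simp: b_def N_def bdry_def)
  have bdA: "bdry A - {{}} = a \<union> N" "a \<inter> N = {}" and bdB: "bdry B - {{}} = b \<union> N" "b \<inter> N = {}"
    using gluingD(7,8)[OF gl] by (auto simp: a_def b_def N_def)
  have bdC: "bdry C - {{}} = a \<union> b \<union> (N - E)"
  proof (intro equalityI subsetI)
    fix F assume F: "F \<in> bdry C - {{}}"
    then have "F \<in> A \<union> B" using gluingD(5)[OF gl] by (auto simp: bdry_def)
    then consider "F \<in> A" "F \<in> B" | "F \<in> A" "F \<notin> B" | "F \<in> B" "F \<notin> A" by blast
    then show "F \<in> a \<union> b \<union> (N - E)"
    proof cases
      case 1 then show ?thesis using F by (auto simp: N_def E_def)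
    next
      case 2 then show ?thesis using F gluing_private_face(1)[OF gl 2] by (auto simp: a_def N_def)
    next
      case 3 then show ?thesis using F gluing_private_face(1)[OF gluing_sym[OF gl] 3] by (auto simp: b_def N_def)
    qed
  next
    fix F assume "F \<in> a \<union> b \<union> (N - E)"
    then consider "F \<in> a" | "F \<in> b" | "F \<in> N - E" by blast
    then show "F \<in> bdry C - {{}}"
    proof cases
      case 1 then show ?thesis using aB gluing_private_face(1)[OF gl, of F] by (auto simp: a_def)
    next
      case 2 then show ?thesis using bA gluing_private_face(1)[OF gluing_sym[OF gl], of F] by (auto simp: b_def)
    next
      case 3 then show ?thesis by (auto simp: E_def N_def)
    qed
  qed
  have EN: "E \<subseteq> N" by (auto simp: E_def)
  have sC: "(\<Sum>F\<in>bdry C - {{}}. w F) = sum w a + sum w b + (sum w N - sum w E)" for w :: "'a set \<Rightarrow> 'b::ab_group_add"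
  proof -
    have "a \<inter> b = {}" "(a \<union> b) \<inter> (N - E) = {}" using aB bA bdA bdB by blast+
    then show ?thesis unfolding bdC using f EN by (simp add: sum.union_disjoint sum_diff)
  qed
  have sA: "(\<Sum>F\<in>bdry A - {{}}. w F) = sum w a + sum w N" and sB: "(\<Sum>F\<in>bdry B - {{}}. w F) = sum w b + sum w N"
    for w :: "'a set \<Rightarrow> 'b::ab_group_add"
    using f bdA bdB by (simp_all add: sum.union_disjoint)
  show "euler_char (bdry C) = euler_char (bdry A) + euler_char (bdry B) - sum ?s N - sum ?s E"
    unfolding euler_char_bdry[OF C] euler_char_bdry[OF gluingD(3)[OF gl]] euler_char_bdry[OF gluingD(4)[OF gl]] cell_euler_def sA sB sC
    by simp
  have ca: "(\<Sum>F\<in>a. ?s F * solid_angle F C) = (\<Sum>F\<in>a. ?s F * solid_angle F A)"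
    by (rule sum.cong) (use aB gluing_private_face(2)[OF gl] in auto)
  have cb: "(\<Sum>F\<in>b. ?s F * solid_angle F C) = (\<Sum>F\<in>b. ?s F * solid_angle F B)"
    by (rule sum.cong) (use bA gluing_private_face(2)[OF gluing_sym[OF gl]] in auto)
  have cN: "(\<Sum>F\<in>N. ?s F * solid_angle F C) = (\<Sum>F\<in>N. ?s F * solid_angle F A) + (\<Sum>F\<in>N. ?s F * solid_angle F B)"
    unfolding sum.distrib[symmetric]
    by (rule sum.cong) (auto simp: N_def gluing_common_face(1)[OF gl] distrib_left)
  have cE: "(\<Sum>F\<in>E. ?s F * solid_angle F C) = (\<Sum>F\<in>E. ?s F)"
    by (rule sum.cong) (auto simp: E_def N_def gluing_common_face(2)[OF gl])
  show "angle_char C = angle_char A + angle_char B - (\<Sum>F\<in>E. ?s F)"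
    unfolding angle_char_sum[OF C] angle_char_sum[OF gluingD(3)[OF gl]] angle_char_sum[OF gluingD(4)[OF gl]] sA sB sC ca cb cN cE
    by simp
qed

section \<open>The faces that become interior\<close>

lemma unpinched_interior:
  fixes A B C :: "'a::euclidean_space set set"
  assumes gl: "gluing C A B" and "unpinched_along A J" "unpinched_along B J"
    and J: "J \<subseteq> \<Union>(A \<inter> B)" and x: "x \<in> J"
  shows "x \<in> interior (\<Union>C)"
proof -
  \<comment> \<open>\<open>J\<close> is open in the frontier of each complex, so near
    \<open>x\<close> this frontier lies in \<open>J\<close> and hence in common cells.\<close>
  have near: "\<exists>e>0. frontier (\<Union>K) \<inter> ball x e \<subseteq> \<Union>(A \<inter> B)" if "polytopal_complex K" "unpinched_along K J" for K
    using that(2) x J unfolding unpinched_along_def Union_bdry[OF that(1)] openin_contains_ball by blast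
  obtain e1 e2 where e: "e1 > 0" "frontier (\<Union>A) \<inter> ball x e1 \<subseteq> \<Union>(A \<inter> B)"
      "e2 > 0" "frontier (\<Union>B) \<inter> ball x e2 \<subseteq> \<Union>(A \<inter> B)"
    using near gluingD(3,4)[OF gl] assms(2,3) by meson
  have "x \<in> \<Union>A" using J x by blast
  then have "x \<in> interior (\<Union>A \<union> \<Union>B)"
    using e by (intro glued_interior_point[OF gl, of "min e1 e2"]) auto
  then show ?thesis by (simp only: gluingD(9)[OF gl])
qed

text \<open>Near the rim point the complexes meet only in the disc. If they covered a ball there, a
  connected set in it off the disc would be contained in one of two closed sets that are disjoint on
  it. Yet purity gives interior points of both complexes arbitrarily near the rim point, and these
  are joined off the disc.\<close>

lemma disc_boundary_not_interior:
  fixes A B C :: "'a::euclidean_space set set"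
  assumes gl: "gluing C A B"
    and fg: "homeomorphism (cball 0 1 \<inter> {x::'a. x \<bullet> b = 0}) D f g"
    and b: "b \<in> Basis" and u: "u \<in> sphere 0 1" "u \<bullet> b = 0"
    and D: "D \<subseteq> \<Union>A \<inter> \<Union>B" and e: "e > 0" "ball (f u) e \<inter> (\<Union>A \<inter> \<Union>B) \<subseteq> D"
  shows "f u \<notin> interior (\<Union>C)"
proof
  assume "f u \<in> interior (\<Union>C)"
  then obtain e1 where e1: "e1 > 0" "ball (f u) e1 \<subseteq> \<Union>A \<union> \<Union>B"
    using mem_interior gluingD(9)[OF gl] by metis
  define e2 where "e2 = min e e1"
  have "e2 > 0" using e e1 by (simp add: e2_def)
  then obtain \<delta> where \<delta>: "\<delta> > 0"
    "\<And>p q. p \<in> ball (f u) \<delta> - D \<Longrightarrow> q \<in> ball (f u) \<delta> - D \<Longrightarrow> connected_component (ball (f u) e2 - D) p q"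
    using disc_boundary_not_separating[OF fg b u] by metis
  have "u \<in> cball 0 1 \<inter> {x. x \<bullet> b = 0}" using u by simp
  then have "f u \<in> D" using fg by (auto simp: homeomorphism_def)
  have near: "\<exists>p. p \<in> interior (\<Union>K) \<and> p \<in> ball (f u) \<delta>" if "geometric_complex K" "D \<subseteq> \<Union>K" for K
  proof -
    have "f u \<in> closure (interior (\<Union>K))"
      using geometric_complex_closure_interior[OF that(1)] that(2) \<open>f u \<in> D\<close> by blast
    then show ?thesis using \<delta>(1) unfolding closure_approachable by (metis dist_commute mem_ball)
  qed
  obtain p where p: "p \<in> interior (\<Union>A)" "p \<in> ball (f u) \<delta>" using near[of A] gluingD(1)[OF gl] D by blast
  obtain q where q: "q \<in> interior (\<Union>B)" "q \<in> ball (f u) \<delta>" using near[of B] gluingD(2)[OF gl] D by blast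
  have pA: "p \<in> \<Union>A" and qB: "q \<in> \<Union>B" using p q interior_subset by blast+
  have pB: "p \<notin> \<Union>B" and qA: "q \<notin> \<Union>A"
    using p q pA qB gluingD(10,11)[OF gl] unfolding frontier_def by blast+
  then have "connected_component (ball (f u) e2 - D) p q"
    using p q D by (intro \<delta>(2)) auto
  then obtain T where T: "connected T" "T \<subseteq> ball (f u) e2 - D" "p \<in> T" "q \<in> T"
    unfolding connected_component_def by blast
  have "ball (f u) e2 \<subseteq> ball (f u) e" "ball (f u) e2 \<subseteq> ball (f u) e1" by (auto simp: e2_def)
  then have "T \<subseteq> \<Union>A \<union> \<Union>B" "\<Union>A \<inter> \<Union>B \<inter> T = {}" using T(2) e(2) e1(2) by blast+
  moreover have "closed (\<Union>A)" "closed (\<Union>B)"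
    using polytopal_complexD(10) gluingD(3,4)[OF gl] by blast+
  ultimately have "\<Union>A \<inter> T = {} \<or> \<Union>B \<inter> T = {}"
    using connected_closedD[OF T(1)] by blast
  then show False using pA qB T by blast
qed

lemma hyperplane_disc:
  fixes b :: "'a::euclidean_space"
  assumes b: "b \<in> Basis"
  defines "H \<equiv> {x. x \<bullet> b = 0}"
  shows "convex (cball 0 1 \<inter> H)" "compact (cball 0 1 \<inter> H)" "cball 0 1 \<inter> H \<noteq> {}"
    "aff_dim (cball 0 1 \<inter> H) = int (DIM('a) - 1)" "rel_frontier (cball 0 1 \<inter> H) = sphere 0 1 \<inter> H"
proof -
  have H: "H = {x. b \<bullet> x = 0}" by (simp add: H_def inner_commute)
  have aH: "affine H" "convex H" "closed H"
    unfolding H by (rule affine_hyperplane, rule convex_hyperplane, rule closed_hyperplane)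
  have b0: "b \<noteq> 0" using b nonzero_Basis by blast
  show "convex (cball 0 1 \<inter> H)" "compact (cball 0 1 \<inter> H)"
    using aH by (auto intro: convex_Int compact_Int_closed)
  have 0: "0 \<in> interior (cball 0 1) \<inter> H" by (simp add: H_def)
  then show "cball 0 1 \<inter> H \<noteq> {}" using interior_subset by blast
  have "aff_dim (H \<inter> cball 0 1) = aff_dim H"
    by (rule aff_dim_convex_Int_nonempty_interior) (use aH 0 in auto)
  also have "\<dots> = int (DIM('a)) - 1"
    unfolding H using b0 DIM_positive[where 'a='a] by (simp add: aff_dim_hyperplane of_nat_diff Suc_leI)
  finally show "aff_dim (cball 0 1 \<inter> H) = int (DIM('a) - 1)"
    using DIM_positive[where 'a='a] by (simp add: Int_commute of_nat_diff Suc_leI)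
  show "rel_frontier (cball 0 1 \<inter> H) = sphere 0 1 \<inter> H"
    using convex_affine_rel_frontier_Int[OF convex_cball aH(1)] 0 by (metis empty_iff frontier_cball)
qed

text \<open>All nonempty cells of \<open>K\<close> sum to the Euler characteristic 1 of a ball.
  Those in the boundary of \<open>C\<close> triangulate no more and no less than the rim, a sphere
  of dimension \<open>d - 2\<close>, and sum to 1 - (-1)^(d - 1). The difference belongs to the
  cells that become interior.\<close>

lemma gluing_disc_sums:
  fixes A B C K :: "'a::euclidean_space set set"
  assumes gl: "gluing C A B" and K: "polytopal_complex K" "K - {{}} \<subseteq> A \<inter> B"
    and ball: "codim1_ball (\<Union>K) J" and un: "unpinched_along A J" "unpinched_along B J"
    and sep: "\<And>x. x \<in> \<Union>K \<Longrightarrow> \<exists>e>0. ball x e \<inter> (\<Union>A \<inter> \<Union>B) \<subseteq> \<Union>K"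
  shows "(\<Sum>F\<in>K - {{}}. (-1) ^ nat (aff_dim F)) = (1::int)"
    and "(\<Sum>F\<in>{F \<in> K - {{}}. F \<notin> bdry C}. (-1) ^ nat (aff_dim F)) = ((-1) ^ (DIM('a) - 1) :: int)"
proof -
  note K' = polytopal_complexD[OF K(1)]
  obtain b f g where b: "b \<in> Basis" and fg: "homeomorphism (cball 0 1 \<inter> {x::'a. x \<bullet> b = 0}) (\<Union>K) f g"
    and J: "J = f ` (ball 0 1 \<inter> {x. x \<bullet> b = 0})"
    using ball unfolding codim1_ball_def by blast
  define H where "H = {x::'a. x \<bullet> b = 0}"
  note fg = fg[folded H_def] and J = J[folded H_def] and disc = hyperplane_disc[OF b, folded H_def]
  have fD: "f ` (cball 0 1 \<inter> H) = \<Union>K" and inj: "inj_on f (cball 0 1 \<inter> H)"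
    using fg by (auto simp: homeomorphism_def intro!: inj_on_inverseI[where g = g])
  define S where "S = f ` (sphere 0 1 \<inter> H)"
  have KSJ: "\<Union>K = S \<union> J"
    unfolding S_def J fD[symmetric] image_Un[symmetric] by (rule arg_cong[of _ _ "image f"]) auto
  have SJ: "S \<inter> J = {}"
  proof -
    have "f ` (sphere 0 1 \<inter> H) \<inter> f ` (ball 0 1 \<inter> H) = f ` ((sphere 0 1 \<inter> H) \<inter> (ball 0 1 \<inter> H))"
      by (rule inj_on_image_Int[OF inj, symmetric]) auto
    then show ?thesis unfolding S_def J by auto
  qed
  have KAB: "\<Union>K \<subseteq> \<Union>(A \<inter> B)" using K(2) by blast
  then have KXY: "\<Union>K \<subseteq> \<Union>A \<inter> \<Union>B" by blast
  have Jint: "x \<in> interior (\<Union>C)" if "x \<in> J" for x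
    using unpinched_interior[OF gl un _ that] KAB KSJ by blast
  have Sint: "x \<notin> interior (\<Union>C)" if xS: "x \<in> S" for x
  proof -
    obtain u where u: "u \<in> sphere 0 1" "u \<bullet> b = 0" "x = f u" using xS by (auto simp: S_def H_def)
    obtain e where "e > 0" "ball x e \<inter> (\<Union>A \<inter> \<Union>B) \<subseteq> \<Union>K" using sep[of x] xS KSJ by auto
    then show ?thesis using disc_boundary_not_interior[OF gl fg[unfolded H_def] b u(1,2) KXY] u(3) by blast
  qed
  show one: "(\<Sum>F\<in>K - {{}}. (-1) ^ nat (aff_dim F)) = (1::int)"
    using cell_euler_homeomorphic[OF K(1) _ pair_euler_convex[OF disc(1,3)]] fg homeomorphic_def homeomorphic_sym
    unfolding cell_euler_def by metis
  have FC: "F \<in> C" if "F \<in> K - {{}}" for F using that K(2) gluingD(5)[OF gl] by blast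
  have bd: "F \<in> bdry C \<longleftrightarrow> F \<subseteq> S" if F: "F \<in> K - {{}}" for F
  proof
    assume "F \<in> bdry C"
    then have "F \<inter> interior (\<Union>C) = {}" by (auto simp: bdry_def frontier_def)
    then show "F \<subseteq> S" using Jint KSJ F by blast
  next
    assume "F \<subseteq> S"
    obtain x where x: "x \<in> rel_interior F" using F rel_interior_eq_empty[OF K'(6), of F] by auto
    then have "x \<in> S" using \<open>F \<subseteq> S\<close> rel_interior_subset by blast
    then show "F \<in> bdry C" using bdry_iff[OF polytopal_complex_gluing[OF gl] FC[OF F] x] Sint by blast
  qed
  define G where "G = {F \<in> K. F \<subseteq> S}"
  have G: "polytopal_complex G"
    unfolding polytopal_complex_def
  proof (intro conjI ballI allI impI)
    show "F \<in> G" if "P \<in> G" "F face_of P" for P F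
      using that K'(3) face_of_imp_subset[OF that(2)] by (auto simp: G_def)
  qed (use K' in \<open>auto simp: G_def\<close>)
  have "\<Union>G = S"
  proof
    show "\<Union>G \<subseteq> S" by (auto simp: G_def)
    \<comment> \<open>The cell whose relative interior contains a rim point is a boundary cell of
      \<open>C\<close>, and such a cell lies in the rim as a whole. This is why the rim is a
      subcomplex.\<close>
    show "S \<subseteq> \<Union>G"
    proof
      fix x assume x: "x \<in> S"
      then obtain F where F: "F \<in> K" "x \<in> rel_interior F" using complex_rel_interior_cover[OF K(1), of x] KSJ by blast
      then have xF: "x \<in> F" using rel_interior_subset by blast
      then have F0: "F \<in> K - {{}}" using F by blast
      have "F \<in> bdry C" using bdry_iff[OF polytopal_complex_gluing[OF gl] FC[OF F0] F(2)] Sint[OF x] by blast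
      then show "x \<in> \<Union>G" using bd[OF F0] F xF by (auto simp: G_def)
    qed
  qed
  moreover have "S homeomorphic rel_frontier (cball 0 1 \<inter> H)"
  proof -
    have "homeomorphism (sphere 0 1 \<inter> H) S f g"
      by (rule homeomorphism_of_subsets[OF fg]) (auto simp: S_def)
    then show ?thesis unfolding disc(5) using homeomorphic_def homeomorphic_sym by blast
  qed
  ultimately have "cell_euler G = 1 - (-1) ^ (DIM('a) - 1)"
    using cell_euler_homeomorphic[OF G _ pair_euler_rel_frontier[OF disc(1,2,4)]] by simp
  moreover have "(\<Sum>F\<in>K - {{}}. (-1) ^ nat (aff_dim F))
      = (\<Sum>F\<in>{F \<in> K - {{}}. F \<notin> bdry C}. (-1) ^ nat (aff_dim F)) + cell_euler G"
  proof -
    have split: "K - {{}} = {F \<in> K - {{}}. F \<notin> bdry C} \<union> (G - {{}})"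
      using bd by (auto simp: G_def)
    show ?thesis
      unfolding cell_euler_def
      by (subst split, rule sum.union_disjoint) (use K'(1) bd in \<open>auto simp: G_def\<close>)
  qed
  ultimately show "(\<Sum>F\<in>{F \<in> K - {{}}. F \<notin> bdry C}. (-1) ^ nat (aff_dim F)) = ((-1) ^ (DIM('a) - 1) :: int)"
    using one by simp
qed

text \<open>Removing the empty cell on both sides of the third assumption admits
  \<open>m = 0\<close>, where it is the only common cell.\<close>

theorem theorem3p3p2:
  fixes A B C :: "'a::euclidean_space set set"
    and D :: "nat \<Rightarrow> 'a set set"
    and I :: "nat \<Rightarrow> 'a set"
    and m d :: nat
  assumes "d = DIM('a)"
    and "gluing C A B"
    and "A \<inter> B - {{}} = (\<Union>i<m. D i) - {{}}"
    and "\<And>i j. i < m \<Longrightarrow> j < m \<Longrightarrow> i \<noteq> j \<Longrightarrow> \<Union>(D i) \<inter> \<Union>(D j) = {}"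
    and "\<And>i. i < m \<Longrightarrow> polytopal_complex (D i)"
    and "\<And>i. i < m \<Longrightarrow> codim1_ball (\<Union>(D i)) (I i)"
    and "\<And>i. i < m \<Longrightarrow> unpinched_along A (I i) \<and> unpinched_along B (I i)"
  shows "euler_char (bdry C) =
           euler_char (bdry A) + euler_char (bdry B) - int m * (1 + (-1) ^ (d - 1)) \<and>
         angle_char C = angle_char A + angle_char B - real m * (-1) ^ (d - 1) \<and>
         (odd d \<longrightarrow>
           real_of_int (euler_char (bdry C) - euler_char (bdry A) - euler_char (bdry B)) =
           2 * (angle_char C - angle_char A - angle_char B)) \<and>
         (even d \<longrightarrow>
           (m \<ge> 1 \<longrightarrow> angle_char C > angle_char A + angle_char B) \<and>
           euler_char (bdry C) = euler_char (bdry A) + euler_char (bdry B))"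
proof -
  note gl = assms(2)
  let ?s = "\<lambda>F::'a set. (-1) ^ nat (aff_dim F)"
  define E where "E = {F \<in> A \<inter> B - {{}}. F \<notin> bdry C}"
  have sub: "D i - {{}} \<subseteq> A \<inter> B" if "i < m" for i using assms(3) that by blast
  have XY: "\<Union>A \<inter> \<Union>B = (\<Union>i<m. \<Union>(D i))"
  proof -
    have "\<Union>(A \<inter> B) = \<Union>(A \<inter> B - {{}})" by blast
    also have "\<dots> = (\<Union>i<m. \<Union>(D i))" unfolding assms(3) by blast
    finally show ?thesis using gluingD(6)[OF gl] by simp
  qed
  have sep: "\<exists>e>0. ball x e \<inter> (\<Union>A \<inter> \<Union>B) \<subseteq> \<Union>(D i)" if i: "i < m" and x: "x \<in> \<Union>(D i)" for i x
  proof -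
    \<comment> \<open>The other discs form a closed set that misses \<open>x\<close>, which isolates
      the disc through \<open>x\<close>.\<close>
    define R where "R = (\<Union>j\<in>{..<m} - {i}. \<Union>(D j))"
    have "closed R" unfolding R_def using polytopal_complexD(10)[OF assms(5)] by (intro closed_UN) auto
    moreover have "x \<notin> R" using assms(4)[OF i] x by (fastforce simp: R_def)
    ultimately obtain e where "e > 0" "ball x e \<subseteq> - R" using openE[OF open_Compl] by blast
    moreover have "\<Union>A \<inter> \<Union>B \<subseteq> R \<union> \<Union>(D i)" unfolding XY R_def by blast
    ultimately show ?thesis by blast
  qed
  have disj: "(D i - {{}}) \<inter> (D j - {{}}) = {}" if "i < m" "j < m" "i \<noteq> j" for i j
    using assms(4)[OF that] by blast
  have fin: "finite (D i)" if "i < m" for i using polytopal_complexD(1)[OF assms(5)[OF that]] .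
  have sums: "(\<Sum>F\<in>D i - {{}}. ?s F) = (1::int)" "(\<Sum>F\<in>{F \<in> D i - {{}}. F \<notin> bdry C}. ?s F) = ((-1) ^ (d - 1) :: int)" if "i < m" for i
    unfolding assms(1) using gluing_disc_sums[OF gl assms(5)[OF that] sub[OF that] assms(6)[OF that]]
      assms(7)[OF that] sep[OF that] by blast+
  have NU: "A \<inter> B - {{}} = (\<Union>i<m. D i - {{}})" using assms(3) by blast
  have "(\<Sum>F\<in>A \<inter> B - {{}}. ?s F) = (\<Sum>i<m. \<Sum>F\<in>D i - {{}}. ?s F :: int)"
    unfolding NU using disj fin by (intro sum.UNION_disjoint) auto
  then have N: "(\<Sum>F\<in>A \<inter> B - {{}}. ?s F) = int m" using sums(1) by simp
  have EU: "E = (\<Union>i<m. {F \<in> D i - {{}}. F \<notin> bdry C})" unfolding E_def using assms(3) by blast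
  have "(\<Sum>F\<in>E. ?s F) = (\<Sum>i<m. \<Sum>F\<in>{F \<in> D i - {{}}. F \<notin> bdry C}. ?s F :: int)"
    unfolding EU using disj fin by (intro sum.UNION_disjoint) auto
  then have E: "(\<Sum>F\<in>E. ?s F) = int m * (-1) ^ (d - 1)" using sums(2) by simp
  have "(\<Sum>F\<in>E. ?s F :: real) = real_of_int (\<Sum>F\<in>E. ?s F)" by simp
  also have "\<dots> = real m * (-1) ^ (d - 1)" unfolding E by simp
  finally have E': "(\<Sum>F\<in>E. ?s F) = real m * (-1) ^ (d - 1)" .
  have 1: "euler_char (bdry C) = euler_char (bdry A) + euler_char (bdry B) - int m * (1 + (-1) ^ (d - 1))"
    using gluing_characters(1)[OF gl] N E by (simp add: E_def algebra_simps)
  have 2: "angle_char C = angle_char A + angle_char B - real m * (-1) ^ (d - 1)"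
    using gluing_characters(2)[OF gl] E' by (simp add: E_def)
  \<comment> \<open>As \<open>d\<close> is positive, \<open>d - 1\<close> has the opposite parity.
    The two corrections are thus \<open>2 * m\<close> and \<open>m\<close> for odd \<open>d\<close>,
    and 0 and \<open>- m\<close> for even \<open>d\<close>.\<close>
  have "d \<ge> 1" using assms(1) DIM_positive[where 'a='a] by simp
  then have "(-1::int) ^ (d - 1) = 1 \<and> (-1::real) ^ (d - 1) = 1" if "odd d" using that by simp
  moreover have "(-1::int) ^ (d - 1) = -1 \<and> (-1::real) ^ (d - 1) = -1" if "even d"
    using that \<open>d \<ge> 1\<close> by simp
  ultimately show ?thesis using 1 2 by auto
qed

end
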